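(* Let $P$ and $P'$ be finite sets of points in general position in the plane, and suppose that the geometric tree graphs $G(P)$ and $G(P')$ are isomorphic as abstract graphs. Then there is a bijection $\sigma:P\to P'$ such that for any four distinct points $a,b,c,d\in P$, the segments $[a,b]$ and $[c,d]$ cross if and only if the segments $[\sigma(a),\sigma(b)]$ and $[\sigma(c),\sigma(d)]$ cross. In other words, the geometric structure of $K(P)$ (the information, for every pair of vertex-disjoint edges, whether they cross) can be reconstructed, up to isomorphism, from the abstract graph $G(P)$.
   Context: General position means no three points are collinear. $K(P)$ is the complete geometric graph on $P$, whose edges are the straight segments between points of $P$. Two segments with four distinct endpoints cross if they intersect. A spanning tree of $K(P)$ is simple (an SST) if no two of its edges cross; spanning subgraphs are identified with their edge sets. The geometric tree graph $G(P)$ is the abstract graph whose vertices are the SSTs of $K(P)$, where two SSTs $T,T'$ are adjacent iff $|T\triangle T'|=2$, i.e., $T'$ is obtained from $T$ by deleting one edge and adding another edge.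
   Formalization: The case where one of P, P' has exactly one point and the other exactly two is excluded: both tree graphs are then a single vertex, hence isomorphic, but no bijection between the point sets exists. *)

theory Defs
  imports "HOL-Analysis.Analysis"
begin

text \<open>Simple undirected graphs: a vertex set together with a set of two-element edges.\<close>

type_synonym 'a graph = "'a set \<times> 'a set set"

definition graph_iso :: "'a graph \<Rightarrow> 'b graph \<Rightarrow> bool" where
  "graph_iso G H \<longleftrightarrow>
     (\<exists>f. bij_betw f (fst G) (fst H) \<and>
          (\<forall>u\<in>fst G. \<forall>v\<in>fst G. {u, v} \<in> snd G \<longleftrightarrow> {f u, f v} \<in> snd H))"

definition complete_edges :: "'a set \<Rightarrow> 'a set set" where
  "complete_edges V = {{a, b} |a b. a \<in> V \<and> b \<in> V \<and> a \<noteq> b}"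

definition connected_graph :: "'a graph \<Rightarrow> bool" where
  "connected_graph G \<longleftrightarrow>
     fst G \<noteq> {} \<and> (\<forall>u\<in>fst G. \<forall>v\<in>fst G. (u, v) \<in> {(x, y). {x, y} \<in> snd G}\<^sup>*)"

text \<open>A cycle is listed by its vertices, without repeating the first one at the end.\<close>

definition is_cycle :: "'a graph \<Rightarrow> 'a list \<Rightarrow> bool" where
  "is_cycle G c \<longleftrightarrow>
     3 \<le> length c \<and> distinct c \<and>
     (\<forall>i<length c. {c ! i, c ! (Suc i mod length c)} \<in> snd G)"

definition is_tree :: "'a graph \<Rightarrow> bool" where
  "is_tree G \<longleftrightarrow> connected_graph G \<and> (\<nexists>c. is_cycle G c)"

definition general_position :: "(real ^ 2) set \<Rightarrow> bool" where
  "general_position P \<longleftrightarrow>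
     (\<forall>a\<in>P. \<forall>b\<in>P. \<forall>c\<in>P. distinct [a, b, c] \<longrightarrow> \<not> collinear {a, b, c})"

text \<open>An edge of the complete geometric graph is represented by its pair of endpoints;
  the points themselves are those of the closed segment.\<close>

definition edges_cross :: "(real ^ 2) set \<Rightarrow> (real ^ 2) set \<Rightarrow> bool" where
  "edges_cross e f \<longleftrightarrow>
     (\<exists>a b c d. e = {a, b} \<and> f = {c, d} \<and> distinct [a, b, c, d] \<and>
                closed_segment a b \<inter> closed_segment c d \<noteq> {})"

definition simple_spanning_trees :: "(real ^ 2) set \<Rightarrow> (real ^ 2) set set set" where
  "simple_spanning_trees P =
     {T. T \<subseteq> complete_edges P \<and> is_tree (P, T) \<and> (\<forall>e\<in>T. \<forall>f\<in>T. \<not> edges_cross e f)}"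

definition geometric_tree_graph :: "(real ^ 2) set \<Rightarrow> (real ^ 2) set set graph" where
  "geometric_tree_graph P =
     (simple_spanning_trees P,
      {{T, T'} |T T'. T \<in> simple_spanning_trees P \<and> T' \<in> simple_spanning_trees P \<and>
                      card (sym_diff T T') = 2})"

end

theory Submission
  imports Defs
begin

text \<open>
  The spanning stars can be recognised in the tree graph: every neighbour of a star lies with it in a
  triangle that is contained in no complete subgraph on four vertices. A tree that is not a star has an edge
  \<open>e\<close> whose removal leaves two components with at least two vertices each. Such a forest has at
  least four non-crossing connecting edges, one of them disjoint from \<open>e\<close>, and exchanging
  \<open>e\<close> for the latter gives a neighbour without such a triangle. Hence an isomorphism \<open>f\<close>
  matches the stars, and with them the points.

  A path of length \<open>k\<close> from a tree to the star of \<open>a\<close> bounds the degree of \<open>a\<close> from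
  below. So \<open>f\<close> maps the trees in which every edge meets \<open>{a, b}\<close> and \<open>{a, b}\<close> is an edge to
  trees of the same kind. Such a tree is given by the set \<open>I\<close> of the leaves at \<open>b\<close>, and the sets that
  occur are the order ideals of the relation that segment \<open>ax\<close> crosses segment \<open>by\<close>. For at
  least five points \<open>f\<close> respects the labelling of these ideals by points, by induction on
  \<open>card I\<close>, and two segments \<open>ac\<close> and \<open>bd\<close> are disjoint iff some ideal contains \<open>d\<close>
  but not \<open>c\<close>. For four points the neighbours of the stars already determine the crossings.
\<close>

subsection \<open>Connectivity and spanning trees\<close>

text \<open>Two adjacent trees \<open>T\<close> and \<open>T - e + g\<close> have common neighbours
  of two kinds: trees over the forest \<open>T - e\<close>, one for each further connector, and
  trees inside \<open>T + g\<close>, one for each further cycle edge whose removal leaves no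
  crossing. Trees of one kind are pairwise adjacent. Next to a star the cycle has length three, so
  its trees form a triangle that cannot be enlarged. The bound of four connectors enlarges every
  triangle of the first kind, and the disjointness of the new connector from \<open>e\<close> makes
  the cycle longer than three, which does the same for the second kind. Let \<open>n\<close> be the
  number of points. A double star with \<open>i\<close> leaves at \<open>b\<close> has walks of
  lengths \<open>i\<close> and \<open>n - 2 - i\<close> to the stars of \<open>a\<close> and
  \<open>b\<close>. Its image has degrees at least \<open>n - 1 - i\<close> and \<open>i + 1\<close>
  at the two centres, in sum one more than its \<open>n - 1\<close> edges, so all its edges are at a
  centre. The obstacle is that this fixes the size of the leaf set but not its members:
  \<open>f\<close> is not known to be induced by a map of points, and for four points it may permute
  the trees next to a star.\<close>

definition conn :: "'a set set \<Rightarrow> 'a \<Rightarrow> 'a \<Rightarrow> bool" where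
  "conn E u v \<longleftrightarrow> (u, v) \<in> {(x, y). {x, y} \<in> E}\<^sup>*"

lemma conn_refl [simp]: "conn E u u"
  by (simp add: conn_def)

lemma conn_trans: "conn E u v \<Longrightarrow> conn E v w \<Longrightarrow> conn E u w"
  unfolding conn_def by (rule rtrancl_trans)

lemma conn_edge: "{u, v} \<in> E \<Longrightarrow> conn E u v"
  unfolding conn_def by auto

lemma conn_induct [consumes 1, case_names refl step]:
  assumes "conn E u v" "Q u" "\<And>x y. conn E u x \<Longrightarrow> {x, y} \<in> E \<Longrightarrow> Q x \<Longrightarrow> Q y"
  shows "Q v"
  using assms(1) unfolding conn_def
proof (induction rule: rtrancl_induct)
  case base
  then show ?case by fact
next
  case (step y z)
  then show ?case using assms(3)[of y z] by (simp add: conn_def)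
qed

lemma conn_lift:
  assumes "conn E u v" "\<And>x y. {x, y} \<in> E \<Longrightarrow> conn E' x y"
  shows "conn E' u v"
  using assms(1) by (induction rule: conn_induct) (auto intro: conn_trans assms(2))

lemma conn_mono: "conn E u v \<Longrightarrow> E \<subseteq> E' \<Longrightarrow> conn E' u v"
  by (erule conn_lift) (auto intro: conn_edge)

lemma conn_sym: "conn E u v \<Longrightarrow> conn E v u"
proof (induction rule: conn_induct)
  case (step x y)
  have "conn E y x" by (rule conn_edge) (use step.hyps in \<open>simp add: insert_commute\<close>)
  then show ?case using step.IH by (rule conn_trans)
qed simp

text \<open>The device for refuting connectivity: a set that contains \<open>u\<close>, is closed
  under the edges and misses \<open>v\<close>.\<close>

lemma conn_closed:
  assumes "conn E u v" "u \<in> A" "\<And>x y. {x, y} \<in> E \<Longrightarrow> x \<in> A \<Longrightarrow> y \<in> A"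
  shows "v \<in> A"
  using assms(1,2) by (induction rule: conn_induct) (auto intro: assms(3))

text \<open>A walk need not use the new edge twice, so it is split at most once, with the edge
  traversed in either direction.\<close>

lemma conn_insert:
  "conn (insert {p, q} E) u v \<longleftrightarrow>
     conn E u v \<or> conn E u p \<and> conn E q v \<or> conn E u q \<and> conn E p v"  (is "?l \<longleftrightarrow> ?r")
proof
  assume ?l
  then show ?r
  proof (induction rule: conn_induct)
    case (step x y)
    from \<open>{x, y} \<in> insert {p, q} E\<close> consider "{x, y} \<in> E" | "x = p" "y = q" | "x = q" "y = p"
      by (auto simp: doubleton_eq_iff)
    then show ?case
      using step.IH by cases (auto intro: conn_trans conn_edge)
  qed simp
next
  have 1: "conn E a b \<Longrightarrow> conn (insert {p, q} E) a b" for a b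
    by (erule conn_mono) auto
  have 2: "conn (insert {p, q} E) p q" "conn (insert {p, q} E) q p"
    by (rule conn_edge, simp add: insert_commute)+
  assume ?r
  then show ?l
    using 1 2 by (meson conn_trans)
qed

lemma conn_delete:
  assumes "\<forall>x\<in>P. conn T p x"  "x \<in> P"
  shows "conn (T - {{p, q}}) p x \<or> conn (T - {{p, q}}) q x"
proof -
  have "conn (insert {p, q} (T - {{p, q}})) p x"
    by (rule conn_mono[of T]) (use assms in auto)
  then show ?thesis
    unfolding conn_insert by blast
qed

text \<open>The walk from \<open>y\<close> is followed until it would step onto \<open>z\<close>;
  the vertex before that step is \<open>x\<close>. Later this finds the edge at a prescribed end of
  a new edge on the cycle that the new edge closes.\<close>

lemma conn_first_edge:
  assumes "conn E y v" "y \<noteq> z"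
  shows "conn {e \<in> E. z \<notin> e} y v \<or> (\<exists>x. {z, x} \<in> E \<and> conn {e \<in> E. z \<notin> e} y x)"
  using assms(1)
proof (induction rule: conn_induct)
  case (step v w)
  show ?case
  proof (cases "\<exists>x. {z, x} \<in> E \<and> conn {e \<in> E. z \<notin> e} y x")
    case False
    then have v: "conn {e \<in> E. z \<notin> e} y v" using step.IH by blast
    have "v \<noteq> z"
    proof
      assume "v = z"
      have "{z} \<inter> {x. conn {e \<in> E. z \<notin> e} y x} = {}"
      proof -
        have "z \<in> - {z}" if "conn {e \<in> E. z \<notin> e} y z"
          by (rule conn_closed[OF that]) (use assms(2) in auto)
        then show ?thesis by auto
      qed
      then show False using v \<open>v = z\<close> by auto
    qed
    moreover have "w \<noteq> z"
      using False v step.hyps(2) by (auto simp: insert_commute)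
    ultimately have "conn {e \<in> E. z \<notin> e} y w"
      using v step.hyps(2) by (auto intro: conn_trans conn_edge)
    then show ?thesis by blast
  qed blast
qed simp

lemma conn_path:
  assumes "conn E u v"
  obtains xs where "distinct xs" "xs \<noteq> []" "hd xs = u" "last xs = v"
    "successively (\<lambda>x y. {x, y} \<in> E) xs"
proof -
  have "\<exists>xs. distinct xs \<and> xs \<noteq> [] \<and> hd xs = u \<and> last xs = v \<and> successively (\<lambda>x y. {x, y} \<in> E) xs"
    using assms unfolding conn_def
  proof (induction rule: converse_rtrancl_induct)
    case base
    show ?case by (rule exI[of _ "[v]"]) auto
  next
    case (step y z)
    then obtain xs where xs: "distinct xs" "xs \<noteq> []" "hd xs = z" "last xs = v"
      "successively (\<lambda>x y. {x, y} \<in> E) xs" by blast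
    show ?case
    proof (cases "y \<in> set xs")
      case True
      then obtain as bs where "xs = as @ y # bs" by (meson split_list)
      then show ?thesis using xs
        by (intro exI[of _ "y # bs"]) (auto simp: successively_append_iff)
    next
      case False
      then show ?thesis using xs step.hyps(1)
        by (intro exI[of _ "y # xs"]) (auto simp: successively_Cons)
    qed
  qed
  then show ?thesis using that by blast
qed

text \<open>A path from \<open>u\<close> to \<open>v\<close> that avoids the edge
  \<open>{u, v}\<close> is closed by it. The path has a third vertex, since with two it would
  consist of that edge.\<close>

lemma cycle_of_conn:
  assumes "{u, v} \<in> E" "u \<noteq> v" "conn (E - {{u, v}}) u v"
  shows "\<exists>c. is_cycle (P, E) c"
proof -
  obtain xs where xs: "distinct xs" "xs \<noteq> []" "hd xs = u" "last xs = v"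
    "successively (\<lambda>x y. {x, y} \<in> E - {{u, v}}) xs"
    using conn_path[OF assms(3)] by metis
  have l3: "3 \<le> length xs"
  proof (rule ccontr)
    assume "\<not> 3 \<le> length xs"
    then consider "length xs = 0" | "length xs = 1" | "length xs = 2" by linarith
    then show False
    proof cases
      case 3
      then obtain a b where "xs = [a, b]" by (auto simp: length_Suc_conv numeral_2_eq_2)
      then show False using xs by auto
    qed (use xs assms(2) in \<open>auto simp: length_Suc_conv\<close>)
  qed
  have "{xs ! i, xs ! (Suc i mod length xs)} \<in> E" if "i < length xs" for i
  proof (cases "Suc i = length xs")
    case True
    have "i = length xs - 1" using True by linarith
    then have "xs ! i = v" "xs ! 0 = u"
      using xs(3,4) last_conv_nth[OF xs(2)] hd_conv_nth[OF xs(2)] by simp_all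
    then show ?thesis using True assms(1) by (simp add: insert_commute)
  next
    case False
    then have "Suc i < length xs" using that by simp
    then show ?thesis using successively_nth[OF xs(5)] by auto
  qed
  then show ?thesis using xs(1) l3 unfolding is_cycle_def by auto
qed

text \<open>The edge taken leads from the last vertex of the list back to the first; walking through
  the list never uses it.\<close>

lemma conn_of_cycle:
  assumes "is_cycle (P, E) c"
  obtains u v where "{u, v} \<in> E" "u \<noteq> v" "conn (E - {{u, v}}) u v"
proof -
  define l where "l = length c"
  have c: "3 \<le> l" "distinct c" "\<And>i. i < l \<Longrightarrow> {c ! i, c ! (Suc i mod l)} \<in> E"
    using assms unfolding is_cycle_def l_def by auto
  let ?u = "c ! 0" and ?v = "c ! (l - 1)"
  have uv: "{?u, ?v} \<in> E" using c(3)[of "l - 1"] c(1) by (simp add: insert_commute)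
  have "?u = ?v \<longleftrightarrow> 0 = l - 1"
    by (rule nth_eq_iff_index_eq) (use c l_def in auto)
  then have neq: "?u \<noteq> ?v" using c(1) by simp
  have "conn (E - {{?u, ?v}}) ?u (c ! i)" if "i < l" for i
    using that
  proof (induction i)
    case (Suc i)
    have "{c ! i, c ! Suc i} \<in> E" using c(3)[of i] Suc.prems by simp
    moreover have "{c ! i, c ! Suc i} \<noteq> {?u, ?v}"
    proof
      assume "{c ! i, c ! Suc i} = {?u, ?v}"
      moreover have "c ! Suc i = ?u \<longleftrightarrow> Suc i = 0"
        by (rule nth_eq_iff_index_eq) (use Suc.prems c in \<open>auto simp: l_def\<close>)
      ultimately have "c ! i = c ! 0" "c ! Suc i = c ! (l - 1)" by (auto simp: doubleton_eq_iff)
      moreover have "c ! i = c ! 0 \<longleftrightarrow> i = 0" "c ! Suc i = c ! (l - 1) \<longleftrightarrow> Suc i = l - 1"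
        by (rule nth_eq_iff_index_eq; use Suc.prems c in \<open>auto simp: l_def\<close>)+
      ultimately show False using c(1) by auto
    qed
    ultimately show ?case using Suc by (auto intro: conn_trans conn_edge)
  qed simp
  from this[of "l - 1"] show ?thesis using that uv neq c(1) by auto
qed

lemma complete_edges_iff: "{u, v} \<in> complete_edges P \<longleftrightarrow> u \<in> P \<and> v \<in> P \<and> u \<noteq> v"
  unfolding complete_edges_def by (auto simp: doubleton_eq_iff)

lemma complete_edgesE:
  assumes "e \<in> complete_edges P"
  obtains u v where "e = {u, v}" "u \<in> P" "v \<in> P" "u \<noteq> v"
  using assms unfolding complete_edges_def by blast

lemma finite_complete_edges: "finite P \<Longrightarrow> finite (complete_edges P)"
  by (rule finite_subset[of _ "Pow P"]) (auto simp: complete_edges_def)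

section \<open>Counting components: trees as connected graphs with one edge fewer than
  points\<close>

definition component :: "'a set set \<Rightarrow> 'a \<Rightarrow> 'a set" where
  "component E v = {w. conn E v w}"

lemma component_eq_iff: "component E u = component E v \<longleftrightarrow> conn E u v"
proof
  assume "component E u = component E v"
  then have "v \<in> component E u" by (simp add: component_def)
  then show "conn E u v" by (simp add: component_def)
next
  assume "conn E u v"
  then show "component E u = component E v"
    unfolding component_def by (blast intro: conn_trans dest: conn_sym)
qed

text \<open>Exactly two classes merge: the component map changes only on \<open>?U\<close>, the
  union of the components of \<open>u\<close> and \<open>v\<close>, where it becomes
  constant.\<close>

lemma card_comps_insert:
  assumes "finite P" "u \<in> P" "v \<in> P" "\<not> conn E u v"
  shows "Suc (card (component (insert {u, v} E) ` P)) = card (component E ` P)"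
proof -
  let ?E = "insert {u, v} E"
  let ?U = "component E u \<union> component E v"
  have c: "component ?E w = (if w \<in> ?U then ?U else component E w)" for w
  proof (cases "w \<in> ?U")
    case True
    then have "conn E u w \<or> conn E v w" by (simp add: component_def)
    then have "conn ?E w x \<longleftrightarrow> conn E u x \<or> conn E v x" for x
      unfolding conn_insert by (meson conn_sym conn_trans conn_refl)
    then show ?thesis using True by (auto simp: component_def)
  next
    case False
    then have "\<not> conn E u w" "\<not> conn E v w" by (simp_all add: component_def)
    then have "conn ?E w x \<longleftrightarrow> conn E w x" for x
      unfolding conn_insert by (meson conn_sym)
    then show ?thesis using False by (auto simp: component_def)
  qed
  have ne: "component E u \<noteq> component E v" using assms(4) by (simp add: component_eq_iff)
  have w: "w \<in> component E w'" if "component E w = component E w'" for w w'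
    using that conn_refl[of E w] unfolding component_def by blast
  have U: "w \<in> ?U \<longleftrightarrow> component E w = component E u \<or> component E w = component E v" for w
    by (simp only: component_eq_iff) (auto simp: component_def intro: conn_sym)
  have "component ?E ` P = insert ?U (component E ` P - {component E u, component E v})"
  proof
    show "component ?E ` P \<subseteq> insert ?U (component E ` P - {component E u, component E v})"
      using c U by auto
    show "insert ?U (component E ` P - {component E u, component E v}) \<subseteq> component ?E ` P"
    proof
      fix X assume X: "X \<in> insert ?U (component E ` P - {component E u, component E v})"
      show "X \<in> component ?E ` P"
      proof (cases "X = ?U")
        case True
        then have "X = component ?E u" using c[of u] U[of u] by simp
        then show ?thesis using assms(2) by blast
      next
        case False
        then obtain w where "w \<in> P" "X = component E w" "X \<noteq> component E u" "X \<noteq> component E v" using X by auto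
        moreover from this have "w \<notin> ?U" by (metis U)
        ultimately show ?thesis using c[of w] by auto
      qed
    qed
  qed
  moreover have "?U \<notin> component E ` P - {component E u, component E v}"
  proof
    assume "?U \<in> component E ` P - {component E u, component E v}"
    then obtain w where "?U = component E w" "?U \<noteq> component E u" by auto
    moreover have "u \<in> ?U" by (metis U)
    ultimately have "conn E w u" by (simp add: component_def)
    with \<open>?U = component E w\<close> \<open>?U \<noteq> component E u\<close> show False by (simp add: component_eq_iff)
  qed
  ultimately have "card (component ?E ` P) = Suc (card (component E ` P - {component E u, component E v}))"
    using assms(1) by simp
  also have "card (component E ` P - {component E u, component E v}) = card (component E ` P) - 2"
    using ne assms by (subst card_Diff_subset) auto
  finally show ?thesis
    using card_mono[of "component E ` P" "{component E u, component E v}"] ne assms by auto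
qed

lemma card_comps_insert_le:
  assumes "finite P" "u \<in> P" "v \<in> P"
  shows "card (component E ` P) \<le> Suc (card (component (insert {u, v} E) ` P))"
proof (cases "conn E u v")
  case True
  have "component (insert {u, v} E) = component E"
    using True unfolding component_def conn_insert fun_eq_iff by (meson conn_sym conn_trans)
  then show ?thesis by simp
qed (use card_comps_insert[OF assms] in simp)

lemma card_comps_empty: "card (component {} ` P) = card P"
  by (rule card_image) (auto simp: inj_on_def component_eq_iff conn_def)

lemma card_comps_ge:
  assumes "finite P" "E \<subseteq> complete_edges P"
  shows "card P \<le> card E + card (component E ` P)"
proof -
  have "finite E" using assms finite_complete_edges finite_subset by blast
  then show ?thesis using assms(2)
  proof (induction E rule: finite_induct)
    case empty
    then show ?case by (simp add: card_comps_empty)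
  next
    case (insert e E)
    obtain u v where "e = {u, v}" "u \<in> P" "v \<in> P"
      using insert.prems by (auto elim: complete_edgesE)
    then show ?case
      using insert card_comps_insert_le[OF assms(1), of u v E] by auto
  qed
qed

lemma card_comps_connected:
  assumes "finite P" "P \<noteq> {}"
  shows "card (component E ` P) = 1 \<longleftrightarrow> (\<forall>u\<in>P. \<forall>v\<in>P. conn E u v)"
proof
  assume "card (component E ` P) = 1"
  then obtain X where "component E ` P = {X}" by (auto simp: card_1_singleton_iff)
  then show "\<forall>u\<in>P. \<forall>v\<in>P. conn E u v"
    by (metis component_eq_iff image_eqI singletonD)
next
  assume *: "\<forall>u\<in>P. \<forall>v\<in>P. conn E u v"
  obtain p where "p \<in> P" using assms(2) by blast
  moreover have "component E x = component E p" if "x \<in> P" for x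
    using * that \<open>p \<in> P\<close> unfolding component_eq_iff by blast
  ultimately have "component E ` P = {component E p}" by blast
  then show "card (component E ` P) = 1" by simp
qed

text \<open>Replaces the absence of cycles by an edge count, which an exchange of edges visibly
  preserves. Without cycles every edge added lowers the number of components by one. Conversely, an
  edge on a cycle could be deleted without losing connectivity, which would leave too few
  edges.\<close>

lemma is_tree_iff:
  assumes P: "finite P" "P \<noteq> {}" and T: "T \<subseteq> complete_edges P"
  shows "is_tree (P, T) \<longleftrightarrow> (\<forall>u\<in>P. \<forall>v\<in>P. conn T u v) \<and> card P = Suc (card T)"
proof
  assume tree: "is_tree (P, T)"
  then have c: "\<forall>u\<in>P. \<forall>v\<in>P. conn T u v"
    unfolding is_tree_def connected_graph_def conn_def by simp
  have finT: "finite T" using T finite_complete_edges[OF P(1)] finite_subset by blast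
  have "card P = card F + card (component F ` P)" if "finite F" "F \<subseteq> T" for F
    using that
  proof (induction F rule: finite_induct)
    case empty
    then show ?case by (simp add: card_comps_empty)
  next
    case (insert e F)
    obtain u v where e: "e = {u, v}" "u \<in> P" "v \<in> P" "u \<noteq> v"
      using insert.prems T by (metis complete_edgesE insert_subset subsetD)
    have "\<not> conn F u v"
    proof
      assume "conn F u v"
      then have "conn (T - {{u, v}}) u v"
        by (rule conn_mono) (use insert e in auto)
      then show False
        using cycle_of_conn[of u v T P] tree e insert.prems unfolding is_tree_def by auto
    qed
    then show ?case
      using insert card_comps_insert[OF P(1) e(2,3)] e(1) by auto
  qed
  from this[of T] finT c show "(\<forall>u\<in>P. \<forall>v\<in>P. conn T u v) \<and> card P = Suc (card T)"
    using card_comps_connected[OF P, of T] by auto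
next
  assume *: "(\<forall>u\<in>P. \<forall>v\<in>P. conn T u v) \<and> card P = Suc (card T)"
  have "False" if cyc: "is_cycle (P, T) cc" for cc
  proof -
    obtain u v where uv: "{u, v} \<in> T" "conn (T - {{u, v}}) u v"
      using conn_of_cycle[OF cyc] by metis
    have "conn (T - {{u, v}}) a b" if "a \<in> P" "b \<in> P" for a b
    proof (rule conn_lift[of T])
      show "conn T a b" using * that by blast
      fix x y assume "{x, y} \<in> T"
      then show "conn (T - {{u, v}}) x y"
        using uv conn_sym[OF uv(2)] by (cases "{x, y} = {u, v}") (auto simp: doubleton_eq_iff intro: conn_edge)
    qed
    then have "card (component (T - {{u, v}}) ` P) = 1"
      using card_comps_connected[OF P] by blast
    moreover have "finite T" using T finite_complete_edges[OF P(1)] finite_subset by blast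
    ultimately show False
      using card_comps_ge[OF P(1), of "T - {{u, v}}"] T uv(1) *
      by (metis (no_types, lifting) Suc_n_not_le_n add.commute card_Suc_Diff1 Diff_subset plus_1_eq_Suc subset_trans)
  qed
  then show "is_tree (P, T)"
    using * P(2) unfolding is_tree_def connected_graph_def conn_def by auto
qed

subsection \<open>Crossings and orientations\<close>

lemma edges_cross_iff:
  "edges_cross {a, b} {c, d} \<longleftrightarrow>
     distinct [a, b, c, d] \<and> closed_segment a b \<inter> closed_segment c d \<noteq> {}"
proof
  assume "edges_cross {a, b} {c, d}"
  then obtain a' b' c' d' where "{a, b} = {a', b'}" "{c, d} = {c', d'}" "distinct [a', b', c', d']"
    "closed_segment a' b' \<inter> closed_segment c' d' \<noteq> {}"
    unfolding edges_cross_def by blast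
  then show "distinct [a, b, c, d] \<and> closed_segment a b \<inter> closed_segment c d \<noteq> {}"
    by (auto simp: doubleton_eq_iff closed_segment_commute)
next
  show "distinct [a, b, c, d] \<and> closed_segment a b \<inter> closed_segment c d \<noteq> {}
    \<Longrightarrow> edges_cross {a, b} {c, d}"
    unfolding edges_cross_def by blast
qed

lemma edges_cross_sym: "edges_cross e f \<Longrightarrow> edges_cross f e"
  unfolding edges_cross_def by (metis Int_commute distinct_length_2_or_more distinct_singleton)

lemma edges_cross_disjoint: "edges_cross e f \<Longrightarrow> e \<inter> f = {}"
  unfolding edges_cross_def by auto

text \<open>Twice the signed area of the triangle \<open>abc\<close>, positive iff the triple turns
  counterclockwise.\<close>

definition ori :: "real ^ 2 \<Rightarrow> real ^ 2 \<Rightarrow> real ^ 2 \<Rightarrow> real" where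
  "ori a b c = (b $ 1 - a $ 1) * (c $ 2 - a $ 2) - (b $ 2 - a $ 2) * (c $ 1 - a $ 1)"

definition left_of :: "real ^ 2 \<Rightarrow> real ^ 2 \<Rightarrow> real ^ 2 \<Rightarrow> bool" where
  "left_of a b c \<longleftrightarrow> 0 < ori a b c"

text \<open>Each of the lines \<open>ab\<close> and \<open>cd\<close> separates the ends of the
  other segment. In general position this is crossing, expressed by orientations alone.\<close>

definition cr :: "real ^ 2 \<Rightarrow> real ^ 2 \<Rightarrow> real ^ 2 \<Rightarrow> real ^ 2 \<Rightarrow> bool" where
  "cr a b c d \<longleftrightarrow>
     (left_of a b c \<longleftrightarrow> \<not> left_of a b d) \<and> (left_of c d a \<longleftrightarrow> \<not> left_of c d b)"

lemma ori_rotate: "ori b c a = ori a b c"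
  unfolding ori_def by algebra

lemma ori_swap: "ori b a c = - ori a b c"
  unfolding ori_def by algebra

lemma ori_zero_collinear:
  assumes "ori a b c = 0"
  shows "collinear {a, b, c}"
proof (cases "a = b")
  case False
  have *: "(b $ 1 - a $ 1) * (c $ 2 - a $ 2) = (b $ 2 - a $ 2) * (c $ 1 - a $ 1)"
    using assms unfolding ori_def by simp
  have "\<exists>k. c $ 1 - a $ 1 = k * (b $ 1 - a $ 1) \<and> c $ 2 - a $ 2 = k * (b $ 2 - a $ 2)"
  proof (cases "b $ 1 - a $ 1 = 0")
    case True
    then have "b $ 2 - a $ 2 \<noteq> 0" using False by (auto simp: vec_eq_iff forall_2)
    moreover from this have "c $ 1 - a $ 1 = 0" using * True by simp
    ultimately show ?thesis
      using True by (intro exI[of _ "(c $ 2 - a $ 2) / (b $ 2 - a $ 2)"]) simp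
  next
    case False
    then have "c $ 2 - a $ 2 = (c $ 1 - a $ 1) / (b $ 1 - a $ 1) * (b $ 2 - a $ 2)"
      using * by (simp add: divide_simps) (simp add: mult.commute)
    then show ?thesis
      using False by (intro exI[of _ "(c $ 1 - a $ 1) / (b $ 1 - a $ 1)"]) simp
  qed
  then obtain k where "c $ 1 - a $ 1 = k * (b $ 1 - a $ 1)" "c $ 2 - a $ 2 = k * (b $ 2 - a $ 2)"
    by blast
  then have "c - a = k *\<^sub>R (b - a)" by (simp add: vec_eq_iff forall_2)
  then have "collinear {0, b - a, c - a}" unfolding collinear_lemma by blast
  then have "collinear {b, a, c}" using collinear_3[of b a c] by simp
  then show ?thesis by (simp add: insert_commute)
qed simp

locale points =
  fixes P :: "(real ^ 2) set"
  assumes finite_P: "finite P" and general_position_P: "general_position P"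
begin

lemma ori_nonzero:
  assumes "a \<in> P" "b \<in> P" "c \<in> P" "distinct [a, b, c]"
  shows "ori a b c \<noteq> 0"
  using general_position_P ori_zero_collinear[of a b c] assms unfolding general_position_def by blast

lemma left_of_perm:
  assumes "a \<in> P" "b \<in> P" "c \<in> P" "distinct [a, b, c]"
  shows "left_of b c a = left_of a b c" "left_of c a b = left_of a b c"
    "left_of b a c = (\<not> left_of a b c)" "left_of a c b = (\<not> left_of a b c)"
    "left_of c b a = (\<not> left_of a b c)"
  using ori_nonzero[OF assms] ori_rotate[of a b c] ori_rotate[of b c a] ori_swap[of a b c]
    ori_swap[of c a b] ori_swap[of b c a]
  unfolding left_of_def by auto

text \<open>The point \<open>t\<close> divides the triangle \<open>pqr\<close> into three, and
  signed areas add up. This and \<open>left_of_trans\<close> are the interiority and transitivity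
  axioms of Knuth's CC systems, the geometric input of all later facts about configurations.\<close>

lemma left_of_interior:
  assumes "left_of t q r" "left_of p t r" "left_of p q t"
  shows "left_of p q r"
proof -
  have "ori p q r = ori t q r + ori p t r + ori p q t" unfolding ori_def by algebra
  then show ?thesis using assms unfolding left_of_def by linarith
qed

text \<open>The identity is the three-term Grassmann-Pluecker relation for the vectors that start at
  \<open>t\<close>.\<close>

lemma left_of_trans:
  assumes "left_of t s p" "left_of t s q" "left_of t s r" "left_of t p q" "left_of t q r"
  shows "left_of t p r"
proof -
  have "ori t s q * ori t p r = ori t s r * ori t p q + ori t s p * ori t q r"
    unfolding ori_def by algebra
  moreover have "ori t s r * ori t p q + ori t s p * ori t q r > 0"
    using assms unfolding left_of_def by (simp add: add_pos_pos)
  ultimately show ?thesis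
    using assms(2) unfolding left_of_def by (metis zero_less_mult_pos)
qed

lemma edges_cross_cr:
  assumes "a \<in> P" "b \<in> P" "c \<in> P" "d \<in> P" "distinct [a, b, c, d]"
  shows "edges_cross {a, b} {c, d} \<longleftrightarrow> cr a b c d"
proof -
  have nz: "ori a b c \<noteq> 0" "ori a b d \<noteq> 0" "ori c d a \<noteq> 0" "ori c d b \<noteq> 0"
    by (rule ori_nonzero; use assms in auto)+
  have affine: "ori x y ((1 - s) *\<^sub>R z + s *\<^sub>R w) = (1 - s) * ori x y z + s * ori x y w" for x y z w s
    unfolding ori_def by (simp add: algebra_simps)
  have zero: "ori x y ((1 - s) *\<^sub>R x + s *\<^sub>R y) = 0" for x y s
    unfolding ori_def by (simp add: algebra_simps)
  \<comment> \<open>An affine function on a segment that vanishes at one of its points, but at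
    neither end, changes sign.\<close>
  have opposite: "x < 0 \<longleftrightarrow> \<not> y < 0"
    if "(1 - s) * x + s * y = 0" "0 \<le> s" "s \<le> 1" "x \<noteq> 0" "y \<noteq> 0" for x y s :: real
  proof (cases "s = 0 \<or> s = 1")
    case False
    then have s: "0 < s" "0 < 1 - s" using that by auto
    show ?thesis
    proof
      assume "x < 0"
      then have "(1 - s) * x < 0" using s by (simp add: mult_pos_neg)
      then have "s * y > 0" using that(1) by linarith
      then show "\<not> y < 0" using s by (simp add: zero_less_mult_iff)
    next
      assume "\<not> y < 0"
      then have "s * y > 0" using s that by simp
      then have "(1 - s) * x < 0" using that(1) by linarith
      then show "x < 0" using s by (simp add: mult_less_0_iff)
    qed
  qed (use that in auto)
  have "closed_segment a b \<inter> closed_segment c d \<noteq> {} \<longleftrightarrow> cr a b c d"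
  proof
    assume "closed_segment a b \<inter> closed_segment c d \<noteq> {}"
    then obtain s t where st: "0 \<le> s" "s \<le> 1" "0 \<le> t" "t \<le> 1"
      "(1 - s) *\<^sub>R a + s *\<^sub>R b = (1 - t) *\<^sub>R c + t *\<^sub>R d"
      by (auto simp: closed_segment_def)
    have 1: "(1 - t) * ori a b c + t * ori a b d = 0"
      using affine[of a b t c d] zero[of a b s] st(5) by simp
    have 2: "(1 - s) * ori c d a + s * ori c d b = 0"
      using affine[of c d s a b] zero[of c d t] st(5) by simp
    show "cr a b c d"
      using opposite[OF 1 st(3,4) nz(1,2)] opposite[OF 2 st(1,2) nz(3,4)] nz
      unfolding cr_def left_of_def by linarith
  next
    assume cr: "cr a b c d"
    \<comment> \<open>Along \<open>cd\<close> the function \<open>ori a b\<close> is affine with end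
      values \<open>ori a b c\<close> and \<open>ori a b d\<close>, so it vanishes at the fraction
      \<open>ori a b c / D\<close>. In the same way \<open>ori c d a / E\<close> is the position of
      the intersection point on \<open>ab\<close>.\<close>
    define D where "D = ori a b c - ori a b d"
    define E where "E = ori c d a - ori c d b"
    have D: "0 < ori a b c / D" "ori a b c / D < 1" and E: "0 < ori c d a / E" "ori c d a / E < 1"
      using cr nz unfolding cr_def left_of_def D_def E_def
      by (auto simp: field_simps zero_less_divide_iff divide_less_eq)
    have D0: "D \<noteq> 0" using D by auto
    have ED: "E = - D" unfolding E_def D_def ori_def by algebra
    have "(1 - ori c d a / E) *\<^sub>R a + (ori c d a / E) *\<^sub>R b
        = (1 - ori a b c / D) *\<^sub>R c + (ori a b c / D) *\<^sub>R d"
    proof -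
      have "D * (a $ 1) + ori c d a * (a $ 1 - b $ 1) = D * (c $ 1) - ori a b c * (c $ 1 - d $ 1)"
        unfolding D_def ori_def by algebra
      then have "a $ 1 + ori c d a * (a $ 1 - b $ 1) / D = c $ 1 - ori a b c * (c $ 1 - d $ 1) / D"
        using D0 by (simp add: field_simps)
      moreover
      have "D * (a $ 2) + ori c d a * (a $ 2 - b $ 2) = D * (c $ 2) - ori a b c * (c $ 2 - d $ 2)"
        unfolding D_def ori_def by algebra
      then have "a $ 2 + ori c d a * (a $ 2 - b $ 2) / D = c $ 2 - ori a b c * (c $ 2 - d $ 2) / D"
        using D0 by (simp add: field_simps)
      ultimately show ?thesis
        unfolding ED by (simp add: vec_eq_iff forall_2 algebra_simps diff_divide_distrib)
    qed
    then show "closed_segment a b \<inter> closed_segment c d \<noteq> {}"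
      using D E unfolding closed_segment_def disjoint_iff by (auto intro!: less_imp_le)
  qed
  then show ?thesis using assms(5) by (simp add: edges_cross_iff)
qed

end

subsection \<open>Edge exchanges\<close>

definition swap :: "'a set \<Rightarrow> 'a \<Rightarrow> 'a \<Rightarrow> 'a set" where
  "swap T e g = insert g (T - {e})"

definition clear :: "(real ^ 2) set set \<Rightarrow> (real ^ 2) set \<Rightarrow> bool" where
  "clear F f \<longleftrightarrow> (\<forall>g\<in>F. \<not> edges_cross f g)"

definition tadj :: "(real ^ 2) set \<Rightarrow> (real ^ 2) set set \<Rightarrow> (real ^ 2) set set \<Rightarrow> bool" where
  "tadj P T T' \<longleftrightarrow> T \<in> simple_spanning_trees P \<and> T' \<in> simple_spanning_trees P \<and>
     card (sym_diff T T') = 2"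

lemma clear_mono: "clear F f \<Longrightarrow> F' \<subseteq> F \<Longrightarrow> clear F' f"
  unfolding clear_def by blast

lemma tadj_sym: "tadj P T T' \<Longrightarrow> tadj P T' T"
  unfolding tadj_def by (simp add: Un_commute)

lemma tadj_graph: "{T, T'} \<in> snd (geometric_tree_graph P) \<longleftrightarrow> tadj P T T'"
  unfolding geometric_tree_graph_def tadj_def
  by (auto simp: doubleton_eq_iff Un_commute)

lemma tadj_neq: "tadj P T T' \<Longrightarrow> T \<noteq> T'"
  unfolding tadj_def by auto

lemma swap_sym_diff: "e \<in> T \<Longrightarrow> g \<notin> T \<Longrightarrow> sym_diff T (swap T e g) = {e, g}"
  unfolding swap_def by auto

lemma swap_eq_iff:
  assumes "e \<in> T" "g \<notin> T" "e' \<in> T" "g' \<notin> T"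
  shows "swap T e g = swap T e' g' \<longleftrightarrow> e = e' \<and> g = g'"
  using swap_sym_diff[OF assms(1,2)] swap_sym_diff[OF assms(3,4)] assms
  by (metis doubleton_eq_iff)

context points
begin

lemma sst_nonempty: "T \<in> simple_spanning_trees P \<Longrightarrow> P \<noteq> {}"
  unfolding simple_spanning_trees_def is_tree_def connected_graph_def by auto

lemma sst_iff:
  assumes "P \<noteq> {}"
  shows "T \<in> simple_spanning_trees P \<longleftrightarrow>
    T \<subseteq> complete_edges P \<and> (\<forall>u\<in>P. \<forall>v\<in>P. conn T u v) \<and> card P = Suc (card T) \<and>
    (\<forall>e\<in>T. \<forall>f\<in>T. \<not> edges_cross e f)"
  using is_tree_iff[OF finite_P assms, of T] unfolding simple_spanning_trees_def by auto

lemma sst_edges: "T \<in> simple_spanning_trees P \<Longrightarrow> T \<subseteq> complete_edges P"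
  unfolding simple_spanning_trees_def by auto

lemma sst_edge: "T \<in> simple_spanning_trees P \<Longrightarrow> {u, v} \<in> T \<Longrightarrow> u \<in> P \<and> v \<in> P \<and> u \<noteq> v"
  using sst_edges[of T] complete_edges_iff[of u v P] by auto

lemma sst_noncross: "T \<in> simple_spanning_trees P \<Longrightarrow> e \<in> T \<Longrightarrow> f \<in> T \<Longrightarrow> \<not> edges_cross e f"
  unfolding simple_spanning_trees_def by auto

lemma sst_finite: "T \<in> simple_spanning_trees P \<Longrightarrow> finite T"
  using sst_edges finite_complete_edges[OF finite_P] finite_subset by blast

lemma sst_conn: "T \<in> simple_spanning_trees P \<Longrightarrow> u \<in> P \<Longrightarrow> v \<in> P \<Longrightarrow> conn T u v"
  using sst_iff sst_nonempty by blast

lemma sst_card: "T \<in> simple_spanning_trees P \<Longrightarrow> card P = Suc (card T)"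
  using sst_iff sst_nonempty by blast

lemma sst_bridge:
  assumes "T \<in> simple_spanning_trees P" "{u, v} \<in> T"
  shows "\<not> conn (T - {{u, v}}) u v"
proof
  assume c: "conn (T - {{u, v}}) u v"
  have "u \<noteq> v" using sst_edge[OF assms] by simp
  from cycle_of_conn[OF assms(2) this c, of P] show False
    using assms(1) unfolding simple_spanning_trees_def is_tree_def by blast
qed

lemma sst_no_triangle:
  assumes "T \<in> simple_spanning_trees P" "{a, b} \<in> T" "{b, c} \<in> T" "{a, c} \<in> T"
  shows False
proof -
  have "a \<noteq> b" "b \<noteq> c" "a \<noteq> c" using assms sst_edge[OF assms(1)] by auto
  then have "conn (T - {{a, c}}) a b" "conn (T - {{a, c}}) b c"
    using assms by (auto intro!: conn_edge simp: doubleton_eq_iff)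
  then have "conn (T - {{a, c}}) a c" by (rule conn_trans)
  then show False using sst_bridge[OF assms(1,4)] by simp
qed

lemma sst_incident:
  assumes "T \<in> simple_spanning_trees P" "x \<in> P" "y \<in> P" "x \<noteq> y"
  shows "\<exists>z. {x, z} \<in> T"
proof (rule ccontr)
  assume no: "\<nexists>z. {x, z} \<in> T"
  have "y \<in> {x}"
    by (rule conn_closed[OF sst_conn[OF assms(1-3)]]) (use no in auto)
  then show False using assms(4) by simp
qed

text \<open>Only the ends of the deleted edge have to be reconnected, as all other edges survive;
  since the number of edges stays the same, the result is again a tree.\<close>

lemma sst_swap:
  assumes T: "T \<in> simple_spanning_trees P" and e: "{p, q} \<in> T"
    and f: "f \<in> complete_edges P" "f \<notin> T"
    and c: "conn (swap T {p, q} f) p q" and cl: "clear (T - {{p, q}}) f"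
  shows "swap T {p, q} f \<in> simple_spanning_trees P"
proof -
  have ne: "P \<noteq> {}" using sst_nonempty T by blast
  have "conn (swap T {p, q} f) u v" if "u \<in> P" "v \<in> P" for u v
  proof (rule conn_lift[OF sst_conn[OF T that]])
    fix x y assume xy: "{x, y} \<in> T"
    show "conn (swap T {p, q} f) x y"
    proof (cases "{x, y} = {p, q}")
      case True
      then show ?thesis using c conn_sym[OF c] by (auto simp: doubleton_eq_iff)
    next
      case False
      then show ?thesis using xy by (intro conn_edge) (simp add: swap_def)
    qed
  qed
  moreover have "card (swap T {p, q} f) = card T"
    using sst_finite[OF T] e f(2) unfolding swap_def
    using card_Suc_Diff1[of T "{p, q}"] by simp
  moreover have "\<not> edges_cross g h" if "g \<in> swap T {p, q} f" "h \<in> swap T {p, q} f" for g h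
  proof -
    have ff: "\<not> edges_cross f f" using edges_cross_disjoint[of f f] unfolding edges_cross_def by auto
    show ?thesis
      using that ff cl sst_noncross[OF T] edges_cross_sym unfolding swap_def clear_def by blast
  qed
  ultimately show ?thesis
    using sst_edges[OF T] f(1) sst_card[OF T] unfolding sst_iff[OF ne] swap_def by auto
qed

lemma tadj_swap:
  assumes "T \<in> simple_spanning_trees P" "e \<in> T" "g \<notin> T" "swap T e g \<in> simple_spanning_trees P"
  shows "tadj P T (swap T e g)"
proof -
  have "e \<noteq> g" using assms by blast
  then show ?thesis using assms swap_sym_diff[OF assms(2,3)] unfolding tadj_def by simp
qed

text \<open>All trees have equally many edges, so the two elements of the symmetric difference are
  one lost and one gained edge.\<close>

lemma tadjE:
  assumes "tadj P T T'"
  obtains e g where "e \<in> T" "g \<notin> T" "T' = swap T e g"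
proof -
  have T: "T \<in> simple_spanning_trees P" "T' \<in> simple_spanning_trees P" "card (sym_diff T T') = 2"
    using assms unfolding tadj_def by auto
  have fin: "finite T" "finite T'" and c: "card T = card T'"
    using T sst_finite sst_card by (blast, blast, metis nat.inject)
  have "card (T - T') + card (T' - T) = 2"
    using T(3) fin by (subst (asm) card_Un_disjoint) auto
  moreover have "card (T - T') = card (T' - T)"
    using c fin by (metis Int_commute card_Diff_subset_Int finite_Int)
  ultimately have "card (T - T') = 1" "card (T' - T) = 1" by auto
  then obtain e g where "T - T' = {e}" "T' - T = {g}" by (meson card_1_singletonE)
  then have "e \<in> T" "g \<notin> T" "T' = swap T e g" unfolding swap_def by blast+
  then show ?thesis using that by blast
qed

lemma tadj_swap_swap:
  assumes "e \<in> T" "g \<notin> T" "e' \<in> T" "g' \<notin> T"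
    and "swap T e g \<in> simple_spanning_trees P" "swap T e' g' \<in> simple_spanning_trees P"
  shows "tadj P (swap T e g) (swap T e' g') \<longleftrightarrow> (e = e' \<longleftrightarrow> g \<noteq> g')"
proof -
  have "sym_diff (swap T e g) (swap T e' g') =
      (if e = e' then {} else {e, e'}) \<union> (if g = g' then {} else {g, g'})"
    using assms(1-4) unfolding swap_def by auto
  moreover have "e \<noteq> g" "e \<noteq> g'" "e' \<noteq> g" "e' \<noteq> g'" using assms by blast+
  ultimately show ?thesis
    using assms(5,6) unfolding tadj_def by (simp split: if_splits)
qed

text \<open>By \<open>tadj_swap_swap\<close> the two exchanges agree in exactly one of the deleted
  and the inserted edge. This splits the common neighbours into trees over the forest
  \<open>T - {e}\<close> and trees inside \<open>insert g T\<close>.\<close>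

lemma common_neighbour:
  assumes "e \<in> T" "g \<notin> T" "tadj P T Y" "tadj P (swap T e g) Y"
  obtains (del) h where "h \<notin> T" "h \<noteq> g" "Y = swap T e h"
  | (ins) h where "h \<in> T" "h \<noteq> e" "Y = swap T h g"
proof -
  obtain e' g' where Y: "e' \<in> T" "g' \<notin> T" "Y = swap T e' g'"
    using tadjE[OF assms(3)] by metis
  then have "e = e' \<longleftrightarrow> g \<noteq> g'"
    using tadj_swap_swap[OF assms(1,2) Y(1,2)] assms(4) unfolding tadj_def by blast
  then show ?thesis using Y that by metis
qed

end

text \<open>Orientations are only compared with each other, so that the orientation of the given triple
  does not matter. The first argument of \<open>in_cone\<close> is the apex.\<close>

definition in_cone :: "real ^ 2 \<Rightarrow> real ^ 2 \<Rightarrow> real ^ 2 \<Rightarrow> real ^ 2 \<Rightarrow> bool" where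
  "in_cone c a b x \<longleftrightarrow> x \<noteq> c \<and> x \<noteq> a \<and> x \<noteq> b \<and>
     (left_of c a x = left_of c a b) \<and> (left_of c x b = left_of c a b)"

definition in_tri :: "real ^ 2 \<Rightarrow> real ^ 2 \<Rightarrow> real ^ 2 \<Rightarrow> real ^ 2 \<Rightarrow> bool" where
  "in_tri a b c x \<longleftrightarrow> x \<noteq> a \<and> x \<noteq> b \<and> x \<noteq> c \<and>
     (left_of a b x = left_of a b c) \<and> (left_of b c x = left_of a b c) \<and> (left_of c a x = left_of a b c)"

context points
begin

lemma left_of_perms:
  assumes "a \<in> P" "b \<in> P" "c \<in> P" "a \<noteq> b" "a \<noteq> c" "b \<noteq> c"
  shows "left_of b c a = left_of a b c \<and> left_of c a b = left_of a b c \<and>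
    left_of b a c = (\<not> left_of a b c) \<and> left_of a c b = (\<not> left_of a b c) \<and>
    left_of c b a = (\<not> left_of a b c)"
  using left_of_perm[of a b c] assms by auto

lemma edges_cross_cr':
  assumes "a \<in> P" "b \<in> P" "c \<in> P" "d \<in> P"
  shows "edges_cross {a, b} {c, d} \<longleftrightarrow> distinct [a, b, c, d] \<and> cr a b c d"
  using edges_cross_cr[OF assms] edges_cross_iff[of a b c d] by blast

text \<open>The following facts about at most six points are propositional consequences of the listed
  instances of \<open>left_of_interior\<close> and \<open>left_of_trans\<close>.\<close>

lemma cone_trans_aux:
  assumes "{c, u, v, x, y} \<subseteq> P" "distinct [c, u, v, x, y]"
    "in_cone c u v x" "in_cone c u x y"
  shows "in_cone c u v y"
  using assms
    left_of_perms[of c u v] left_of_perms[of c u x] left_of_perms[of c u y] left_of_perms[of c v x]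
    left_of_perms[of c v y] left_of_perms[of c x y] left_of_perms[of u v x] left_of_perms[of u v y]
    left_of_perms[of u x y] left_of_perms[of v x y] left_of_interior[of c x y v]
    left_of_interior[of u y x v] left_of_trans[of c u v y x] left_of_trans[of u c v x y]
    left_of_trans[of v x c y u] left_of_trans[of x y c v u] left_of_trans[of y v c x u]
  unfolding cr_def in_cone_def in_tri_def insert_subset distinct.simps list.set insert_iff empty_iff
  by (smt (verit))

lemma cone_commute_aux:
  assumes "{c, u, v, x} \<subseteq> P" "distinct [c, u, v, x]"
    "in_cone c u v x"
  shows "in_cone c v u x"
  using assms
    left_of_perms[of c u v] left_of_perms[of c u x] left_of_perms[of c v x] left_of_perms[of u v x]
  unfolding cr_def in_cone_def in_tri_def insert_subset distinct.simps list.set insert_iff empty_iff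
  by (smt (verit))

lemma cone_asym_aux:
  assumes "{c, u, x, y} \<subseteq> P" "distinct [c, u, x, y]"
    "in_cone c u x y" "in_cone c u y x"
  shows False
  using assms
    left_of_perms[of c u x] left_of_perms[of c u y] left_of_perms[of c x y] left_of_perms[of u x y]
  unfolding cr_def in_cone_def in_tri_def insert_subset distinct.simps list.set insert_iff empty_iff
  by (smt (verit))

lemma tri_cone_aux:
  assumes "{c, z, d, y} \<subseteq> P" "distinct [c, z, d, y]"
    "in_tri c z d y"
  shows "in_cone c z d y"
  using assms
    left_of_perms[of c z d] left_of_perms[of c z y] left_of_perms[of c d y] left_of_perms[of z d y]
  unfolding cr_def in_cone_def in_tri_def insert_subset distinct.simps list.set insert_iff empty_iff
  by (smt (verit))

lemma tri_cone_aux':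
  assumes "{c, z, d, y} \<subseteq> P" "distinct [c, z, d, y]"
    "in_tri c z d y"
  shows "in_cone z c d y"
  using assms
    left_of_perms[of c z d] left_of_perms[of c z y] left_of_perms[of c d y] left_of_perms[of z d y]
  unfolding cr_def in_cone_def in_tri_def insert_subset distinct.simps list.set insert_iff empty_iff
  by (smt (verit))

lemma tri_commute_aux:
  assumes "{a, b, c, x} \<subseteq> P" "distinct [a, b, c, x]"
    "in_tri a b c x"
  shows "in_tri b a c x"
  using assms
    left_of_perms[of a b c] left_of_perms[of a b x] left_of_perms[of a c x] left_of_perms[of b c x]
  unfolding cr_def in_cone_def in_tri_def insert_subset distinct.simps list.set insert_iff empty_iff
  by (smt (verit))

lemma tri_asym_aux:
  assumes "{c, z, d, y} \<subseteq> P" "distinct [c, z, d, y]"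
    "in_tri c z d y" "in_tri c z y d"
  shows False
  using assms
    left_of_perms[of c z d] left_of_perms[of c z y] left_of_perms[of c d y] left_of_perms[of z d y]
  unfolding cr_def in_cone_def in_tri_def insert_subset distinct.simps list.set insert_iff empty_iff
  by (smt (verit))

lemma cr_cone:
  assumes "{x, y, a, z} \<subseteq> P" "distinct [x, y, a, z]"
    "cr x y a z"
  shows "in_cone a x y z"
  using assms
    left_of_perms[of x y a] left_of_perms[of x y z] left_of_perms[of x a z] left_of_perms[of y a z]
    left_of_interior[of x y z a] left_of_interior[of x z y a]
  unfolding cr_def in_cone_def in_tri_def insert_subset distinct.simps list.set insert_iff empty_iff
  by (smt (verit))

lemma cr_not_tri:
  assumes "{c, z, d, y} \<subseteq> P" "distinct [c, z, d, y]"
    "in_tri c z d y" "cr z y c d"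
  shows False
  using assms
    left_of_perms[of c z d] left_of_perms[of c z y] left_of_perms[of c d y] left_of_perms[of z d y]
  unfolding cr_def in_cone_def in_tri_def insert_subset distinct.simps list.set insert_iff empty_iff
  by (smt (verit))

lemma cr_not_tri':
  assumes "{c, z, d, y} \<subseteq> P" "distinct [c, z, d, y]"
    "in_tri c z d y" "cr c y z d"
  shows False
  using assms
    left_of_perms[of c z d] left_of_perms[of c z y] left_of_perms[of c d y] left_of_perms[of z d y]
  unfolding cr_def in_cone_def in_tri_def insert_subset distinct.simps list.set insert_iff empty_iff
  by (smt (verit))

lemma cr_tri_cone:
  assumes "{c, z, d, y, t} \<subseteq> P" "distinct [c, z, d, y, t]"
    "in_tri c z d y" "cr z y c t"
  shows "in_cone c z d t"
  using assms
    left_of_perms[of c z d] left_of_perms[of c z y] left_of_perms[of c z t] left_of_perms[of c d y]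
    left_of_perms[of c d t] left_of_perms[of c y t] left_of_perms[of z d y] left_of_perms[of z d t]
    left_of_perms[of z y t] left_of_perms[of d y t] left_of_interior[of c y t d]
    left_of_interior[of c z y t] left_of_interior[of c y z t] left_of_trans[of c z d t y]
    left_of_trans[of y t c d z]
  unfolding cr_def in_cone_def in_tri_def insert_subset distinct.simps list.set insert_iff empty_iff
  by (smt (verit))

lemma cr_tri_d:
  assumes "{c, z, d, y, t} \<subseteq> P" "distinct [c, z, d, y, t]"
    "in_tri c z d y" "cr z y d t" "\<not> cr c z d t" "\<not> (in_tri c z d t \<and> in_cone z c y t)"
  shows False
  using assms
    left_of_perms[of c z d] left_of_perms[of c z y] left_of_perms[of c z t] left_of_perms[of c d y]
    left_of_perms[of c d t] left_of_perms[of c y t] left_of_perms[of z d y] left_of_perms[of z d t]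
    left_of_perms[of z y t] left_of_perms[of d y t] left_of_interior[of c t y d]
    left_of_interior[of z y t d] left_of_interior[of z t y d] left_of_trans[of d z c t y]
    left_of_trans[of y t c z d]
  unfolding cr_def in_cone_def in_tri_def insert_subset distinct.simps list.set insert_iff empty_iff
  by (smt (verit))

text \<open>From \<open>zd\<close> the segment \<open>st\<close> enters the triangle
  \<open>czd\<close>. It can leave neither through \<open>cz\<close> or \<open>cd\<close> nor again
  through \<open>zd\<close>, so it ends inside.\<close>

lemma cr_side:
  assumes "{c, z, d, s, t} \<subseteq> P" "distinct [c, z, d, s, t]"
    "cr z d s t" "\<not> cr c z s t" "\<not> cr c d s t" "\<not> (in_tri c z d s \<and> in_cone z c d s)"
    "\<not> (in_tri c z d t \<and> in_cone z c d t)"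
  shows False
  using assms
    left_of_perms[of c z d] left_of_perms[of c z s] left_of_perms[of c z t] left_of_perms[of c d s]
    left_of_perms[of c d t] left_of_perms[of c s t] left_of_perms[of z d s] left_of_perms[of z d t]
    left_of_perms[of z s t] left_of_perms[of d s t] left_of_interior[of c z s d]
    left_of_interior[of c z t d] left_of_interior[of c s z d] left_of_interior[of c t z d]
    left_of_interior[of z s t d] left_of_interior[of z t s d] left_of_trans[of c z d s t]
    left_of_trans[of c z d t s] left_of_trans[of c d z s t] left_of_trans[of c d z t s]
    left_of_trans[of z s c d t] left_of_trans[of z t c d s] left_of_trans[of d s c z t]
    left_of_trans[of d t c z s] left_of_trans[of s z c t d] left_of_trans[of s d c t z]
    left_of_trans[of t z c s d] left_of_trans[of t d c s z]
  unfolding cr_def in_cone_def in_tri_def insert_subset distinct.simps list.set insert_iff empty_iff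
  by (smt (verit))

text \<open>Consider the triangle of \<open>c\<close>, \<open>z\<close> and the point where the ray
  \<open>zy\<close> meets \<open>cd\<close>. The segment \<open>st\<close> enters it through
  \<open>zy\<close>, cannot return to that line, and crosses neither \<open>cz\<close> nor
  \<open>cd\<close>, so it ends inside.\<close>

lemma cr_inner:
  assumes "{c, z, d, y, s, t} \<subseteq> P" "distinct [c, z, d, y, s, t]"
    "in_tri c z d y" "cr z y s t" "\<not> cr c z s t" "\<not> cr c d s t"
    "\<not> (in_tri c z d s \<and> in_cone z c y s)" "\<not> (in_tri c z d t \<and> in_cone z c y t)"
  shows False
  using assms
    left_of_perms[of c z d] left_of_perms[of c z y] left_of_perms[of c z s] left_of_perms[of c z t]
    left_of_perms[of c d y] left_of_perms[of c d s] left_of_perms[of c d t] left_of_perms[of c y s]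
    left_of_perms[of c y t] left_of_perms[of c s t] left_of_perms[of z d y] left_of_perms[of z d s]
    left_of_perms[of z d t] left_of_perms[of z y s] left_of_perms[of z y t] left_of_perms[of z s t]
    left_of_perms[of d y s] left_of_perms[of d y t] left_of_perms[of d s t] left_of_perms[of y s t]
    left_of_interior[of c z t d] left_of_interior[of c y s d] left_of_interior[of c s z d]
    left_of_interior[of c t y d] left_of_interior[of c z y s] left_of_interior[of z y s d]
    left_of_interior[of z y t d] left_of_interior[of z y t s] left_of_interior[of z t y s]
    left_of_interior[of d y t s] left_of_trans[of c z d s y] left_of_trans[of c z d t y]
    left_of_trans[of c z y s t] left_of_trans[of c z y t s] left_of_trans[of c d z s y]
    left_of_trans[of c d z t y] left_of_trans[of c y z s t] left_of_trans[of c y z t s]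
    left_of_trans[of c s z y t] left_of_trans[of z c d s y] left_of_trans[of z c d t y]
    left_of_trans[of z d c s y] left_of_trans[of z s c y t] left_of_trans[of z t c y s]
    left_of_trans[of d z c t y] left_of_trans[of y c d s t] left_of_trans[of y s c z d]
    left_of_trans[of y s c z t] left_of_trans[of y s z t d] left_of_trans[of y t c z d]
    left_of_trans[of y t c z s] left_of_trans[of y t c d z] left_of_trans[of s z c y d]
    left_of_trans[of s z c t y] left_of_trans[of s z d t y] left_of_trans[of s d c z y]
    left_of_trans[of s d c y z] left_of_trans[of s y c t z] left_of_trans[of t c d s y]
    left_of_trans[of t z c y d] left_of_trans[of t z c s y] left_of_trans[of t d c z y]
    left_of_trans[of t d c y z] left_of_trans[of t y c d z] left_of_trans[of t y c s z]
    left_of_trans[of t y z d s]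
  unfolding cr_def in_cone_def in_tri_def insert_subset distinct.simps list.set insert_iff empty_iff
  by (smt (verit))

lemma cr_tri'_z:
  assumes "{c, z, d, y, t} \<subseteq> P" "distinct [c, z, d, y, t]"
    "in_tri c z d y" "cr c y z t" "\<not> cr c d z t" "\<not> (in_tri c z d t \<and> in_cone z c y t)"
  shows False
  using assms
    left_of_perms[of c z d] left_of_perms[of c z y] left_of_perms[of c z t] left_of_perms[of c d y]
    left_of_perms[of c d t] left_of_perms[of c y t] left_of_perms[of z d y] left_of_perms[of z d t]
    left_of_perms[of z y t] left_of_perms[of d y t] left_of_interior[of c z y t]
    left_of_interior[of c y z t] left_of_interior[of z y t d] left_of_trans[of z c d t y]
    left_of_trans[of y t c z d]
  unfolding cr_def in_cone_def in_tri_def insert_subset distinct.simps list.set insert_iff empty_iff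
  by (smt (verit))

lemma cr_tri'_d:
  assumes "{c, z, d, y, t} \<subseteq> P" "distinct [c, z, d, y, t]"
    "in_tri c z d y" "cr c y d t" "\<not> cr z y d t" "\<not> cr c z d t"
    "\<not> (in_tri c z d t \<and> in_cone z c y t)"
  shows False
  using assms
    left_of_perms[of c z d] left_of_perms[of c z y] left_of_perms[of c z t] left_of_perms[of c d y]
    left_of_perms[of c d t] left_of_perms[of c y t] left_of_perms[of z d y] left_of_perms[of z d t]
    left_of_perms[of z y t] left_of_perms[of d y t] left_of_interior[of c y t d]
    left_of_trans[of c z d t y] left_of_trans[of z d c t y] left_of_trans[of d c z t y]
    left_of_trans[of y t c d z] left_of_trans[of t y c z d]
  unfolding cr_def in_cone_def in_tri_def insert_subset distinct.simps list.set insert_iff empty_iff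
  by (smt (verit))

text \<open>Here \<open>st\<close> enters the triangle \<open>czy\<close> through \<open>cy\<close>
  and, crossing neither of the other two sides, ends inside; that triangle is contained in
  \<open>czd\<close> and has smaller angles at \<open>z\<close>.\<close>

lemma cr_inner':
  assumes "{c, z, d, y, s, t} \<subseteq> P" "distinct [c, z, d, y, s, t]"
    "in_tri c z d y" "cr c y s t" "\<not> cr z y s t" "\<not> cr c z s t" "\<not> cr c d s t"
    "\<not> (in_tri c z d s \<and> in_cone z c y s)" "\<not> (in_tri c z d t \<and> in_cone z c y t)"
  shows False
  using assms
    left_of_perms[of c z d] left_of_perms[of c z y] left_of_perms[of c z s] left_of_perms[of c z t]
    left_of_perms[of c d y] left_of_perms[of c d s] left_of_perms[of c d t] left_of_perms[of c y s]
    left_of_perms[of c y t] left_of_perms[of c s t] left_of_perms[of z d y] left_of_perms[of z d s]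
    left_of_perms[of z d t] left_of_perms[of z y s] left_of_perms[of z y t] left_of_perms[of z s t]
    left_of_perms[of d y s] left_of_perms[of d y t] left_of_perms[of d s t] left_of_perms[of y s t]
    left_of_interior[of c s y d] left_of_interior[of c y z s] left_of_interior[of c y t s]
    left_of_interior[of c t y s] left_of_interior[of c z y t] left_of_interior[of c y z t]
    left_of_interior[of z s y d] left_of_interior[of d y t s] left_of_trans[of c z d s y]
    left_of_trans[of c z d t y] left_of_trans[of c d z t y] left_of_trans[of c t z y s]
    left_of_trans[of c t d y s] left_of_trans[of z c d s t] left_of_trans[of z c d t y]
    left_of_trans[of z y c t s] left_of_trans[of d c z s y] left_of_trans[of d c z t y]
    left_of_trans[of d z c t y] left_of_trans[of y z d s t] left_of_trans[of y d z s t]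
    left_of_trans[of y s c t z] left_of_trans[of y s c t d] left_of_trans[of y s z t d]
    left_of_trans[of y t c z d] left_of_trans[of y t c d z] left_of_trans[of y t c s z]
    left_of_trans[of s c z t y] left_of_trans[of s d c z y] left_of_trans[of s d c y z]
    left_of_trans[of s y c z t] left_of_trans[of s y c d t] left_of_trans[of t c z s y]
    left_of_trans[of t c d s y] left_of_trans[of t z c d y] left_of_trans[of t z c y d]
    left_of_trans[of t d c z y] left_of_trans[of t d c y z] left_of_trans[of t y c z d]
    left_of_trans[of t y c z s]
  unfolding cr_def in_cone_def in_tri_def insert_subset distinct.simps list.set insert_iff empty_iff
  by (smt (verit))

lemma tri_tri:
  assumes "{c, z, d, y, w} \<subseteq> P" "distinct [c, z, d, y, w]"
    "in_tri c z d y" "in_tri c z y w"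
  shows "in_tri c z d w"
  using assms
    left_of_perms[of c z d] left_of_perms[of c z y] left_of_perms[of c z w] left_of_perms[of c d y]
    left_of_perms[of c d w] left_of_perms[of c y w] left_of_perms[of z d y] left_of_perms[of z d w]
    left_of_perms[of z y w] left_of_perms[of d y w] left_of_interior[of c y w d]
    left_of_interior[of z y w d] left_of_trans[of c z d w y] left_of_trans[of z c d w y]
    left_of_trans[of w d c z y] left_of_trans[of w d c y z]
  unfolding cr_def in_cone_def in_tri_def insert_subset distinct.simps list.set insert_iff empty_iff
  by (smt (verit))

text \<open>The angular order around \<open>c\<close> is \<open>r\<close>, \<open>b\<close>,
  \<open>q\<close>, \<open>d\<close>, within an angle below a half turn.\<close>

lemma cone_opposite:
  assumes "{c, r, q, b, d} \<subseteq> P" "distinct [c, r, q, b, d]"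
    "in_cone c r d b" "in_cone c b d q"
  shows "in_cone c r q b"
  using assms
    left_of_perms[of c r q] left_of_perms[of c r b] left_of_perms[of c r d] left_of_perms[of c q b]
    left_of_perms[of c q d] left_of_perms[of c b d] left_of_perms[of r q b] left_of_perms[of r q d]
    left_of_perms[of r b d] left_of_perms[of q b d] left_of_interior[of c q r b]
    left_of_interior[of r q d b] left_of_trans[of c d r q b] left_of_trans[of r b c q d]
    left_of_trans[of q r c b d] left_of_trans[of b q c r d] left_of_trans[of d c r b q]
  unfolding cr_def in_cone_def in_tri_def insert_subset distinct.simps list.set insert_iff empty_iff
  by (smt (verit))

lemma cone_not_both:
  assumes "{c, b, q, p} \<subseteq> P" "distinct [c, b, q, p]"
    "in_cone b c p q" "in_cone b q p c"
  shows False
  using assms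
    left_of_perms[of c b q] left_of_perms[of c b p] left_of_perms[of c q p] left_of_perms[of b q p]
  unfolding cr_def in_cone_def in_tri_def insert_subset distinct.simps list.set insert_iff empty_iff
  by (smt (verit))

text \<open>The rays from \<open>c\<close> through \<open>b\<close> and from \<open>b\<close>
  through \<open>c\<close> both meet the segment \<open>qr\<close>, hence in the same point, which
  therefore lies between \<open>b\<close> and \<open>c\<close>.\<close>

lemma cone_cone_cr:
  assumes "{c, r, q, b} \<subseteq> P" "distinct [c, r, q, b]"
    "in_cone c r q b" "in_cone b q r c"
  shows "cr q r b c"
  using assms
    left_of_perms[of c r q] left_of_perms[of c r b] left_of_perms[of c q b] left_of_perms[of r q b]
  unfolding cr_def in_cone_def in_tri_def insert_subset distinct.simps list.set insert_iff empty_iff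
  by (smt (verit))

lemma quad_cross5:
  assumes "{b, c, q, r, t} \<subseteq> P" "distinct [b, c, q, r, t]"
    "cr q r b c" "cr q r b t" "\<not> cr c r b t" "\<not> cr c q b t" "\<not> in_tri b c r t"
    "\<not> in_tri b c q t"
  shows False
  using assms
    left_of_perms[of b c q] left_of_perms[of b c r] left_of_perms[of b c t] left_of_perms[of b q r]
    left_of_perms[of b q t] left_of_perms[of b r t] left_of_perms[of c q r] left_of_perms[of c q t]
    left_of_perms[of c r t] left_of_perms[of q r t] left_of_interior[of b q r c]
    left_of_interior[of b r q c] left_of_interior[of b r t q] left_of_interior[of b t r q]
  unfolding cr_def in_cone_def in_tri_def insert_subset distinct.simps list.set insert_iff empty_iff
  by (smt (verit))

text \<open>The convex quadrilateral with diagonals \<open>qr\<close> and \<open>bc\<close> is the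
  union of the triangles \<open>bcr\<close> and \<open>bcq\<close>. A segment that crosses
  \<open>qr\<close> enters it, and without crossing a side or \<open>bc\<close> it must have an end
  in one of the triangles.\<close>

lemma quad_cross6:
  assumes "{b, c, q, r, s, t} \<subseteq> P" "distinct [b, c, q, r, s, t]"
    "cr q r b c" "cr q r s t" "\<not> cr b r s t" "\<not> cr c r s t" "\<not> cr b q s t"
    "\<not> cr c q s t" "\<not> cr b c s t" "\<not> in_tri b c r s" "\<not> in_tri b c r t"
    "\<not> in_tri b c q s" "\<not> in_tri b c q t"
  shows False
  using assms
    left_of_perms[of b c q] left_of_perms[of b c r] left_of_perms[of b c s] left_of_perms[of b c t]
    left_of_perms[of b q r] left_of_perms[of b q s] left_of_perms[of b q t] left_of_perms[of b r s]
    left_of_perms[of b r t] left_of_perms[of b s t] left_of_perms[of c q r] left_of_perms[of c q s]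
    left_of_perms[of c q t] left_of_perms[of c r s] left_of_perms[of c r t] left_of_perms[of c s t]
    left_of_perms[of q r s] left_of_perms[of q r t] left_of_perms[of q s t] left_of_perms[of r s t]
    left_of_interior[of b q r c] left_of_interior[of b r q c] left_of_interior[of b r s q]
    left_of_interior[of c r s q] left_of_interior[of q s t r] left_of_interior[of q t s r]
    left_of_trans[of b q c r t] left_of_trans[of b r q t s] left_of_trans[of b t q s r]
    left_of_trans[of c r b q t] left_of_trans[of c t q s r] left_of_trans[of q b c t r]
    left_of_trans[of q c b t r] left_of_trans[of q s b r t] left_of_trans[of q t b r s]
    left_of_trans[of q t c r s] left_of_trans[of r b c t q] left_of_trans[of r c b t q]
    left_of_trans[of r t b q s] left_of_trans[of r t c q s] left_of_trans[of s q b t r]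
    left_of_trans[of s q c t r] left_of_trans[of s r b t q] left_of_trans[of s r c t q]
    left_of_trans[of t b c q r] left_of_trans[of t b c r q] left_of_trans[of t c b q r]
    left_of_trans[of t c b r q] left_of_trans[of t q b s r] left_of_trans[of t q c s r]
    left_of_trans[of t r b s q] left_of_trans[of t r c s q]
  unfolding cr_def in_cone_def in_tri_def insert_subset distinct.simps list.set insert_iff empty_iff
  by (smt (verit))

lemma cr_order_trans:
  assumes "{a, b, z, y, d} \<subseteq> P" "distinct [a, b, z, y, d]"
    "cr a z b d" "cr a y b z"
  shows "cr a y b d"
  using assms
    left_of_perms[of a b z] left_of_perms[of a b y] left_of_perms[of a b d] left_of_perms[of a z y]
    left_of_perms[of a z d] left_of_perms[of a y d] left_of_perms[of b z y] left_of_perms[of b z d]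
    left_of_perms[of b y d] left_of_perms[of z y d] left_of_interior[of a z y b]
    left_of_interior[of a z d b] left_of_interior[of a y z b] left_of_interior[of a d z b]
    left_of_interior[of a z y d] left_of_interior[of b y z d] left_of_trans[of a b z d y]
    left_of_trans[of b a z y d] left_of_trans[of y z a b d] left_of_trans[of d z a y b]
  unfolding cr_def in_cone_def in_tri_def insert_subset distinct.simps list.set insert_iff empty_iff
  by (smt (verit))

lemma cr_order_asym:
  assumes "{a, b, z, d} \<subseteq> P" "distinct [a, b, z, d]"
    "cr a z b d" "cr a d b z"
  shows False
  using assms
    left_of_perms[of a b z] left_of_perms[of a b d] left_of_perms[of a z d] left_of_perms[of b z d]
    left_of_interior[of a z d b] left_of_interior[of a d z b]
  unfolding cr_def in_cone_def in_tri_def insert_subset distinct.simps list.set insert_iff empty_iff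
  by (smt (verit))

text \<open>\<open>az\<close> and \<open>bx\<close> are the diagonals of a convex quadrilateral with
  side \<open>xz\<close>; a segment from \<open>a\<close> through this side would first cross the
  diagonal \<open>bx\<close>.\<close>

lemma cr_principal:
  assumes "{a, b, x, z, y} \<subseteq> P" "distinct [a, b, x, z, y]"
    "cr a z b x" "\<not> cr a y b x" "\<not> cr a y b z"
  shows "\<not> cr a y x z"
  using assms
    left_of_perms[of a b x] left_of_perms[of a b z] left_of_perms[of a b y] left_of_perms[of a x z]
    left_of_perms[of a x y] left_of_perms[of a z y] left_of_perms[of b x z] left_of_perms[of b x y]
    left_of_perms[of b z y] left_of_perms[of x z y] left_of_interior[of a x z b]
    left_of_interior[of a z y x] left_of_interior[of a y z x] left_of_interior[of b z y x]
    left_of_trans[of a x b y z] left_of_trans[of b z a y x] left_of_trans[of b y a x z]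
    left_of_trans[of x a b z y] left_of_trans[of z y a b x] left_of_trans[of y z a x b]
  unfolding cr_def in_cone_def in_tri_def insert_subset distinct.simps list.set insert_iff empty_iff
  by (smt (verit))

end

subsection \<open>Connecting the two components of a bisected forest\<close>

definition noncrossing :: "(real ^ 2) set set \<Rightarrow> bool" where
  "noncrossing F \<longleftrightarrow> (\<forall>e\<in>F. clear F e)"

text \<open>The two trees left by deleting an inner edge, reduced to what the visibility arguments
  use. No point is isolated, so that every apex has an edge towards which to turn.\<close>

definition bisects :: "(real ^ 2) set \<Rightarrow> (real ^ 2) set set \<Rightarrow> (real ^ 2) set \<Rightarrow> (real ^ 2) set \<Rightarrow> bool" where
  "bisects P F A B \<longleftrightarrow> F \<subseteq> complete_edges P \<and> noncrossing F \<and> A \<union> B = P \<and> A \<inter> B = {} \<and>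
     (\<forall>u v. {u, v} \<in> F \<longrightarrow> (u \<in> A \<longleftrightarrow> v \<in> A)) \<and> (\<forall>v\<in>P. \<exists>w. {v, w} \<in> F)"

lemma bisects_commute: "bisects P F A B \<Longrightarrow> bisects P F B A"
proof -
  assume F: "bisects P F A B"
  have "u \<in> B \<longleftrightarrow> v \<in> B" if "{u, v} \<in> F" for u v
  proof -
    have "u \<in> P" "v \<in> P" using F that complete_edges_iff[of u v P] unfolding bisects_def by auto
    then show ?thesis using F that unfolding bisects_def by blast
  qed
  then show ?thesis using F unfolding bisects_def by (simp add: Un_commute Int_commute)
qed

definition connectors :: "(real ^ 2) set set \<Rightarrow> (real ^ 2) set \<Rightarrow> (real ^ 2) set \<Rightarrow> (real ^ 2) set set" where
  "connectors F A B = {{z, y} |z y. z \<in> A \<and> y \<in> B \<and> clear F {z, y}}"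

lemma edge_endpoints:
  assumes "F \<subseteq> complete_edges P" "{s, t} \<in> F"
  shows "s \<in> P" "t \<in> P" "s \<noteq> t"
  using assms complete_edges_iff[of s t P] by auto

lemma bisects_edge:
  assumes "bisects P F A B" "{u, v} \<in> F"
  shows "u \<in> P" "v \<in> P" "u \<noteq> v" "u \<in> A \<longleftrightarrow> v \<in> A" "u \<in> B \<longleftrightarrow> v \<in> B"
  using assms edge_endpoints[of F P u v] unfolding bisects_def by blast+

context points
begin

lemma cone_commute: "{c, u, v, x} \<subseteq> P \<Longrightarrow> distinct [c, u, v] \<Longrightarrow> in_cone c u v x \<Longrightarrow> in_cone c v u x"
  by (rule cone_commute_aux) (auto simp: in_cone_def)

lemma cone_asym:
  "{c, u, x, y} \<subseteq> P \<Longrightarrow> distinct [c, u, x] \<Longrightarrow> in_cone c u x y \<Longrightarrow> \<not> in_cone c u y x"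
  using cone_asym_aux[of c u x y] by (auto simp: in_cone_def)

lemma cone_trans:
  assumes "{c, u, v, x, y} \<subseteq> P" "distinct [c, u, v]" "in_cone c u v x" "in_cone c u x y"
  shows "in_cone c u v y"
proof (rule cone_trans_aux)
  have "y \<noteq> v" using cone_asym[of c u v x] assms by auto
  then show "distinct [c, u, v, x, y]" using assms(2-4) by (auto simp: in_cone_def)
qed fact+

text \<open>Only angles below a half turn are compared, so turning from \<open>cz\<close> gives a
  strict partial order instead of a linear one. A minimal element of it is enough.\<close>

lemma min_angle:
  assumes "S \<subseteq> P" "S \<noteq> {}" "c \<in> P" "z \<in> P" "c \<notin> S" "z \<notin> S" "c \<noteq> z"
  obtains y where "y \<in> S" "\<And>w. w \<in> S \<Longrightarrow> \<not> in_cone c z y w"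
proof -
  let ?R = "\<lambda>w y. in_cone c z y w"
  have "asymp_on S ?R"
  proof (rule asymp_onI)
    fix x y assume "x \<in> S" "y \<in> S" "in_cone c z y x"
    then show "\<not> in_cone c z x y" using cone_asym[of c z y x] assms by (auto simp: subset_iff)
  qed
  moreover have "transp_on S ?R"
  proof (rule transp_onI)
    fix u v w assume "u \<in> S" "v \<in> S" "w \<in> S" "in_cone c z v u" "in_cone c z w v"
    then show "in_cone c z w u" using cone_trans[of c z w v u] assms by (auto simp: subset_iff)
  qed
  moreover have "finite S" using assms(1) finite_P finite_subset by blast
  ultimately obtain y where "y \<in> S" "\<forall>x\<in>S. x \<noteq> y \<longrightarrow> \<not> in_cone c z y x"
    using Finite_Set.bex_min_element[of S ?R] assms(2) by blast
  then show ?thesis using that by (metis in_cone_def)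
qed

lemma clearD: "clear F f \<Longrightarrow> g \<in> F \<Longrightarrow> \<not> edges_cross f g"
  unfolding clear_def by blast

lemma clear_cr:
  assumes "clear F {a, b}" "{s, t} \<in> F" "{a, b, s, t} \<subseteq> P" "distinct [a, b, s, t]"
  shows "\<not> cr a b s t"
  using clearD[OF assms(1,2)] edges_cross_cr'[of a b s t] assms(3,4) by auto

text \<open>Among the candidates, \<open>y\<close> is the one with the smallest angle at \<open>z\<close>, measured from
  \<open>zc\<close>: an edge that blocks \<open>zy\<close> or \<open>cy\<close> has an endpoint with a smaller angle.\<close>

lemma visible_apex:
  assumes F: "F \<subseteq> complete_edges P" "noncrossing F" and cd: "{c, d} \<in> F"
    and z: "z \<in> P" "z \<noteq> c" "z \<noteq> d" and cz: "clear F {c, z}"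
    and first: "\<And>x. {c, x} \<in> F \<Longrightarrow> \<not> in_cone c z d x"
  obtains y where "y \<in> P" "y = d \<or> in_tri c z d y" "clear F {c, y}" "clear F {z, y}"
    "\<And>w. w \<in> P \<Longrightarrow> \<not> in_tri c z y w"
proof -
  have cdP: "c \<in> P" "d \<in> P" "c \<noteq> d" using edge_endpoints[OF F(1) cd] by auto
  have FP: "s \<in> P" "t \<in> P" "s \<noteq> t" if "{s, t} \<in> F" for s t
    using edge_endpoints[OF F(1) that] by auto
  define S where "S = {y \<in> P. y = d \<or> in_tri c z d y}"
  have "S \<subseteq> P" "S \<noteq> {}" "z \<notin> S" "c \<notin> S" using cdP z unfolding S_def in_tri_def by auto
  then obtain y where y: "y \<in> S" and min: "\<And>w. w \<in> S \<Longrightarrow> \<not> in_cone z c y w"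
    using min_angle[of S z c] z cdP by metis
  have yP: "y \<in> P" and yd: "y = d \<or> in_tri c z d y" using y unfolding S_def by auto
  have yn: "y \<noteq> c" "y \<noteq> z" using yd z cdP by (auto simp: in_tri_def)
  have no: "\<not> (in_tri c z d t \<and> in_cone z c y t)" if "t \<in> P" for t
    using min[of t] that unfolding S_def by blast
  have cdc: "clear F {c, d}" using F(2) cd unfolding noncrossing_def by blast
  note in_P = cdP z yP yn
  \<comment> \<open>An edge at \<open>c\<close> that crosses \<open>zy\<close> would lie inside the
    angle between \<open>cz\<close> and \<open>cd\<close>, which \<open>first\<close>
    excludes.\<close>
  have zy_c: "\<not> edges_cross {z, y} {c, t}" if g: "{c, t} \<in> F" for t
  proof
    assume x: "edges_cross {z, y} {c, t}"
    then have d: "distinct [z, y, c, t]" "cr z y c t"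
      using edges_cross_cr'[of z y c t] FP[OF g] in_P by auto
    have "t = d \<or> in_cone c z d t"
    proof (cases "y = d")
      case True
      then show ?thesis using cr_cone[of z d c t] d FP[OF g] in_P by auto
    next
      case False
      then have t: "in_tri c z d y" using yd by blast
      then show ?thesis
        using cr_tri_cone[OF _ _ t d(2)] d(1) False FP[OF g] in_P by auto
    qed
    moreover have "t \<noteq> d"
      using cr_not_tri[of c z d y] d yd in_P by auto
    ultimately show False using first[OF g] by blast
  qed
  have zy_d: "\<not> edges_cross {z, y} {d, t}" if g: "{d, t} \<in> F" "t \<noteq> c" for t
  proof
    assume x: "edges_cross {z, y} {d, t}"
    then have d: "distinct [z, y, d, t]" "cr z y d t"
      using edges_cross_cr'[of z y d t] FP[OF g(1)] in_P by auto
    then have t: "in_tri c z d y" using yd by auto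
    have "\<not> cr c z d t" using clear_cr[OF cz g(1)] d FP[OF g(1)] g(2) in_P by auto
    then show False
      using cr_tri_d[OF _ _ t d(2)] no[of t] d FP[OF g(1)] g(2) in_P by auto
  qed
  have zy_st: "\<not> edges_cross {z, y} {s, t}" if g: "{s, t} \<in> F" "{s, t} \<inter> {c, d} = {}" for s t
  proof
    assume x: "edges_cross {z, y} {s, t}"
    then have d: "distinct [z, y, s, t]" "cr z y s t"
      using edges_cross_cr'[of z y s t] FP[OF g(1)] in_P by auto
    have n: "\<not> cr c z s t" "\<not> cr c d s t"
      using clear_cr[OF cz g(1)] clear_cr[OF cdc g(1)] d FP[OF g(1)] g(2) in_P by auto
    show False
    proof (cases "y = d")
      case True
      then show ?thesis
        using cr_side[of c z d s t] n no[of t] no[of s] d FP[OF g(1)] g(2) in_P by auto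
    next
      case False
      then have t: "in_tri c z d y" using yd by blast
      show ?thesis
        using cr_inner[OF _ _ t d(2) n no no] d False FP[OF g(1)] g(2) in_P by auto
    qed
  qed
  have zy: "clear F {z, y}"
    unfolding clear_def
  proof
    fix g assume g: "g \<in> F"
    obtain s t where st: "g = {s, t}" using F(1) g by (metis complete_edgesE subsetD)
    show "\<not> edges_cross {z, y} g"
    proof (cases "g \<inter> {c, d} = {}")
      case True
      then show ?thesis using zy_st[of s t] g st by blast
    next
      case False
      then consider u where "g = {c, u}" | u where "g = {d, u}" "u \<noteq> c"
        using st by (auto simp: insert_commute)
      then show ?thesis using zy_c zy_d g by cases blast+
    qed
  qed
  have cy: "clear F {c, y}"
  proof (cases "y = d")
    case False
    then have t: "in_tri c z d y" using yd by blast
    have cy_z: "\<not> edges_cross {c, y} {z, t}" if g: "{z, t} \<in> F" for t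
    proof
      assume "edges_cross {c, y} {z, t}"
      then have d: "distinct [c, y, z, t]" "cr c y z t"
        using edges_cross_cr'[of c y z t] FP[OF g] in_P by auto
      have "t \<noteq> d" using cr_not_tri'[of c z d y] d t in_P by auto
      moreover from this have "\<not> cr c d z t" using clear_cr[OF cdc g] d FP[OF g] in_P by auto
      ultimately show False
        using cr_tri'_z[OF _ _ t d(2)] no[of t] d False FP[OF g] in_P by auto
    qed
    have cy_d: "\<not> edges_cross {c, y} {d, t}" if g: "{d, t} \<in> F" "t \<noteq> z" for t
    proof
      assume "edges_cross {c, y} {d, t}"
      then have d: "distinct [c, y, d, t]" "cr c y d t"
        using edges_cross_cr'[of c y d t] FP[OF g(1)] in_P by auto
      have n: "\<not> cr z y d t" "\<not> cr c z d t"
        using clear_cr[OF zy g(1)] clear_cr[OF cz g(1)] d FP[OF g(1)] g(2) in_P by auto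
      show False
        using cr_tri'_d[OF _ _ t d(2) n] no[of t] d False FP[OF g(1)] g(2) in_P by auto
    qed
    have cy_st: "\<not> edges_cross {c, y} {s, t}" if g: "{s, t} \<in> F" "{s, t} \<inter> {z, d} = {}" for s t
    proof
      assume "edges_cross {c, y} {s, t}"
      then have d: "distinct [c, y, s, t]" "cr c y s t"
        using edges_cross_cr'[of c y s t] FP[OF g(1)] in_P by auto
      have n: "\<not> cr z y s t" "\<not> cr c z s t" "\<not> cr c d s t"
        using clear_cr[OF zy g(1)] clear_cr[OF cz g(1)] clear_cr[OF cdc g(1)] d FP[OF g(1)] g(2) in_P
        by auto
      show False
        using cr_inner'[OF _ _ t d(2) n no no] d False FP[OF g(1)] g(2) in_P by auto
    qed
    show ?thesis
      unfolding clear_def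
    proof
      fix g assume g: "g \<in> F"
      obtain s t where st: "g = {s, t}" using F(1) g by (metis complete_edgesE subsetD)
      show "\<not> edges_cross {c, y} g"
      proof (cases "g \<inter> {z, d} = {}")
        case True
        then show ?thesis using cy_st[of s t] g st by blast
      next
        case False
        then consider u where "g = {z, u}" | u where "g = {d, u}" "u \<noteq> z"
          using st by (auto simp: insert_commute)
        then show ?thesis using cy_z cy_d g by cases blast+
      qed
    qed
  qed (simp add: cdc)
  \<comment> \<open>A point inside \<open>czy\<close> would be a candidate with a smaller angle at
    \<open>z\<close> than \<open>y\<close>.\<close>
  have empty: "\<not> in_tri c z y w" if w: "w \<in> P" for w
  proof
    assume t: "in_tri c z y w"
    then have "w \<noteq> c" "w \<noteq> z" "w \<noteq> y" by (auto simp: in_tri_def)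
    moreover from this have "in_cone z c y w" using tri_cone_aux'[OF _ _ t] in_P w by auto
    moreover have "in_tri c z d w"
    proof (cases "y = d")
      case False
      then have y: "in_tri c z d y" using yd by blast
      then have "w \<noteq> d" using tri_asym_aux[of c z d y] t False in_P by auto
      then show ?thesis using tri_tri[OF _ _ y t] False in_P w calculation by auto
    qed (use t in simp)
    ultimately show False using no[OF w] by blast
  qed
  show ?thesis by (rule that[OF yP yd cy zy empty])
qed

text \<open>Among the edges at \<open>c\<close>, \<open>cd\<close> is chosen so that no other one
  lies in the angle between \<open>cz\<close> and \<open>cd\<close>. It stays in \<open>B\<close>,
  so that \<open>d\<close> differs from \<open>z\<close>.\<close>

lemma visible_apex_connector:
  assumes F: "bisects P F A B" and z: "z \<in> A" and c: "c \<in> B" and cz: "clear F {c, z}"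
  obtains d y where "{c, d} \<in> F" "d \<in> B" "y \<in> P" "y = d \<or> in_tri c z d y" "clear F {c, y}" "clear F {z, y}"
    "\<And>w. w \<in> P \<Longrightarrow> \<not> in_tri c z y w"
proof -
  have P: "z \<in> P" "c \<in> P" "z \<noteq> c" using F z c unfolding bisects_def by auto
  have side: "v \<in> B" "v \<in> P" "v \<noteq> c" if "{c, v} \<in> F" for v
    using bisects_edge[OF F that] c by auto
  define S where "S = {v. {c, v} \<in> F}"
  have "S \<noteq> {}" using F P unfolding S_def bisects_def by blast
  moreover have "S \<subseteq> P" "c \<notin> S" "z \<notin> S"
  proof -
    show "S \<subseteq> P" using side(2) unfolding S_def by blast
    show "c \<notin> S" using side(3)[of c] unfolding S_def by blast
    show "z \<notin> S" using side(1)[of z] F z unfolding S_def bisects_def by blast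
  qed
  ultimately obtain d where d: "{c, d} \<in> F" "\<And>w. {c, w} \<in> F \<Longrightarrow> \<not> in_cone c z d w"
    using min_angle[of S c z] P unfolding S_def by auto
  have "z \<noteq> d" using side[OF d(1)] F z unfolding bisects_def by auto
  then show ?thesis
    using visible_apex[of F c d z] d P cz F that side unfolding bisects_def by metis
qed

text \<open>The apex \<open>y\<close> is visible from both ends of \<open>zc\<close> and lies in one
  of the two parts, so one of \<open>zy\<close> and \<open>cy\<close> is a second connector.\<close>

lemma connectors_near:
  assumes F: "bisects P F A B" and k: "k \<in> connectors F A B"
  shows "\<exists>k'\<in>connectors F A B. k' \<noteq> k \<and> k' \<inter> k \<noteq> {}"
proof -
  obtain z c where zc: "k = {z, c}" "z \<in> A" "c \<in> B" "clear F {z, c}"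
    using k unfolding connectors_def by auto
  then have "clear F {c, z}" by (simp add: insert_commute)
  then obtain d y where y: "{c, d} \<in> F" "d \<in> B" "y \<in> P" "y = d \<or> in_tri c z d y" "clear F {c, y}" "clear F {z, y}"
    using visible_apex_connector[OF F zc(2,3)] by metis
  have "y \<noteq> c" "y \<noteq> z"
    using y(4) bisects_edge[OF F y(1)] F zc(2,3) unfolding bisects_def in_tri_def by auto
  moreover have "y \<in> A \<or> y \<in> B" using F y(3) unfolding bisects_def by blast
  moreover have "clear F {y, c}" using y(5) by (simp add: insert_commute)
  ultimately show ?thesis
    using zc y(6) unfolding connectors_def by (auto simp: doubleton_eq_iff)
qed

text \<open>Induction on the number of points in the cone. An edge of \<open>F\<close> at
  \<open>c\<close> inside the cone replaces \<open>cd\<close>. Otherwise there is an apex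
  \<open>y\<close> visible from \<open>p\<close> and \<open>c\<close>; it lies in \<open>A\<close>,
  or \<open>py\<close> would be a connector that avoids \<open>b\<close> and \<open>c\<close>.
  Unless \<open>y\<close> is \<open>b\<close>, it replaces \<open>p\<close>.\<close>

lemma connector_cone:
  assumes F: "bisects P F A B" and b: "b \<in> A" and c: "c \<in> B"
    and none: "\<And>z y. z \<in> A - {b} \<Longrightarrow> y \<in> B - {c} \<Longrightarrow> \<not> clear F {z, y}"
    and p: "p \<in> A - {b}" "clear F {c, p}" and d: "{c, d} \<in> F"
  shows "in_cone c p d b"
  using p d
proof (induction "card {w \<in> P. in_cone c p d w}" arbitrary: p d rule: less_induct)
  case less
  have AB: "A \<union> B = P" "A \<inter> B = {}" and FP: "F \<subseteq> complete_edges P" "noncrossing F"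
    using F unfolding bisects_def by auto
  have side: "v \<in> B" "v \<in> P" "v \<noteq> c" if "{c, v} \<in> F" for v
    using bisects_edge[OF F that] c by auto
  have P: "p \<in> P" "c \<in> P" "b \<in> P" "p \<noteq> c" "p \<noteq> b" "b \<noteq> c" "d \<in> P" "p \<noteq> d" "d \<noteq> c" "b \<noteq> d"
    using side[OF less.prems(3)] AB less.prems b c by auto
  have smaller: "card {w \<in> P. in_cone c p' d' w} < card {w \<in> P. in_cone c p d w}"
    if "\<And>w. w \<in> P \<Longrightarrow> in_cone c p' d' w \<Longrightarrow> in_cone c p d w" "x \<in> P" "in_cone c p d x" "\<not> in_cone c p' d' x" for p' d' x
    by (rule psubset_card_mono) (use that finite_P in auto)
  show ?case
  proof (cases "\<exists>x. {c, x} \<in> F \<and> in_cone c p d x")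
    case True
    then obtain x where x: "{c, x} \<in> F" "in_cone c p d x" by blast
    have sub: "in_cone c p d w" if "w \<in> P" "in_cone c p x w" for w
      using cone_trans[of c p d x w] P x that side[OF x(1)] by auto
    have "card {w \<in> P. in_cone c p x w} < card {w \<in> P. in_cone c p d w}"
      by (rule smaller[of p x x]) (use sub x side[OF x(1)] in \<open>auto simp: in_cone_def\<close>)
    then have "in_cone c p x b" using less.hyps[OF _ less.prems(1,2) x(1)] by blast
    then show ?thesis using sub P by blast
  next
    case False
    then obtain y where y: "y \<in> P" "y = d \<or> in_tri c p d y" "clear F {c, y}" "clear F {p, y}"
      using visible_apex[of F c d p] FP less.prems P by metis
    have "y \<noteq> c" using y(2) P by (auto simp: in_tri_def)
    then have "y \<notin> B" using none[OF less.prems(1)] y(4) by blast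
    then have yA: "y \<in> A" and yd: "y \<noteq> d" using y(1) AB side[OF less.prems(3)] by auto
    then have t: "in_tri c p d y" using y(2) by blast
    then have ypd: "in_cone c p d y" using tri_cone_aux[of c p d y] P y(1) by (auto simp: in_tri_def)
    show ?thesis
    proof (cases "y = b")
      case False
      have sub: "in_cone c p d w" if w: "w \<in> P" "in_cone c y d w" for w
      proof -
        have "in_cone c d p y" using cone_commute[of c p d y] ypd P y(1) by auto
        moreover have "in_cone c d y w" using cone_commute[of c y d w] w P y(1) ypd by (auto simp: in_cone_def)
        ultimately have "in_cone c d p w" using cone_trans[of c d p y w] P y(1) w by auto
        then show ?thesis using cone_commute[of c d p w] P w by auto
      qed
      have "card {w \<in> P. in_cone c y d w} < card {w \<in> P. in_cone c p d w}"
        by (rule smaller[of y d y]) (use sub ypd y(1) in \<open>auto simp: in_cone_def\<close>)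
      then have "in_cone c y d b" using less.hyps[OF _ _ y(3) less.prems(3)] yA False by blast
      then show ?thesis using sub P by blast
    qed (use ypd in simp)
  qed
qed

text \<open>An apex \<open>q\<close> in \<open>A\<close> could serve as \<open>p\<close> in
  \<open>connector_cone\<close>, so that, seen from \<open>c\<close>, \<open>b\<close> would lie
  between \<open>q\<close> and \<open>d\<close>. But \<open>q\<close> lies between \<open>b\<close>
  and \<open>d\<close>.\<close>

lemma connector_apex:
  assumes F: "bisects P F A B" and b: "b \<in> A" and c: "c \<in> B" and bc: "clear F {b, c}"
    and none: "\<And>z y. z \<in> A - {b} \<Longrightarrow> y \<in> B - {c} \<Longrightarrow> \<not> clear F {z, y}"
  obtains q d where "q \<in> B - {c}" "clear F {b, q}" "clear F {c, q}" "{c, d} \<in> F" "q = d \<or> in_cone c b d q"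
    "\<And>w. w \<in> P \<Longrightarrow> \<not> in_tri b c q w"
proof -
  have AB: "A \<union> B = P" "A \<inter> B = {}" and FP: "F \<subseteq> complete_edges P"
    using F unfolding bisects_def by auto
  have "clear F {c, b}" using bc by (simp add: insert_commute)
  then obtain d q where q: "{c, d} \<in> F" "d \<in> B" "q \<in> P" "q = d \<or> in_tri c b d q" "clear F {c, q}" "clear F {b, q}"
    "\<And>w. w \<in> P \<Longrightarrow> \<not> in_tri c b q w"
    using visible_apex_connector[OF F b c] by metis
  have P: "b \<in> P" "c \<in> P" "b \<noteq> c" "d \<in> P" "d \<noteq> c" "d \<noteq> b"
    using AB b c q(2) bisects_edge[OF F q(1)] by auto
  have apex: "in_cone c b d q" if "q \<noteq> d"
    using tri_cone_aux[of c b d q] q(3,4) that P by (auto simp: in_tri_def)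
  have qn: "q \<noteq> c" "q \<noteq> b" using q(4) P by (auto simp: in_tri_def)
  have "q \<in> B"
  proof (rule ccontr)
    assume "q \<notin> B"
    then have "q \<in> A - {b}" "q \<noteq> d" using AB q(2,3) qn by auto
    moreover from this have "in_cone c q d b"
      using connector_cone[OF F b c none] q(1,5) by blast
    ultimately show False using apex cone_not_both[of b c q d] P q(3) qn by auto
  qed
  moreover have "\<not> in_tri b c q w" if "w \<in> P" for w
    using q(7)[OF that] tri_commute_aux[of b c q w] P q(3) qn that by (auto simp: in_tri_def)
  ultimately show ?thesis using that q qn apex by blast
qed

text \<open>Otherwise all connectors meet \<open>bc\<close>. Then the empty visible triangles \<open>bcq\<close> and \<open>bcr\<close> lie
  on different sides of \<open>bc\<close> and form a convex quadrilateral, whose other diagonal \<open>qr\<close> is a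
  connector as well.\<close>

lemma connectors_far:
  assumes F: "bisects P F A B" and b: "b \<in> A" and c: "c \<in> B" and bc: "clear F {b, c}"
  obtains z y where "z \<in> A - {b}" "y \<in> B - {c}" "clear F {z, y}"
proof (rule ccontr)
  assume "\<not> thesis"
  then have none: "\<And>z y. z \<in> A - {b} \<Longrightarrow> y \<in> B - {c} \<Longrightarrow> \<not> clear F {z, y}" using that by blast
  then have none': "\<And>y z. y \<in> B - {c} \<Longrightarrow> z \<in> A - {b} \<Longrightarrow> \<not> clear F {y, z}"
    by (subst insert_commute) (rule none)
  have AB: "A \<union> B = P" "A \<inter> B = {}" and FP: "F \<subseteq> complete_edges P"
    using F unfolding bisects_def by auto
  note F' = bisects_commute[OF F]
  have cb: "clear F {c, b}" using bc by (simp add: insert_commute)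
  obtain q d where q: "q \<in> B - {c}" "clear F {b, q}" "clear F {c, q}" "{c, d} \<in> F" "q = d \<or> in_cone c b d q"
    "\<And>w. w \<in> P \<Longrightarrow> \<not> in_tri b c q w"
    using connector_apex[OF F b c bc none] by metis
  obtain r p where r: "r \<in> A - {b}" "clear F {c, r}" "clear F {b, r}" "{b, p} \<in> F" "r = p \<or> in_cone b c p r"
    "\<And>w. w \<in> P \<Longrightarrow> \<not> in_tri c b r w"
    using connector_apex[OF F' c b cb none'] by metis
  have pd: "p \<in> A" "d \<in> B" "p \<noteq> b" "d \<noteq> c"
    using bisects_edge[OF F r(4)] bisects_edge[OF F q(4)] b c by auto
  have P: "{b, c, q, r, p, d} \<subseteq> P" "distinct [b, c, q, r]" "p \<noteq> c" "p \<noteq> q" "d \<noteq> b" "d \<noteq> r"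
    using AB b c q(1) r(1) pd by auto
  have "in_cone c r d b" using connector_cone[OF F b c none r(1,2) q(4)] .
  \<comment> \<open>Seen from \<open>c\<close> the order is \<open>r\<close>, \<open>b\<close>,
    \<open>q\<close>, where \<open>q\<close> is \<open>d\<close> or precedes it; hence
    \<open>bc\<close> separates \<open>q\<close> from \<open>r\<close>.\<close>
  then have 1: "in_cone c r q b"
    using q(5) cone_opposite[of c r q b d] P pd by (auto simp: in_cone_def)
  have "in_cone b q p c" using connector_cone[OF F' c b none' q(1,2) r(4)] .
  then have 2: "in_cone b q r c"
    using r(5) cone_opposite[of b q r c p] P pd by (auto simp: in_cone_def)
  have x: "cr q r b c" using cone_cone_cr[of c r q b] 1 2 P by auto
  have x': "cr q r c b"
    using x edges_cross_cr'[of q r b c] edges_cross_cr'[of q r c b] P by (auto simp: insert_commute)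
  have tri: "\<not> in_tri b c r w" "\<not> in_tri c b r w" "\<not> in_tri b c q w" "\<not> in_tri c b q w" if "w \<in> P" for w
    using q(6)[OF that] r(6)[OF that] tri_commute_aux[of b c r w] tri_commute_aux[of c b q w] P that
    by (auto simp: in_tri_def)
  have FP2: "s \<in> P" "t \<in> P" "s \<noteq> t" if "{s, t} \<in> F" for s t
    using edge_endpoints[OF FP that] by auto
  have "{b, c} \<notin> F" using F b c AB unfolding bisects_def by blast
  have g_b: "\<not> edges_cross {q, r} {b, t}" if g: "{b, t} \<in> F" for t
  proof
    assume "edges_cross {q, r} {b, t}"
    then have e: "distinct [q, r, b, t]" "cr q r b t"
      using edges_cross_cr'[of q r b t] FP2[OF g] P by auto
    have tc: "t \<noteq> c" using g \<open>{b, c} \<notin> F\<close> by auto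
    have "\<not> cr c r b t" "\<not> cr c q b t"
      using clear_cr[OF r(2) g] clear_cr[OF q(3) g] e tc FP2[OF g] P by auto
    then show False
      using quad_cross5[of b c q r t] x e tri[of t] tc FP2[OF g] P by auto
  qed
  have g_c: "\<not> edges_cross {q, r} {c, t}" if g: "{c, t} \<in> F" for t
  proof
    assume "edges_cross {q, r} {c, t}"
    then have e: "distinct [q, r, c, t]" "cr q r c t"
      using edges_cross_cr'[of q r c t] FP2[OF g] P by auto
    have tc: "t \<noteq> b" using g \<open>{b, c} \<notin> F\<close> by (auto simp: insert_commute)
    have "\<not> cr b r c t" "\<not> cr b q c t"
      using clear_cr[OF r(3) g] clear_cr[OF q(2) g] e tc FP2[OF g] P by auto
    then show False
      using quad_cross5[of c b q r t] x' e tri[of t] tc FP2[OF g] P by auto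
  qed
  have g_st: "\<not> edges_cross {q, r} {s, t}" if g: "{s, t} \<in> F" "{s, t} \<inter> {b, c} = {}" for s t
  proof
    assume "edges_cross {q, r} {s, t}"
    then have e: "distinct [q, r, s, t]" "cr q r s t"
      using edges_cross_cr'[of q r s t] FP2[OF g(1)] P by auto
    have n: "\<not> cr b r s t" "\<not> cr c r s t" "\<not> cr b q s t" "\<not> cr c q s t" "\<not> cr b c s t"
      using clear_cr[OF r(3) g(1)] clear_cr[OF r(2) g(1)] clear_cr[OF q(2) g(1)]
        clear_cr[OF q(3) g(1)] clear_cr[OF bc g(1)] e g(2) FP2[OF g(1)] P by auto
    show False
      using quad_cross6[OF _ _ x e(2) n] tri[of s] tri[of t] e(1) g(2) FP2[OF g(1)] P by auto
  qed
  have "clear F {q, r}"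
    unfolding clear_def
  proof
    fix g assume g: "g \<in> F"
    obtain s t where st: "g = {s, t}" using FP g by (metis complete_edgesE subsetD)
    show "\<not> edges_cross {q, r} g"
    proof (cases "g \<inter> {b, c} = {}")
      case True
      then show ?thesis using g_st[of s t] g st by blast
    next
      case False
      then consider u where "g = {b, u}" | u where "g = {c, u}"
        using st by (auto simp: insert_commute)
      then show ?thesis using g_b g_c g by cases blast+
    qed
  qed
  then show False using none'[of q r] q(1) r(1) by blast
qed

text \<open>Besides \<open>k1\<close> take \<open>l1\<close> disjoint from \<open>k1\<close> and
  \<open>l2\<close> meeting \<open>k1\<close>. A neighbour \<open>l3\<close> of \<open>l1\<close> is
  a fourth connector unless it is \<open>l2\<close>. In that case \<open>l2\<close> meets both
  \<open>k1\<close> and \<open>l1\<close>, so a connector \<open>l4\<close> disjoint from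
  \<open>l2\<close> is new.\<close>

lemma fourth_connector:
  assumes F: "bisects P F A B" and k: "k1 \<in> connectors F A B"
  obtains k where "k \<in> connectors F A B" "k \<noteq> k1" "k \<noteq> k2" "k \<noteq> k3"
proof -
  have far: "\<exists>l'\<in>connectors F A B. l' \<inter> l = {}" if l: "l \<in> connectors F A B" for l
  proof -
    obtain b c where bc: "l = {b, c}" "b \<in> A" "c \<in> B" "clear F {b, c}"
      using l unfolding connectors_def by auto
    obtain z y where "z \<in> A - {b}" "y \<in> B - {c}" "clear F {z, y}"
      using connectors_far[OF F bc(2-4)] by metis
    moreover have "A \<inter> B = {}" using F unfolding bisects_def by blast
    ultimately show ?thesis
      using bc unfolding connectors_def by (intro bexI[of _ "{z, y}"]) auto
  qed
  have ne: "l \<noteq> {}" if "l \<in> connectors F A B" for l using that unfolding connectors_def by auto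
  obtain l1 where l1: "l1 \<in> connectors F A B" "l1 \<inter> k1 = {}" using far[OF k] by blast
  obtain l2 where l2: "l2 \<in> connectors F A B" "l2 \<inter> k1 \<noteq> {}" "l2 \<noteq> k1" using connectors_near[OF F k] by blast
  obtain l3 where l3: "l3 \<in> connectors F A B" "l3 \<inter> l1 \<noteq> {}" "l3 \<noteq> l1"
    using connectors_near[OF F l1(1)] by blast
  obtain l4 where l4: "l4 \<in> connectors F A B" "l4 \<inter> l2 = {}" using far[OF l2(1)] by blast
  have "k1 \<noteq> l1" "l1 \<noteq> l2" "l3 \<noteq> k1" "l4 \<noteq> l2" using l1 l2 l3 l4 ne[OF k] ne[OF l2(1)] by blast+
  have "l3 \<noteq> l2 \<or> (l4 \<noteq> k1 \<and> l4 \<noteq> l1)" using l2 l3 l4 by blast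
  then have "\<exists>m\<in>{l3, l4}. m \<noteq> k1 \<and> m \<noteq> l1 \<and> m \<noteq> l2"
    using l3 \<open>l3 \<noteq> k1\<close> \<open>l4 \<noteq> l2\<close> by blast
  then obtain m where m: "m \<in> connectors F A B" "m \<noteq> k1" "m \<noteq> l1" "m \<noteq> l2" using l3(1) l4(1) by blast
  then consider "l1 \<notin> {k2, k3}" | "l2 \<notin> {k2, k3}" | "m \<notin> {k2, k3}"
    using \<open>l1 \<noteq> l2\<close> by blast
  then show ?thesis
    using that l1(1) l2(1,3) m \<open>k1 \<noteq> l1\<close> by cases blast+
qed

end

subsection \<open>Stars in the tree graph\<close>

definition star :: "'a set \<Rightarrow> 'a \<Rightarrow> 'a set set" where
  "star P a = (\<lambda>x. {a, x}) ` (P - {a})"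

text \<open>Stated for an arbitrary relation, so that every bijection that respects adjacency
  transports it.\<close>

definition starlike :: "('b \<Rightarrow> 'b \<Rightarrow> bool) \<Rightarrow> 'b \<Rightarrow> bool" where
  "starlike adj T \<longleftrightarrow>
     (\<forall>p. adj T p \<longrightarrow> (\<exists>q. adj T q \<and> adj p q \<and> \<not> (\<exists>r. adj T r \<and> adj p r \<and> adj q r)))"

lemma star_edge: "a \<in> P \<Longrightarrow> {u, v} \<in> star P a \<longleftrightarrow> u \<in> P \<and> v \<in> P \<and> u \<noteq> v \<and> (u = a \<or> v = a)"
  unfolding star_def image_iff doubleton_eq_iff by auto

lemma star_elem: "e \<in> star P a \<Longrightarrow> a \<in> e"
  unfolding star_def by auto

lemma card_star: "finite P \<Longrightarrow> a \<in> P \<Longrightarrow> card P = Suc (card (star P a))"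
  unfolding star_def
  by (subst card_image) (auto simp: inj_on_def doubleton_eq_iff card_Suc_Diff1 simp del: card_Diff_insert)

context points
begin

lemma star_sst:
  assumes "a \<in> P"
  shows "star P a \<in> simple_spanning_trees P"
proof -
  have ne: "P \<noteq> {}" using assms by blast
  have a: "conn (star P a) a x" if "x \<in> P" for x
    using that assms by (cases "x = a") (auto intro: conn_edge simp: star_edge)
  have "conn (star P a) u v" if "u \<in> P" "v \<in> P" for u v
    using conn_trans[OF conn_sym[OF a[OF that(1)]] a[OF that(2)]] .
  moreover have "star P a \<subseteq> complete_edges P"
    unfolding star_def using assms by (auto simp: complete_edges_iff)
  moreover have "\<not> edges_cross e f" if "e \<in> star P a" "f \<in> star P a" for e f
    using star_elem[OF that(1)] star_elem[OF that(2)] edges_cross_disjoint[of e f] by blast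
  ultimately show ?thesis
    using card_star[OF finite_P assms] unfolding sst_iff[OF ne] by blast
qed

lemma sst_swap_edge:
  assumes "swap T e g \<in> simple_spanning_trees P"
  shows "g \<in> complete_edges P"
  using sst_edges[OF assms] unfolding swap_def by blast

lemma sst_swap_clear:
  assumes "swap T e g \<in> simple_spanning_trees P"
  shows "clear (T - {e}) g"
  using sst_noncross[OF assms] unfolding swap_def clear_def by blast

text \<open>After the only edge at \<open>x\<close> is deleted, only the new edge can attach
  \<open>x\<close> again.\<close>

lemma swap_leaf:
  assumes T: "T \<in> simple_spanning_trees P" and e: "{a, x} \<in> T"
    and leaf: "\<And>y. {x, y} \<in> T \<Longrightarrow> y = a"
    and s: "swap T {a, x} g \<in> simple_spanning_trees P"
  obtains b where "g = {x, b}" "b \<in> P" "b \<noteq> x"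
proof -
  have P: "a \<in> P" "x \<in> P" "a \<noteq> x" using sst_edge[OF T e] by auto
  obtain z where z: "{x, z} \<in> swap T {a, x} g" using sst_incident[OF s P(2,1)] P(3) by blast
  have "{x, z} \<notin> T - {{a, x}}" using leaf[of z] by (auto simp: insert_commute)
  then have "g = {x, z}" using z unfolding swap_def by auto
  then show ?thesis using that sst_edge[OF s z] by auto
qed

text \<open>The neighbour \<open>p\<close> exchanges \<open>{a, x}\<close> for
  \<open>{x, b}\<close>; its partner \<open>q\<close> deletes \<open>{a, b}\<close> instead, the
  other old edge of the cycle \<open>a\<close>, \<open>x\<close>, \<open>b\<close>. Of the common
  neighbours of the star and \<open>p\<close>, those over the same forest are not adjacent to
  \<open>q\<close>, and any other one apart from \<open>q\<close> would keep the whole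
  cycle.\<close>

lemma starlike_star:
  assumes a: "a \<in> P"
  shows "starlike (tadj P) (star P a)"
  unfolding starlike_def
proof (intro allI impI)
  let ?S = "star P a"
  note S = star_sst[OF a]
  fix p assume p: "tadj P ?S p"
  obtain e g where eg: "e \<in> ?S" "g \<notin> ?S" "p = swap ?S e g" using tadjE[OF p] by metis
  obtain x where x: "e = {a, x}" "x \<in> P" "x \<noteq> a" using eg(1) unfolding star_def by auto
  have pS: "swap ?S {a, x} g \<in> simple_spanning_trees P" using p eg(3) x(1) unfolding tadj_def by simp
  have e: "{a, x} \<in> ?S" using eg(1) x(1) by simp
  have leaf: "y = a" if "{x, y} \<in> ?S" for y
    using that a x(3) by (simp add: star_edge)
  obtain b where b: "g = {x, b}" "b \<in> P" "b \<noteq> x" using swap_leaf[OF S e leaf pS] by metis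
  have ba: "b \<noteq> a" using eg(2) b(1) e by (auto simp: insert_commute)
  define q where "q = swap ?S {a, b} g"
  have ab: "{a, b} \<in> ?S" using a b(2) ba by (simp add: star_edge)
  have q: "q \<in> simple_spanning_trees P"
    unfolding q_def
  proof (rule sst_swap[OF S ab sst_swap_edge[OF pS] eg(2)])
    have "conn (swap ?S {a, b} g) a x" "conn (swap ?S {a, b} g) x b"
      using e b x(3) ba by (auto intro!: conn_edge simp: swap_def doubleton_eq_iff)
    then show "conn (swap ?S {a, b} g) a b" by (rule conn_trans)
    have "\<not> edges_cross g {a, x}" using edges_cross_disjoint[of g "{a, x}"] b(1) by blast
    then show "clear (?S - {{a, b}}) g"
      using sst_swap_clear[OF pS] unfolding clear_def by blast
  qed
  have neq: "{a, x} \<noteq> {a, b}" using b(3) by (auto simp: doubleton_eq_iff)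
  have pq: "tadj P p q"
    using tadj_swap_swap[OF eg(1,2) ab eg(2)] q p eg(3) neq x(1) unfolding q_def tadj_def by blast
  have "False" if r: "tadj P ?S r" "tadj P p r" "tadj P q r" for r
  proof -
    have r2: "tadj P (swap ?S {a, x} g) r" using r(2) eg(3) x(1) by simp
    show False
    proof (rule common_neighbour[OF e eg(2) r(1) r2])
      fix h assume h: "h \<notin> ?S" "h \<noteq> g" "r = swap ?S {a, x} h"
      then show False
        using tadj_swap_swap[OF ab eg(2) e h(1)] r(1,3) q neq unfolding q_def tadj_def by auto
    next
      fix h assume h: "h \<in> ?S" "h \<noteq> {a, x}" "r = swap ?S h g"
      have "h \<noteq> {a, b}"
        using r(3) tadj_neq h(3) unfolding q_def by blast
      then have "{a, x} \<in> r" "{a, b} \<in> r" "{x, b} \<in> r"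
        using h(2,3) e ab b(1) unfolding swap_def by auto
      then show False using sst_no_triangle[of r a x b] r(1) unfolding tadj_def by blast
    qed
  qed
  then show "\<exists>q. tadj P ?S q \<and> tadj P p q \<and> \<not> (\<exists>r. tadj P ?S r \<and> tadj P p r \<and> tadj P q r)"
    using tadj_swap[OF S ab eg(2)] q pq unfolding q_def by blast
qed

text \<open>Otherwise every edge has an end of degree one. If \<open>c\<close> is such an end of
  \<open>bc\<close>, then all neighbours of \<open>b\<close> are leaves as well, and connectivity
  makes the tree the star of \<open>b\<close>. A single point carries the empty star.\<close>

lemma internal_edge:
  assumes T: "T \<in> simple_spanning_trees P" and ns: "\<And>a. a \<in> P \<Longrightarrow> T \<noteq> star P a"
  obtains b c b' c' where "{b, c} \<in> T" "{b, b'} \<in> T" "b' \<noteq> c" "{c, c'} \<in> T" "c' \<noteq> b"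
proof (rule ccontr)
  note found = that
  assume "\<not> thesis"
  then have no: "b' = c \<or> c' = b" if "{b, c} \<in> T" "{b, b'} \<in> T" "{c, c'} \<in> T" for b c b' c'
    using found[OF that(1,2) _ that(3)] by blast
  have star: "T = star P b" if bc: "{b, c} \<in> T" and leaf: "\<And>w. {c, w} \<in> T \<Longrightarrow> w = b" for b c
  proof -
    have P: "b \<in> P" "c \<in> P" "b \<noteq> c" using sst_edge[OF T bc] by auto
    have "v \<in> insert b {v. {b, v} \<in> T}" if v: "v \<in> P" for v
    proof (rule conn_closed[OF sst_conn[OF T P(1) v]])
      fix x y assume xy: "{x, y} \<in> T" "x \<in> insert b {v. {b, v} \<in> T}"
      show "y \<in> insert b {v. {b, v} \<in> T}"
      proof (cases "x = b")
        case False
        then have bx: "{b, x} \<in> T" using xy(2) by simp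
        have "c = x \<or> y = b" using no[OF bx bc xy(1)] .
        then show ?thesis using leaf[of y] xy(1) by auto
      qed (use xy in simp)
    qed simp
    then have "star P b \<subseteq> T" unfolding star_def by auto
    moreover have "card T = card (star P b)"
      using sst_card[OF T] card_star[OF finite_P P(1)] by simp
    ultimately show ?thesis using card_subset_eq[OF sst_finite[OF T]] by metis
  qed
  obtain p where p: "p \<in> P" using sst_nonempty[OF T] by blast
  show False
  proof (cases "P = {p}")
    case True
    then have "T \<subseteq> {}" using sst_edges[OF T] by (auto elim!: complete_edgesE)
    then show False using ns[OF p] True unfolding star_def by simp
  next
    case False
    then obtain p' where "p' \<in> P" "p \<noteq> p'" using p by blast
    then obtain c where bc: "{p, c} \<in> T" using sst_incident[OF T p] by blast
    then have cb: "{c, p} \<in> T" by (simp add: insert_commute)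
    show False
    proof (cases "\<forall>w. {c, w} \<in> T \<longrightarrow> w = p")
      case True
      then show False using star[OF bc] ns[OF p] by blast
    next
      case False
      then have "w = c" if "{p, w} \<in> T" for w using no[OF bc that] by blast
      then show False using star[OF cb] ns[of c] sst_edge[OF T bc] by blast
    qed
  qed
qed

text \<open>The edges to \<open>b'\<close> and \<open>c'\<close> keep \<open>b\<close> and
  \<open>c\<close> from being isolated once \<open>bc\<close> is deleted.\<close>

lemma bisects_internal:
  assumes T: "T \<in> simple_spanning_trees P" and bc: "{b, c} \<in> T"
    and b': "{b, b'} \<in> T" "b' \<noteq> c" and c': "{c, c'} \<in> T" "c' \<noteq> b"
  defines "F \<equiv> T - {{b, c}}"
  defines "A \<equiv> {v \<in> P. conn F b v}"
  shows "bisects P F A (P - A)" "b \<in> A" "c \<in> P - A"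
proof -
  have P: "b \<in> P" "c \<in> P" "b \<noteq> c" using sst_edge[OF T bc] by auto
  have FT: "F \<subseteq> T" unfolding F_def by blast
  have FP: "F \<subseteq> complete_edges P" using FT sst_edges[OF T] by blast
  have "noncrossing F"
    unfolding noncrossing_def clear_def using sst_noncross[OF T] FT by blast
  moreover have "u \<in> A \<longleftrightarrow> v \<in> A" if uv: "{u, v} \<in> F" for u v
  proof -
    have "u \<in> P" "v \<in> P" using edge_endpoints[OF FP uv] by auto
    moreover have "conn F u v" "conn F v u" using conn_edge[OF uv] conn_sym by auto
    ultimately show ?thesis unfolding A_def using conn_trans[of F b] by blast
  qed
  moreover have "\<exists>w. {v, w} \<in> F" if v: "v \<in> P" for v
  proof -
    consider "v = b" | "v = c" | "v \<noteq> b" "v \<noteq> c" by blast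
    then show ?thesis
    proof cases
      case 1
      then show ?thesis using b' unfolding F_def by (auto simp: doubleton_eq_iff)
    next
      case 2
      then show ?thesis using c' P unfolding F_def by (auto simp: doubleton_eq_iff)
    next
      case 3
      then show ?thesis using sst_incident[OF T v P(1)] unfolding F_def by (auto simp: doubleton_eq_iff)
    qed
  qed
  ultimately show "bisects P F A (P - A)" unfolding bisects_def A_def using FP by blast
  show "b \<in> A" unfolding A_def using P by simp
  show "c \<in> P - A" unfolding A_def F_def using P sst_bridge[OF T bc] by simp
qed

text \<open>The new edge has to join the two components of \<open>F\<close>, and \<open>F\<close>
  already connects each of them.\<close>

lemma connector_swap:
  assumes T: "T \<in> simple_spanning_trees P" and bc: "{b, c} \<in> T"
  defines "F \<equiv> T - {{b, c}}"
  defines "A \<equiv> {v \<in> P. conn F b v}"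
  assumes g: "g \<notin> T"
  shows "swap T {b, c} g \<in> simple_spanning_trees P \<longleftrightarrow> g \<in> connectors F A (P - A)"
proof
  have P: "b \<in> P" "c \<in> P" "b \<noteq> c" using sst_edge[OF T bc] by auto
  {
    assume s: "swap T {b, c} g \<in> simple_spanning_trees P"
    obtain u v where uv: "g = {u, v}" "u \<in> P" "v \<in> P" "u \<noteq> v"
      using sst_swap_edge[OF s] by (rule complete_edgesE)
    have "conn (insert {u, v} F) b c"
      using sst_conn[OF s P(1,2)] uv(1) unfolding swap_def F_def by simp
    moreover have nc: "\<not> conn F b c" using sst_bridge[OF T bc] unfolding F_def .
    ultimately consider "conn F b u" "conn F v c" | "conn F b v" "conn F u c"
      unfolding conn_insert by blast
    then show "g \<in> connectors F A (P - A)"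
    proof cases
      case 1
      moreover from this have "\<not> conn F b v" using nc conn_trans by metis
      ultimately show ?thesis
        using uv sst_swap_clear[OF s] unfolding connectors_def A_def F_def by blast
    next
      case 2
      moreover from this have "\<not> conn F b u" using nc conn_trans by metis
      moreover have "g = {v, u}" using uv(1) by (simp add: insert_commute)
      ultimately show ?thesis
        using uv(2,3) sst_swap_clear[OF s] unfolding connectors_def A_def F_def by blast
    qed
  next
    assume "g \<in> connectors F A (P - A)"
    then obtain z y where zy: "g = {z, y}" "z \<in> A" "y \<in> P - A" "clear F g"
      unfolding connectors_def by blast
    have y: "conn F c y"
      using conn_delete[of P T b y c] sst_conn[OF T P(1)] zy(3) unfolding A_def F_def by auto
    have sub: "F \<subseteq> swap T {b, c} g" unfolding F_def swap_def by blast
    have "conn (swap T {b, c} g) b z" "conn (swap T {b, c} g) y c"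
      using conn_mono[OF _ sub] zy(2) conn_sym[OF y] unfolding A_def by auto
    moreover have "conn (swap T {b, c} g) z y"
      by (rule conn_edge) (simp add: swap_def zy(1))
    ultimately have "conn (swap T {b, c} g) b c" by (meson conn_trans)
    moreover have "g \<in> complete_edges P"
      using zy(1-3) unfolding A_def by (auto simp: complete_edges_iff)
    ultimately show "swap T {b, c} g \<in> simple_spanning_trees P"
      using sst_swap[OF T bc _ g] zy(4) unfolding F_def by blast
  }
qed

text \<open>The neighbour that refutes \<open>starlike\<close> exchanges the inner edge
  \<open>?e\<close> for a connector \<open>?f\<close> disjoint from it. A partner \<open>q\<close>
  over the same forest is met by a fourth connector, a partner on the cycle through
  \<open>?f\<close> by a further edge of that cycle.\<close>

lemma not_starlike:
  assumes T: "T \<in> simple_spanning_trees P" and ns: "\<And>a. a \<in> P \<Longrightarrow> T \<noteq> star P a"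
  shows "\<not> starlike (tadj P) T"
proof
  assume sl: "starlike (tadj P) T"
  obtain b c b' c' where bc: "{b, c} \<in> T" "{b, b'} \<in> T" "b' \<noteq> c" "{c, c'} \<in> T" "c' \<noteq> b"
    using internal_edge[OF T ns] by metis
  define F where "F = T - {{b, c}}"
  define A where "A = {v \<in> P. conn F b v}"
  note bis = bisects_internal[OF T bc, folded F_def, folded A_def]
  note K = connector_swap[OF T bc(1), folded F_def, folded A_def]
  let ?K = "connectors F A (P - A)" and ?e = "{b, c}"
  have "clear T {b, c}" using sst_noncross[OF T bc(1)] unfolding clear_def by blast
  then have cl: "clear F {b, c}" unfolding F_def by (rule clear_mono) blast
  obtain z y where zy: "z \<in> A - {b}" "y \<in> P - A - {c}" "clear F {z, y}"
    using connectors_far[OF bis(1-3) cl] by metis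
  let ?f = "{z, y}"
  have fK: "?f \<in> ?K" using zy unfolding connectors_def by blast
  have KT: "k \<notin> T" if k: "k \<in> ?K" "k \<noteq> ?e" for k
  proof
    assume "k \<in> T"
    then have "k \<in> F" using k(2) unfolding F_def by blast
    obtain u v where uv: "k = {u, v}" "u \<in> A" "v \<in> P - A" using k(1) unfolding connectors_def by blast
    then have "{u, v} \<in> F" using \<open>k \<in> F\<close> by simp
    then show False using bisects_edge(4)[OF bis(1)] uv(2,3) by blast
  qed
  have fe: "?f \<noteq> ?e" using zy bis(2,3) by (auto simp: doubleton_eq_iff)
  note fT = KT[OF fK fe]
  have pS: "swap T ?e ?f \<in> simple_spanning_trees P" using K[OF fT] fK by blast
  then have Tp: "tadj P T (swap T ?e ?f)" using tadj_swap[OF T bc(1) fT] by blast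
  then obtain q where q: "tadj P T q" "tadj P (swap T ?e ?f) q"
    and nor: "\<And>r. tadj P T r \<Longrightarrow> tadj P (swap T ?e ?f) r \<Longrightarrow> tadj P q r \<Longrightarrow> False"
    using sl unfolding starlike_def by blast
  have qS: "q \<in> simple_spanning_trees P" using q(1) unfolding tadj_def by blast
  show False
  proof (rule common_neighbour[OF bc(1) fT q])
    fix h assume h: "h \<notin> T" "h \<noteq> ?f" "q = swap T ?e h"
    obtain k where k: "k \<in> ?K" "k \<noteq> ?f" "k \<noteq> ?e" "k \<noteq> h"
      using fourth_connector[OF bis(1) fK, of ?e h] by metis
    note kT = KT[OF k(1,3)]
    have r: "swap T ?e k \<in> simple_spanning_trees P" using K[OF kT] k(1) by blast
    have "tadj P (swap T ?e ?f) (swap T ?e k)"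
      using tadj_swap_swap[OF bc(1) fT bc(1) kT pS r] k(2) by auto
    moreover have "tadj P q (swap T ?e k)"
      using tadj_swap_swap[OF bc(1) h(1) bc(1) kT _ r] h(3) qS k(4) by auto
    ultimately show False using nor tadj_swap[OF T bc(1) kT r] by blast
  next
    fix h assume h: "h \<in> T" "h \<noteq> ?e" "q = swap T h ?f"
    have "?e \<in> q" "?f \<in> q" using h bc(1) unfolding swap_def by auto
    \<comment> \<open>\<open>q\<close> contains both edges, so \<open>?f\<close> crosses nothing in
      \<open>T\<close>, and deleting any edge of its cycle gives a tree.\<close>
    then have "\<not> edges_cross ?f ?e" using sst_noncross[OF qS] by blast
    then have fcl: "clear T ?f" using zy(3) unfolding F_def clear_def by blast
    have zP: "z \<in> P" "y \<in> P" "z \<noteq> y" "z \<noteq> b" "z \<noteq> c" "y \<noteq> b" "y \<noteq> c"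
      using zy bis(2,3) unfolding A_def by auto
    have fP: "{u, v} \<in> complete_edges P" if "{u, v} = ?f" for u v
      using that zP by (simp add: complete_edges_iff)
    have ex: "\<exists>x. {u, x} \<in> T \<and> swap T {u, x} ?f \<in> simple_spanning_trees P"
      if u: "?f = {u, v}" "u \<in> P" "v \<in> P" "u \<noteq> v" for u v
    proof -
      have "\<not> conn {e \<in> T. u \<notin> e} v u"
      proof
        assume "conn {e \<in> T. u \<notin> e} v u"
        then have "u \<in> - {u}" by (rule conn_closed) (use u in auto)
        then show False by simp
      qed
      then obtain x where x: "{u, x} \<in> T" "conn {e \<in> T. u \<notin> e} v x"
        using conn_first_edge[OF sst_conn[OF T u(3,2)], of u] u(4) by blast
      have vx: "conn (swap T {u, x} ?f) v x"
        by (rule conn_mono[OF x(2)]) (auto simp: swap_def)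
      have "conn (swap T {u, x} ?f) u v"
        by (rule conn_edge) (simp add: swap_def u(1))
      from conn_trans[OF this vx] have "swap T {u, x} ?f \<in> simple_spanning_trees P"
        using sst_swap[OF T x(1) _ fT] fP[of z y] clear_mono[OF fcl, of "T - {{u, x}}"] by blast
      then show ?thesis using x(1) by blast
    qed
    obtain x1 where x1: "{z, x1} \<in> T" "swap T {z, x1} ?f \<in> simple_spanning_trees P"
      using ex[of z y] zP by blast
    obtain x2 where x2: "{y, x2} \<in> T" "swap T {y, x2} ?f \<in> simple_spanning_trees P"
      using ex[OF insert_commute zP(2,1)] zP(3) by blast
    \<comment> \<open>The cycle edges at the two ends of \<open>?f\<close> could coincide only in
      \<open>?f\<close>, which is not in \<open>T\<close>. They differ from \<open>?e\<close>
      because \<open>?f\<close> is disjoint from it, so one of them is neither \<open>?e\<close> nor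
      \<open>h\<close>.\<close>
    have ne: "{z, x1} \<noteq> {y, x2}" using x1(1) fT zP by (auto simp: doubleton_eq_iff)
    have ne': "{z, x1} \<noteq> ?e" "{y, x2} \<noteq> ?e" using zP by (auto simp: doubleton_eq_iff)
    obtain d where d: "d \<in> T" "swap T d ?f \<in> simple_spanning_trees P" "d \<noteq> ?e" "d \<noteq> h"
    proof (cases "{z, x1} = h")
      case True
      then show ?thesis using that[OF x2 ne'(2)] ne by blast
    next
      case False
      then show ?thesis using that[OF x1 ne'(1)] by blast
    qed
    have "tadj P (swap T ?e ?f) (swap T d ?f)"
      using tadj_swap_swap[OF bc(1) fT d(1) fT pS d(2)] d(3) by auto
    moreover have "tadj P q (swap T d ?f)"
      using tadj_swap_swap[OF h(1) fT d(1) fT _ d(2)] h(3) qS d(4) by auto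
    ultimately show False using nor tadj_swap[OF T d(1) fT d(2)] by blast
  qed
qed

lemma starlike_iff:
  "T \<in> simple_spanning_trees P \<Longrightarrow> starlike (tadj P) T \<longleftrightarrow> (\<exists>a\<in>P. T = star P a)"
  using starlike_star not_starlike by blast

end

subsection \<open>Double stars\<close>

definition dstar :: "'a set \<Rightarrow> 'a \<Rightarrow> 'a \<Rightarrow> 'a set \<Rightarrow> 'a set set" where
  "dstar P a b I = insert {a, b} ((\<lambda>x. {a, x}) ` (P - {a, b} - I) \<union> (\<lambda>x. {b, x}) ` I)"

text \<open>A walk of exactly \<open>k\<close> steps, which bounds the distance from above.
  Isomorphisms carry walks over, and the existence of one is all that the degree bound
  needs.\<close>

primrec dist_le :: "(real ^ 2) set \<Rightarrow> nat \<Rightarrow> (real ^ 2) set set \<Rightarrow> (real ^ 2) set set \<Rightarrow> bool" where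
  "dist_le P 0 T U \<longleftrightarrow> T = U"
| "dist_le P (Suc k) T U \<longleftrightarrow> (\<exists>V. tadj P T V \<and> dist_le P k V U)"

lemma dstar_edge:
  assumes "a \<in> P" "b \<in> P" "a \<noteq> b" "I \<subseteq> P - {a, b}"
  shows "{u, v} \<in> dstar P a b I \<longleftrightarrow>
    u = a \<and> v \<in> P - {a} - I \<or> v = a \<and> u \<in> P - {a} - I \<or> u = b \<and> v \<in> I \<or> v = b \<and> u \<in> I"
  using assms unfolding dstar_def insert_iff Un_iff image_iff doubleton_eq_iff by auto

lemma dstar_commute: "I \<subseteq> P - {a, b} \<Longrightarrow> dstar P a b I = dstar P b a (P - {a, b} - I)"
proof -
  assume I: "I \<subseteq> P - {a, b}"
  then have "P - {b, a} - (P - {a, b} - I) = I" by blast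
  then show ?thesis unfolding dstar_def by (simp add: Un_commute insert_commute)
qed

lemma dstar_empty: "a \<noteq> b \<Longrightarrow> b \<in> P \<Longrightarrow> dstar P a b {} = star P a"
  unfolding dstar_def star_def by auto

lemma dstar_remove:
  assumes "a \<in> P" "b \<in> P" "a \<noteq> b" "I \<subseteq> P - {a, b}" "z \<in> I"
  shows "dstar P a b (I - {z}) = swap (dstar P a b I) {b, z} {a, z}"
proof -
  have 1: "P - {a, b} - (I - {z}) = insert z (P - {a, b} - I)" using assms by blast
  have 2: "(\<lambda>x. {b, x}) ` (I - {z}) = (\<lambda>x. {b, x}) ` I - {{b, z}}"
    by (auto simp: doubleton_eq_iff)
  have 3: "{b, z} \<notin> (\<lambda>x. {a, x}) ` (P - {a, b} - I)" "{b, z} \<noteq> {a, b}"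
    using assms by (auto simp: doubleton_eq_iff)
  have exchange: "insert e (insert g X \<union> (Y - {h})) = insert g (insert e (X \<union> Y) - {h})"
    if "h \<notin> X" "h \<noteq> e" for e g h :: "'a set" and X Y
    using that by blast
  show ?thesis unfolding dstar_def swap_def 1 2 image_insert by (rule exchange[OF 3])
qed

lemma card_dstar:
  assumes "finite P" "a \<in> P" "b \<in> P" "a \<noteq> b" "I \<subseteq> P - {a, b}"
  shows "card P = Suc (card (dstar P a b I))"
proof -
  have fin: "finite I" using assms(1,5) finite_subset by blast
  have "card (dstar P a b I) = Suc (card ((\<lambda>x. {a, x}) ` (P - {a, b} - I) \<union> (\<lambda>x. {b, x}) ` I))"
    unfolding dstar_def using assms fin by (subst card_insert_disjoint) (auto simp: doubleton_eq_iff)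
  also have "\<dots> = Suc (card ((\<lambda>x. {a, x}) ` (P - {a, b} - I)) + card ((\<lambda>x. {b, x}) ` I))"
    using assms fin by (subst card_Un_disjoint) (auto simp: doubleton_eq_iff)
  also have "card ((\<lambda>x. {a, x}) ` (P - {a, b} - I)) = card (P - {a, b} - I)"
    by (rule card_image) (auto simp: inj_on_def doubleton_eq_iff)
  also have "card ((\<lambda>x. {b, x}) ` I) = card I"
    by (rule card_image) (auto simp: inj_on_def doubleton_eq_iff)
  also have "card (P - {a, b} - I) + card I = card (P - {a, b})"
    using assms fin by (metis card_Diff_subset card_mono finite_Diff le_add_diff_inverse2)
  also have "Suc (card (P - {a, b})) = card P - 1"
  proof -
    have "card {a, b} \<le> card P" using assms by (intro card_mono) auto
    then show ?thesis using assms by (subst card_Diff_subset) auto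
  qed
  finally show ?thesis using assms by (metis One_nat_def Suc_pred card_gt_0_iff empty_iff)
qed

context points
begin

text \<open>A down-set: if \<open>z\<close> is in \<open>I\<close> and \<open>ax\<close> crosses
  \<open>bz\<close>, then \<open>x\<close> is in \<open>I\<close>. No other pairs matter, as edges
  with a common end do not cross.\<close>

definition valid :: "real ^ 2 \<Rightarrow> real ^ 2 \<Rightarrow> (real ^ 2) set \<Rightarrow> bool" where
  "valid a b I \<longleftrightarrow> I \<subseteq> P - {a, b} \<and> (\<forall>x\<in>P - {a, b} - I. \<forall>z\<in>I. \<not> edges_cross {a, x} {b, z})"

lemma dstar_sst:
  assumes ab: "a \<in> P" "b \<in> P" "a \<noteq> b" and I: "I \<subseteq> P - {a, b}"
  shows "dstar P a b I \<in> simple_spanning_trees P \<longleftrightarrow> valid a b I"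
proof
  assume s: "dstar P a b I \<in> simple_spanning_trees P"
  have "\<not> edges_cross {a, x} {b, z}" if "x \<in> P - {a, b} - I" "z \<in> I" for x z
  proof (rule sst_noncross[OF s])
    show "{a, x} \<in> dstar P a b I" "{b, z} \<in> dstar P a b I" using that ab I unfolding dstar_edge[OF ab I] by auto
  qed
  then show "valid a b I" unfolding valid_def using I by blast
next
  assume v: "valid a b I"
  let ?D = "dstar P a b I"
  have ne: "P \<noteq> {}" using ab by blast
  have "conn ?D a b" by (rule conn_edge) (simp add: dstar_def)
  then have "conn ?D a x" if "x \<in> P" for x
  proof (cases "x \<in> I")
    case True
    then have "conn ?D b x" by (intro conn_edge) (simp add: dstar_def)
    with \<open>conn ?D a b\<close> show ?thesis by (rule conn_trans)
  next
    case False
    then show ?thesis using that by (cases "x = a") (auto intro!: conn_edge simp: dstar_edge[OF ab I])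
  qed
  then have "conn ?D x y" if "x \<in> P" "y \<in> P" for x y
    using that conn_trans[OF conn_sym] by metis
  moreover have "?D \<subseteq> complete_edges P"
    unfolding dstar_def using ab I by (auto simp: complete_edges_iff)
  moreover have "\<not> edges_cross e f" if ef: "e \<in> ?D" "f \<in> ?D" for e f
  proof
    assume x: "edges_cross e f"
    then have d: "e \<inter> f = {}" by (rule edges_cross_disjoint)
    have "a \<in> e \<or> (\<exists>z\<in>I. e = {b, z})" "a \<in> f \<or> (\<exists>z\<in>I. f = {b, z})"
      using ef unfolding dstar_def by auto
    then consider z where "a \<in> e" "z \<in> I" "f = {b, z}" | z where "a \<in> f" "z \<in> I" "e = {b, z}"
      using d by blast
    then show False
    proof cases
      case 1
      then obtain y where "e = {a, y}" "y \<in> P - {a, b} - I" using ef(1) d I ab unfolding dstar_def by auto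
      then show False using v x 1 unfolding valid_def by blast
    next
      case 2
      then obtain y where "f = {a, y}" "y \<in> P - {a, b} - I" using ef(2) d I ab unfolding dstar_def by auto
      then show False using v edges_cross_sym[OF x] 2 unfolding valid_def by blast
    qed
  qed
  ultimately show "?D \<in> simple_spanning_trees P"
    using card_dstar[OF finite_P ab I] unfolding sst_iff[OF ne] by blast
qed

text \<open>\<open>ax\<close> crosses \<open>by\<close> iff \<open>x\<close> and \<open>y\<close>
  lie on the same side of \<open>ab\<close> and \<open>x\<close> has the smaller angle at
  \<open>a\<close> and the larger one at \<open>b\<close>. On each side this is an intersection of
  two linear orders.\<close>

lemma order_trans:
  assumes "{a, b, x, y, z} \<subseteq> P" "edges_cross {a, x} {b, y}" "edges_cross {a, y} {b, z}"
  shows "edges_cross {a, x} {b, z}"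
proof -
  have 1: "distinct [a, x, b, y]" "cr a x b y" "distinct [a, y, b, z]" "cr a y b z"
    using assms edges_cross_cr'[of a x b y] edges_cross_cr'[of a y b z] by auto
  moreover have "x \<noteq> z" using cr_order_asym[of a b z y] 1 assms(1) by auto
  ultimately show ?thesis
    using cr_order_trans[of a b y x z] edges_cross_cr'[of a x b z] assms(1) by auto
qed

lemma order_asym:
  assumes "{a, b, x, y} \<subseteq> P" "edges_cross {a, x} {b, y}"
  shows "\<not> edges_cross {a, y} {b, x}"
  using assms cr_order_asym[of a b x y] edges_cross_cr'[of a x b y] edges_cross_cr'[of a y b x] by auto

lemma order_irrefl: "\<not> edges_cross {a, x} {b, x}"
  using edges_cross_disjoint[of "{a, x}" "{b, x}"] by auto

lemma order_maximal:
  assumes S: "S \<subseteq> P" "S \<noteq> {}" and ab: "a \<in> P" "b \<in> P"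
  obtains m where "m \<in> S" "\<And>w. w \<in> S \<Longrightarrow> \<not> edges_cross {a, m} {b, w}"
proof -
  let ?R = "\<lambda>x y. edges_cross {a, x} {b, y}"
  have "asymp_on S ?R" by (rule asymp_onI, rule order_asym) (use S ab in auto)
  moreover have "transp_on S ?R"
    by (rule transp_onI, rule order_trans) (use S ab in auto)
  moreover have "finite S" using S(1) finite_P finite_subset by blast
  ultimately obtain m where m: "m \<in> S" "\<forall>x\<in>S. x \<noteq> m \<longrightarrow> \<not> ?R m x"
    using Finite_Set.bex_max_element[of S ?R] S(2) by blast
  have "\<not> ?R m w" if "w \<in> S" for w
    using m(2) that order_irrefl by (cases "w = m") auto
  then show ?thesis using that m(1) by blast
qed

text \<open>Removing a maximal element keeps a down-set. Asking for one above a given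
  \<open>x\<close> lets the induction over ideals find a second removable element.\<close>

lemma valid_remove_above:
  assumes v: "valid a b I" and ab: "a \<in> P" "b \<in> P" and x: "x \<in> I"
  obtains z where "z \<in> I" "z = x \<or> edges_cross {a, x} {b, z}" "valid a b (I - {z})"
proof -
  have I: "I \<subseteq> P - {a, b}" using v unfolding valid_def by blast
  define S where "S = {w \<in> I. w = x \<or> edges_cross {a, x} {b, w}}"
  have S: "S \<subseteq> P" "S \<noteq> {}" using I x unfolding S_def by auto
  obtain m where m: "m \<in> S" "\<And>w. w \<in> S \<Longrightarrow> \<not> edges_cross {a, m} {b, w}"
    using order_maximal[OF S ab] by metis
  have mI: "m \<in> I" "m = x \<or> edges_cross {a, x} {b, m}" using m(1) unfolding S_def by auto
  have "\<not> edges_cross {a, m} {b, w}" if w: "w \<in> I" for w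
  proof
    assume c: "edges_cross {a, m} {b, w}"
    have "edges_cross {a, x} {b, w}"
      using mI(2) c order_trans[of a b x m w] ab x w mI(1) I by auto
    then show False using m(2)[of w] w c unfolding S_def by blast
  qed
  then have "valid a b (I - {m})"
    using v I unfolding valid_def by blast
  then show ?thesis using that mI by blast
qed

lemma valid_commute: "valid a b I \<Longrightarrow> valid b a (P - {a, b} - I)"
  unfolding valid_def using edges_cross_sym by blast

lemma dstar_remove_tadj:
  assumes ab: "a \<in> P" "b \<in> P" "a \<noteq> b" and v: "valid a b I" "valid a b (I - {z})" and z: "z \<in> I"
  shows "tadj P (dstar P a b I) (dstar P a b (I - {z}))"
proof -
  have I: "I \<subseteq> P - {a, b}" using v unfolding valid_def by blast
  then have I': "I - {z} \<subseteq> P - {a, b}" by blast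
  have "{b, z} \<in> dstar P a b I" "{a, z} \<notin> dstar P a b I"
    using z I ab unfolding dstar_edge[OF ab I] by auto
  then show ?thesis
    using tadj_swap dstar_sst[OF ab I] dstar_sst[OF ab I'] v dstar_remove[OF ab I z] by metis
qed

text \<open>The leaves at \<open>b\<close> are moved to \<open>a\<close> one at a time, each time a
  maximal one, so that every intermediate leaf set is an ideal.\<close>

lemma dstar_dist:
  assumes ab: "a \<in> P" "b \<in> P" "a \<noteq> b" and v: "valid a b I"
  shows "dist_le P (card I) (dstar P a b I) (star P a)"
  using v
proof (induction "card I" arbitrary: I)
  case 0
  then have "finite I" using finite_P unfolding valid_def by (meson finite_Diff finite_subset)
  then have "I = {}" using 0 by simp
  then show ?case using dstar_empty[OF ab(3,2)] by simp
next
  case (Suc k)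
  then obtain x where "x \<in> I" by (metis card.empty equals0I nat.distinct(1))
  then obtain z where z: "z \<in> I" "valid a b (I - {z})"
    using valid_remove_above[OF Suc.prems ab(1,2)] by metis
  have c: "k = card (I - {z})" using Suc.hyps(2) z(1) by simp
  have "dist_le P (Suc k) (dstar P a b I) (star P a)"
    using Suc.hyps(1)[OF c z(2)] dstar_remove_tadj[OF ab Suc.prems z(2,1)] c by auto
  then show ?case using Suc.hyps(2) by simp
qed

lemma dstar_dist':
  assumes ab: "a \<in> P" "b \<in> P" "a \<noteq> b" and v: "valid a b I"
  shows "dist_le P (card P - 2 - card I) (dstar P a b I) (star P b)"
proof -
  have I: "I \<subseteq> P - {a, b}" using v unfolding valid_def by blast
  have "card (P - {a, b} - I) = card P - 2 - card I"
    using I ab finite_P by (subst card_Diff_subset) (auto intro: finite_subset simp: card_Diff_subset)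
  then show ?thesis
    using dstar_dist[OF ab(2,1) _ valid_commute[OF v]] ab(3) dstar_commute[OF I] by metis
qed

text \<open>An exchange inserts a single edge, so each step gains at most one edge of
  \<open>U\<close>.\<close>

lemma dist_le_card:
  assumes "dist_le P k T U" "U \<in> simple_spanning_trees P"
  shows "card (U - T) \<le> k"
  using assms
proof (induction k arbitrary: T)
  case (Suc k)
  then obtain V where V: "tadj P T V" "dist_le P k V U" by auto
  obtain e g where eg: "V = swap T e g" using tadjE[OF V(1)] by metis
  have "finite U" using sst_finite Suc.prems(2) .
  then have "card (U - T) \<le> card (insert g (U - V))"
    by (intro card_mono) (auto simp: eg swap_def)
  also have "\<dots> \<le> Suc (card (U - V))" by (rule card_insert_le_m1) auto
  finally show ?case using Suc.IH[OF V(2) Suc.prems(2)] by simp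
qed simp

text \<open>The two stars share only the edge \<open>ab\<close>, so the degree bounds leave room for
  no further edge: all inequalities are equalities, \<open>ab\<close> is present, and every other
  point hangs on \<open>a\<close> or \<open>b\<close>.\<close>

lemma dstar_of_degrees:
  assumes R: "R \<in> simple_spanning_trees P" and ab: "a \<in> P" "b \<in> P" "a \<noteq> b" and i: "i \<le> card P - 2"
    and da: "card (star P a - R) \<le> i" and db: "card (star P b - R) \<le> card P - 2 - i"
  obtains J where "J \<subseteq> P - {a, b}" "card J = i" "R = dstar P a b J"
proof -
  let ?A = "star P a \<inter> R" and ?B = "star P b \<inter> R"
  have fR: "finite R" using sst_finite[OF R] .
  have fs: "finite (star P a)" "finite (star P b)" unfolding star_def using finite_P by auto
  have c2: "card {a, b} \<le> card P" using ab finite_P by (intro card_mono) auto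
  then have n: "2 \<le> card P" using ab(3) by simp
  have "card (star P a) = card ?A + card (star P a - R)" "card (star P b) = card ?B + card (star P b - R)"
    using card_Int_Diff fs by metis+
  then have A: "card P \<le> card ?A + i + 1" and B: "i + 1 \<le> card ?B"
    using card_star[OF finite_P ab(1)] card_star[OF finite_P ab(2)] da db i n by linarith+
  have AB: "?A \<inter> ?B \<subseteq> {{a, b}}"
    using ab unfolding star_def by (auto simp: doubleton_eq_iff)
  have U: "card (?A \<union> ?B) + card (?A \<inter> ?B) = card ?A + card ?B"
    using card_Un_Int[of ?A ?B] fR by simp
  have le: "card (?A \<union> ?B) \<le> card R" by (rule card_mono) (use fR in auto)
  have le1: "card (?A \<inter> ?B) \<le> 1" using card_mono[OF _ AB] by simp
  have R1: "card P = Suc (card R)" using sst_card[OF R] .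
  have eq: "card (?A \<union> ?B) = card R" "card (?A \<inter> ?B) = 1" "card ?B = i + 1"
    using A B U le le1 R1 by linarith+
  have RAB: "R = ?A \<union> ?B"
    using card_subset_eq[OF fR, of "?A \<union> ?B"] eq(1) by blast
  have abR: "{a, b} \<in> R"
  proof -
    have "?A \<inter> ?B \<noteq> {}" using eq(2) by auto
    then show ?thesis using AB by blast
  qed
  define J where "J = {x \<in> P - {a, b}. {b, x} \<in> R}"
  have J: "J \<subseteq> P - {a, b}" unfolding J_def by blast
  have aJ: "{a, x} \<in> R" if x: "x \<in> P - {a, b} - J" for x
  proof -
    obtain y where y: "{x, y} \<in> R" using sst_incident[OF R, of x a] x ab by auto
    then have "{x, y} \<in> star P a \<or> {x, y} \<in> star P b" using RAB by blast
    then have "y = a \<or> y = b" using x ab by (auto simp: star_edge)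
    then show ?thesis using y x unfolding J_def by (auto simp: insert_commute)
  qed
  have sub: "dstar P a b J \<subseteq> R"
    unfolding dstar_def using abR aJ by (auto simp: J_def)
  have "R = dstar P a b J"
    using card_subset_eq[OF fR sub] card_dstar[OF finite_P ab J] R1 by simp
  moreover have "card J = i"
  proof -
    have "?B = insert {a, b} ((\<lambda>x. {b, x}) ` J)"
    proof
      show "?B \<subseteq> insert {a, b} ((\<lambda>x. {b, x}) ` J)"
        unfolding star_def J_def using ab by (auto simp: insert_commute)
      show "insert {a, b} ((\<lambda>x. {b, x}) ` J) \<subseteq> ?B"
        unfolding J_def star_def using abR ab by (auto simp: insert_commute)
    qed
    moreover have "{a, b} \<notin> (\<lambda>x. {b, x}) ` J" using J by (auto simp: doubleton_eq_iff)
    moreover have "finite J" using J finite_P by (meson finite_Diff finite_subset)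
    moreover have "card ((\<lambda>x. {b, x}) ` J) = card J"
      by (rule card_image) (auto simp: inj_on_def doubleton_eq_iff)
    ultimately show ?thesis using eq(3) by simp
  qed
  ultimately show ?thesis using that J by blast
qed

text \<open>If \<open>aw\<close> crosses \<open>xy\<close>, then \<open>w\<close> lies in the cone
  at \<open>a\<close> over \<open>xy\<close> and replaces \<open>x\<close> or \<open>y\<close>,
  according to its side of the partition; this shrinks the cone. The pairs that result are the later
  links at \<open>a\<close>, whose graph is thus connected.\<close>

lemma link_connected:
  assumes a: "a \<in> P" and K: "K \<subseteq> P - {a}" "K \<noteq> {}" "K \<noteq> P - {a}"
  obtains x y where "x \<in> K" "y \<in> P - {a} - K" "\<And>w. w \<in> P \<Longrightarrow> \<not> edges_cross {a, w} {x, y}"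
proof -
  have "\<exists>x\<in>K. \<exists>y\<in>P - {a} - K. \<forall>w\<in>P. \<not> edges_cross {a, w} {x, y}"
    if "x \<in> K" "y \<in> P - {a} - K" for x y
    using that
  proof (induction "card {w \<in> P. in_cone a x y w}" arbitrary: x y rule: less_induct)
    case less
    show ?case
    proof (cases "\<forall>w\<in>P. \<not> edges_cross {a, w} {x, y}")
      case False
      then obtain w where w: "w \<in> P" "edges_cross {a, w} {x, y}" by blast
      have xy: "x \<in> P" "y \<in> P" "x \<noteq> y" "x \<noteq> a" "y \<noteq> a" using less.prems K(1) by auto
      have "edges_cross {x, y} {a, w}" using w(2) by (rule edges_cross_sym)
      then have d: "distinct [x, y, a, w]" "cr x y a w"
        using edges_cross_cr'[of x y a w] a w(1) xy by auto
      then have c: "in_cone a x y w" using cr_cone[of x y a w] a w(1) xy by auto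
      have smaller: "card {v \<in> P. in_cone a x' y' v} < card {v \<in> P. in_cone a x y v}"
        if "\<And>v. v \<in> P \<Longrightarrow> in_cone a x' y' v \<Longrightarrow> in_cone a x y v" "\<not> in_cone a x' y' w" for x' y'
        by (rule psubset_card_mono) (use that c w(1) finite_P in auto)
      show ?thesis
      proof (cases "w \<in> K")
        case True
        have "card {v \<in> P. in_cone a w y v} < card {v \<in> P. in_cone a x y v}"
        proof (rule smaller)
          fix v assume v: "v \<in> P" "in_cone a w y v"
          have "in_cone a y x w" using cone_commute[of a x y w] c a w(1) xy by auto
          moreover have "in_cone a y w v" using cone_commute[of a w y v] v d a w(1) xy by auto
          ultimately have "in_cone a y x v" using cone_trans[of a y x w v] v(1) a w(1) xy by auto
          then show "in_cone a x y v" using cone_commute[of a y x v] v(1) a xy by auto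
        qed (simp add: in_cone_def)
        then show ?thesis using less.hyps[of w y] True less.prems(2) by blast
      next
        case False
        have "card {v \<in> P. in_cone a x w v} < card {v \<in> P. in_cone a x y v}"
        proof (rule smaller)
          fix v assume v: "v \<in> P" "in_cone a x w v"
          then show "in_cone a x y v" using cone_trans[of a x y w v] c a w(1) xy by auto
        qed (simp add: in_cone_def)
        moreover have "w \<in> P - {a} - K" using False w(1) d by auto
        ultimately show ?thesis using less.hyps[of x w] less.prems(1) by blast
      qed
    qed (use less.prems in blast)
  qed
  moreover obtain x y where "x \<in> K" "y \<in> P - {a} - K" using K by blast
  ultimately show ?thesis using that by blast
qed

section \<open>Walks to the star of a third point\<close>

definition bistar :: "real ^ 2 \<Rightarrow> real ^ 2 \<Rightarrow> real ^ 2 \<Rightarrow> (real ^ 2) set \<Rightarrow> (real ^ 2) set \<Rightarrow> (real ^ 2) set set" where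
  "bistar a b x B C = insert {a, x} (insert {b, x} ((\<lambda>z. {a, z}) ` (P - {a, b, x} - B - C) \<union>
     (\<lambda>z. {b, z}) ` B \<union> (\<lambda>z. {x, z}) ` C))"

text \<open>The points of \<open>B\<close> move from \<open>b\<close> to \<open>x\<close>; once
  \<open>B\<close> is empty, the tree is a double star at \<open>a\<close> and \<open>x\<close> with
  the leaves \<open>insert b C\<close> at \<open>x\<close>. Each step gives \<open>x\<close> one
  more edge, and for empty \<open>C\<close> it starts with \<open>ax\<close> and \<open>bx\<close>,
  so that \<open>card P - 1 - 2\<close> edges are missing.\<close>

lemma bistar_dist:
  assumes abx: "a \<in> P" "b \<in> P" "x \<in> P" "distinct [a, b, x]"
    and "B \<subseteq> P - {a, b, x}" "C \<subseteq> P - {a, b, x}" "B \<inter> C = {}"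
    and "bistar a b x B C \<in> simple_spanning_trees P"
    and "\<And>z. z \<in> B \<Longrightarrow> edges_cross {a, z} {b, x}"
  shows "dist_le P (card P - 3 - card C) (bistar a b x B C) (star P x)"
  using assms(5-)
proof (induction "card B" arbitrary: B C)
  case 0
  then have "finite B" using finite_P by (meson finite_Diff finite_subset)
  then have B: "B = {}" using 0 by simp
  have bC: "b \<notin> C" "finite C" using 0(3) finite_P by (auto intro: finite_subset)
  have sub: "insert b C \<subseteq> P - {a, x}" using 0(3) abx by auto
  have "P - {a, b, x} - C = P - {a, x} - insert b C" by blast
  then have eq: "bistar a b x B C = dstar P a x (insert b C)"
    unfolding bistar_def dstar_def B by (simp add: insert_commute)
  have ax: "a \<noteq> x" using abx(4) by simp
  have "valid a x (insert b C)"
    using dstar_sst[OF abx(1,3) ax sub] 0(5) eq by simp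
  from dstar_dist'[OF abx(1,3) ax this] show ?case
    unfolding eq using bC by (simp add: numeral_3_eq_3 numeral_2_eq_2)
next
  case (Suc k)
  let ?T = "bistar a b x B C"
  note T = Suc.prems(4)
  have "B \<noteq> {}" using Suc.hyps(2) by auto
  have BP: "B \<subseteq> P" using Suc.prems(1) by blast
  \<comment> \<open>With this choice the new edge \<open>xz\<close> crosses none of the remaining
    edges at \<open>b\<close>; the edges at \<open>a\<close> are handled by
    \<open>cr_principal\<close>.\<close>
  obtain z where z: "z \<in> B" "\<And>w. w \<in> B \<Longrightarrow> \<not> edges_cross {x, z} {b, w}"
    using order_maximal[OF BP \<open>B \<noteq> {}\<close> abx(3,2)] by metis
  have zP: "z \<in> P" "z \<notin> {a, b, x}" "z \<notin> C" using z(1) Suc.prems(1,3) by auto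
  have bz: "{b, z} \<in> ?T" unfolding bistar_def using z(1) by simp
  have xz: "{x, z} \<notin> ?T"
    unfolding bistar_def using zP abx(4) Suc.prems(1) by (auto simp: doubleton_eq_iff)
  have eq: "bistar a b x (B - {z}) (insert z C) = swap ?T {b, z} {x, z}"
  proof -
    have 1: "P - {a, b, x} - (B - {z}) - insert z C = P - {a, b, x} - B - C" using z(1) by blast
    have 2: "(\<lambda>w. {b, w}) ` (B - {z}) = (\<lambda>w. {b, w}) ` B - {{b, z}}"
      by (auto simp: doubleton_eq_iff)
    have 3: "{b, z} \<noteq> {a, x}" "{b, z} \<noteq> {b, x}"
      "{b, z} \<notin> (\<lambda>z. {a, z}) ` (P - {a, b, x} - B - C)" "{b, z} \<notin> (\<lambda>z. {x, z}) ` C"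
      using zP abx(4) by (auto simp: doubleton_eq_iff)
    have exchange: "insert e1 (insert e2 (X \<union> (Y - {h}) \<union> insert g Z)) =
        insert g (insert e1 (insert e2 (X \<union> Y \<union> Z)) - {h})"
      if "h \<noteq> e1" "h \<noteq> e2" "h \<notin> X" "h \<notin> Z" for e1 e2 g h :: "(real ^ 2) set" and X Y Z
      using that by blast
    show ?thesis unfolding bistar_def swap_def 1 2 image_insert by (rule exchange[OF 3])
  qed
  have "swap ?T {b, z} {x, z} \<in> simple_spanning_trees P"
  proof (rule sst_swap[OF T bz _ xz])
    show "{x, z} \<in> complete_edges P" using zP abx(3) by (auto simp: complete_edges_iff)
    have "{b, x} \<in> swap ?T {b, z} {x, z}"
      using zP unfolding bistar_def swap_def by (auto simp: doubleton_eq_iff)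
    moreover have "{x, z} \<in> swap ?T {b, z} {x, z}" unfolding swap_def by simp
    ultimately show "conn (swap ?T {b, z} {x, z}) b z"
      by (rule conn_trans[OF conn_edge conn_edge])
    show "clear (?T - {{b, z}}) {x, z}"
      unfolding clear_def
    proof
      fix e assume e: "e \<in> ?T - {{b, z}}"
      show "\<not> edges_cross {x, z} e"
      proof
        assume c: "edges_cross {x, z} e"
        have "x \<notin> e" using edges_cross_disjoint[OF c] by blast
        moreover from e have "e = {a, x} \<or> e = {b, x} \<or> e \<in> (\<lambda>z. {a, z}) ` (P - {a, b, x} - B - C) \<or>
            e \<in> (\<lambda>z. {b, z}) ` B \<or> e \<in> (\<lambda>z. {x, z}) ` C"
          unfolding bistar_def by blast
        ultimately consider w where "w \<in> B" "e = {b, w}"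
          | y where "y \<in> P - {a, b, x} - B - C" "e = {a, y}"
          by (elim disjE imageE) auto
        then show False
        proof cases
          case 1
          then show False using z(2) c by blast
        next
          case 2
          have ay: "{a, y} \<in> ?T" "{b, x} \<in> ?T" unfolding bistar_def using 2(1) by auto
          have "y \<noteq> z" using 2(1) z(1) by blast
          moreover have "\<not> cr a y b x" "\<not> cr a y b z"
            using sst_noncross[OF T ay] sst_noncross[OF T ay(1) bz] 2(1) zP abx z(1)
              edges_cross_cr'[of a y b x] edges_cross_cr'[of a y b z] by auto
          moreover have "cr a z b x"
            using Suc.prems(5)[OF z(1)] edges_cross_cr'[of a z b x] zP abx by auto
          ultimately have "\<not> cr a y x z" using cr_principal[of a b x z y] 2(1) zP abx by auto
          then show False
            using edges_cross_sym[OF c] edges_cross_cr'[of a y x z] 2 zP abx by auto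
        qed
      qed
    qed
  qed
  then have s: "bistar a b x (B - {z}) (insert z C) \<in> simple_spanning_trees P" unfolding eq .
  have fin: "finite B" "finite C" using Suc.prems(1,2) finite_P by (auto intro: finite_subset)
  have k: "k = card (B - {z})" using Suc.hyps(2) z(1) fin by simp
  have "dist_le P (card P - 3 - card (insert z C)) (bistar a b x (B - {z}) (insert z C)) (star P x)"
  proof (rule Suc.hyps(1)[OF k _ _ _ s])
    show "B - {z} \<subseteq> P - {a, b, x}" "insert z C \<subseteq> P - {a, b, x}" "(B - {z}) \<inter> insert z C = {}"
      using Suc.prems(1-3) z(1) by auto
  qed (use Suc.prems(5) in blast)
  moreover have "tadj P ?T (bistar a b x (B - {z}) (insert z C))"
    using tadj_swap[OF T bz xz] s unfolding eq by blast
  moreover have "card P - 3 - card C = Suc (card P - 3 - card (insert z C))"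
  proof -
    have "card (insert z C) \<le> card (P - {a, b, x})"
      using Suc.prems(1,2) z(1) finite_P by (intro card_mono) auto
    moreover have "card (P - {a, b, x}) = card P - 3"
      using abx finite_P by (subst card_Diff_subset) auto
    ultimately show ?thesis using zP(3) fin by simp
  qed
  ultimately show ?case by auto
qed

end

subsection \<open>Isomorphisms of tree graphs\<close>

definition half :: "'a set \<Rightarrow> 'a \<Rightarrow> 'a \<Rightarrow> 'a \<Rightarrow> 'a set set" where
  "half P a x b = swap (star P a) {a, x} {x, b}"

lemma swap_swap: "e \<in> T \<Longrightarrow> g \<notin> T \<Longrightarrow> swap (swap T e g) g e = T"
  unfolding swap_def by auto

lemma dstar_insert:
  assumes "a \<in> P" "b \<in> P" "a \<noteq> b" "I \<subseteq> P - {a, b}" "x \<in> P - {a, b} - I"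
  shows "dstar P a b (insert x I) = swap (dstar P a b I) {a, x} {b, x}"
proof -
  have I: "insert x I \<subseteq> P - {a, b}" using assms by blast
  have "dstar P a b I = swap (dstar P a b (insert x I)) {b, x} {a, x}"
    using dstar_remove[OF assms(1-3) I, of x] assms(5) by simp
  moreover have "{b, x} \<in> dstar P a b (insert x I)" "{a, x} \<notin> dstar P a b (insert x I)"
    using assms(3,5) unfolding dstar_edge[OF assms(1-3) I] by auto
  ultimately show ?thesis using swap_swap by metis
qed

lemma half_dstar:
  assumes "{a, b, x} \<subseteq> P" "distinct [a, b, x]"
  shows "half P a x b = dstar P a b {x}"
proof -
  have "dstar P a b {x} = swap (dstar P a b {}) {a, x} {b, x}"
    by (rule dstar_insert) (use assms in auto)
  also have "dstar P a b {} = star P a" by (rule dstar_empty) (use assms in auto)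
  finally show ?thesis unfolding half_def by (simp add: insert_commute)
qed

context points
begin

text \<open>For distinct points of \<open>P\<close>, exactly the pairs for which
  \<open>half P a x b\<close> is a tree. The condition is symmetric in \<open>x\<close> and
  \<open>b\<close>, so each link yields two neighbours of the star of \<open>a\<close>, one for each
  orientation.\<close>

definition link :: "real ^ 2 \<Rightarrow> real ^ 2 \<Rightarrow> real ^ 2 \<Rightarrow> bool" where
  "link a x b \<longleftrightarrow> {a, b, x} \<subseteq> P \<and> distinct [a, b, x] \<and> (\<forall>w\<in>P. \<not> edges_cross {a, w} {x, b})"

lemma link_commute: "link a x b \<Longrightarrow> link a b x"
  unfolding link_def by (auto simp: insert_commute)

lemma link_valid:
  assumes "{a, b, x} \<subseteq> P" "distinct [a, b, x]"
  shows "link a x b \<longleftrightarrow> valid a b {x}"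
proof -
  have 1: "\<not> edges_cross {a, w} {x, b}" if "w = a \<or> w = b \<or> w = x" for w
    using edges_cross_disjoint[of "{a, w}" "{x, b}"] edges_cross_iff[of a w x b] that by auto
  have 2: "{b, x} = {x, b}" by blast
  have 3: "P - {a, b} - {x} = P - {a, b, x}" by blast
  have "(\<forall>w\<in>P. \<not> edges_cross {a, w} {x, b}) \<longleftrightarrow> (\<forall>w\<in>P - {a, b, x}. \<not> edges_cross {a, w} {x, b})"
    using 1 by blast
  moreover have "{x} \<subseteq> P - {a, b}" using assms by auto
  ultimately show ?thesis unfolding link_def valid_def 3 using assms by (simp add: 2)
qed

lemma link_half:
  assumes "{a, b, x} \<subseteq> P" "distinct [a, b, x]"
  shows "half P a x b \<in> simple_spanning_trees P \<longleftrightarrow> link a x b"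
proof -
  have "{x} \<subseteq> P - {a, b}" using assms by auto
  then show ?thesis
    using assms dstar_sst[of a b "{x}"] link_valid[OF assms] half_dstar[OF assms] by simp
qed

text \<open>The deleted edge records the tail \<open>x\<close>, the inserted edge the link without
  its orientation, and exactly one of them must agree. So the oriented links are adjacent iff they
  have a common tail or are reversals of each other.\<close>

lemma half_tadj:
  assumes x: "link a x b" and y: "link a y c"
  shows "tadj P (half P a x b) (half P a y c) \<longleftrightarrow> (x = y \<and> b \<noteq> c \<or> x \<noteq> y \<and> x = c \<and> b = y)"
proof -
  have P: "{a, b, x} \<subseteq> P" "distinct [a, b, x]" "{a, c, y} \<subseteq> P" "distinct [a, c, y]"
    using x y unfolding link_def by auto
  have "half P a x b \<in> simple_spanning_trees P" "half P a y c \<in> simple_spanning_trees P"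
    using link_half[OF P(1,2)] link_half[OF P(3,4)] x y by auto
  moreover have "{a, x} \<in> star P a" "{x, b} \<notin> star P a" "{a, y} \<in> star P a" "{y, c} \<notin> star P a"
    using P by (auto simp: star_edge)
  ultimately have "tadj P (half P a x b) (half P a y c) \<longleftrightarrow> ({a, x} = {a, y} \<longleftrightarrow> {x, b} \<noteq> {y, c})"
    using tadj_swap_swap[of "{a, x}" "star P a" "{x, b}" "{a, y}" "{y, c}"] unfolding half_def by meson
  moreover have "{a, x} = {a, y} \<longleftrightarrow> x = y" "{x, b} = {y, c} \<longleftrightarrow> x = y \<and> b = c \<or> x = c \<and> b = y"
    by (auto simp: doubleton_eq_iff)
  moreover have "x \<noteq> b" using P(2) by auto
  ultimately show ?thesis by metis
qed

text \<open>A point lost from \<open>I\<close> would contribute two edges to the symmetric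
  difference, and a point gained a third one.\<close>

lemma dstar_tadj_insert:
  assumes ab: "a \<in> P" "b \<in> P" "a \<noteq> b" and I: "I \<subseteq> P - {a, b}" and J: "J \<subseteq> P - {a, b}"
    and adj: "tadj P (dstar P a b I) (dstar P a b J)" and c: "card J = Suc (card I)"
  obtains u where "u \<in> P - {a, b} - I" "J = insert u I"
proof -
  have fin: "finite I" "finite J" using I J finite_P by (meson finite_Diff finite_subset)+
  have IJ: "I \<subseteq> J"
  proof (rule ccontr)
    assume "\<not> I \<subseteq> J"
    then obtain x where x: "x \<in> I" "x \<notin> J" by blast
    have "\<not> J \<subseteq> I" using card_mono[OF fin(1), of J] c by auto
    then obtain y where y: "y \<in> J" "y \<notin> I" by blast
    let ?D = "sym_diff (dstar P a b I) (dstar P a b J)"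
    have "{{b, x}, {a, x}, {b, y}} \<subseteq> ?D"
      using x y I J ab(3) by (auto simp: dstar_edge[OF ab I] dstar_edge[OF ab J])
    moreover have "finite ?D" unfolding dstar_def using finite_P fin by auto
    ultimately have "card {{b, x}, {a, x}, {b, y}} \<le> card ?D" by (intro card_mono)
    moreover have "card {{b, x}, {a, x}, {b, y}} = 3"
      using x y I J ab(3) by (auto simp: doubleton_eq_iff card_insert_if)
    ultimately show False using adj unfolding tadj_def by simp
  qed
  have "card (J - I) = 1" using c card_Diff_subset[OF fin(1) IJ] by simp
  then obtain u where "J - I = {u}" by (rule card_1_singletonE)
  then show ?thesis using that IJ J by blast
qed

end

text \<open>The map \<open>s\<close> is tied to \<open>f\<close> only through the stars. The
  assumptions are symmetric, so the inverse is again an instance and many facts are needed in one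
  direction only.\<close>

locale tree_graph_iso = A: points P + B: points P'
  for P P' :: "(real ^ 2) set" +
  fixes f :: "(real ^ 2) set set \<Rightarrow> (real ^ 2) set set" and s :: "real ^ 2 \<Rightarrow> real ^ 2"
  assumes bij_f: "bij_betw f (simple_spanning_trees P) (simple_spanning_trees P')"
    and adj_f: "T \<in> simple_spanning_trees P \<Longrightarrow> U \<in> simple_spanning_trees P \<Longrightarrow>
      tadj P' (f T) (f U) \<longleftrightarrow> tadj P T U"
    and bij_s: "bij_betw s P P'"
    and f_star: "a \<in> P \<Longrightarrow> f (star P a) = star P' (s a)"
begin

lemma inverse: "tree_graph_iso P' P (inv_into (simple_spanning_trees P) f) (inv_into P s)"
proof
  let ?f = "inv_into (simple_spanning_trees P) f" and ?s = "inv_into P s"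
  show "bij_betw ?f (simple_spanning_trees P') (simple_spanning_trees P)"
    by (rule bij_betw_inv_into[OF bij_f])
  show "bij_betw ?s P' P" by (rule bij_betw_inv_into[OF bij_s])
  fix T U assume TU: "T \<in> simple_spanning_trees P'" "U \<in> simple_spanning_trees P'"
  then have "?f T \<in> simple_spanning_trees P" "?f U \<in> simple_spanning_trees P"
    "f (?f T) = T" "f (?f U) = U"
    using bij_f by (auto simp: bij_betw_def inv_into_into f_inv_into_f)
  then show "tadj P (?f T) (?f U) \<longleftrightarrow> tadj P' T U" using adj_f by metis
next
  fix a assume a: "a \<in> P'"
  then have b: "inv_into P s a \<in> P" "s (inv_into P s a) = a"
    using bij_s by (auto simp: bij_betw_def inv_into_into f_inv_into_f)
  have "f (star P (inv_into P s a)) = star P' a" using f_star[OF b(1)] b(2) by simp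
  then show "inv_into (simple_spanning_trees P) f (star P' a) = star P (inv_into P s a)"
    using bij_f A.star_sst[OF b(1)] by (metis bij_betw_def inv_into_f_f)
qed

lemma f_sst: "T \<in> simple_spanning_trees P \<Longrightarrow> f T \<in> simple_spanning_trees P'"
  using bij_f by (auto simp: bij_betw_def)

lemma f_tadj: "tadj P T U \<Longrightarrow> tadj P' (f T) (f U)"
  using adj_f[of T U] unfolding tadj_def by blast

lemma s_in: "a \<in> P \<Longrightarrow> s a \<in> P'"
  using bij_s by (auto simp: bij_betw_def)

lemma s_eq: "a \<in> P \<Longrightarrow> b \<in> P \<Longrightarrow> s a = s b \<longleftrightarrow> a = b"
  using bij_s by (auto simp: bij_betw_def inj_on_def)

lemma s_surj: "a' \<in> P' \<Longrightarrow> \<exists>a\<in>P. a' = s a"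
  using bij_s by (auto simp: bij_betw_def)

lemma card_eq: "card P = card P'"
  using bij_s by (rule bij_betw_same_card)

lemma f_dist: "dist_le P k T U \<Longrightarrow> dist_le P' k (f T) (f U)"
  by (induction k arbitrary: T) (auto intro: f_tadj)

lemma f_star_degree:
  assumes "dist_le P k T (star P a)" "a \<in> P"
  shows "card (star P' (s a) - f T) \<le> k"
  using B.dist_le_card[OF f_dist[OF assms(1)]] f_star[OF assms(2)] B.star_sst[OF s_in[OF assms(2)]] by simp

text \<open>The walks to both stars are carried over by \<open>f\<close> and bound both central
  degrees of the image. The leaf set \<open>J\<close> is known only by its size.\<close>

lemma f_dstar:
  assumes ab: "a \<in> P" "b \<in> P" "a \<noteq> b" and v: "A.valid a b I"
  obtains J where "J \<subseteq> P' - {s a, s b}" "card J = card I" "f (dstar P a b I) = dstar P' (s a) (s b) J"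
proof -
  have I: "I \<subseteq> P - {a, b}" using v unfolding A.valid_def by blast
  have "card I \<le> card (P - {a, b})" using I A.finite_P by (intro card_mono) auto
  also have "\<dots> = card P - 2" using ab A.finite_P by (subst card_Diff_subset) auto
  finally have i: "card I \<le> card P' - 2" using card_eq by simp
  show ?thesis
  proof (rule B.dstar_of_degrees[of "f (dstar P a b I)" "s a" "s b" "card I"])
    show "f (dstar P a b I) \<in> simple_spanning_trees P'" using f_sst A.dstar_sst[OF ab I] v by blast
    show "card (star P' (s a) - f (dstar P a b I)) \<le> card I"
      by (rule f_star_degree[OF A.dstar_dist[OF ab v] ab(1)])
    show "card (star P' (s b) - f (dstar P a b I)) \<le> card P' - 2 - card I"
      using f_star_degree[OF A.dstar_dist'[OF ab v] ab(2)] card_eq by simp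
  qed (use s_in s_eq ab i that in auto)
qed

lemma f_half:
  assumes l: "A.link a x b"
  obtains u where "u \<in> P" "u \<noteq> a" "u \<noteq> b" "f (half P a x b) = half P' (s a) (s u) (s b)"
    "B.link (s a) (s u) (s b)"
proof -
  have P: "{a, b, x} \<subseteq> P" "distinct [a, b, x]" using l unfolding A.link_def by auto
  then have ab: "a \<in> P" "b \<in> P" "a \<noteq> b" by auto
  obtain J where J: "J \<subseteq> P' - {s a, s b}" "card J = card {x}"
    "f (dstar P a b {x}) = dstar P' (s a) (s b) J"
    using f_dstar[OF ab] A.link_valid[OF P] l by blast
  have "card J = 1" using J(2) by simp
  then obtain u' where u': "J = {u'}" by (rule card_1_singletonE)
  then obtain u where u: "u \<in> P" "u' = s u" using J(1) s_surj by blast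
  then have n: "u \<noteq> a" "u \<noteq> b" "{s a, s b, s u} \<subseteq> P'" "distinct [s a, s b, s u]"
    using J(1) u' ab s_in s_eq by auto
  have eq: "f (half P a x b) = half P' (s a) (s u) (s b)"
    using J(3) half_dstar[OF P] half_dstar[OF n(3,4)] u' u(2) by simp
  have "half P a x b \<in> simple_spanning_trees P" using A.link_half[OF P] l by blast
  then have "B.link (s a) (s u) (s b)" using f_sst eq B.link_half[OF n(3,4)] by metis
  then show ?thesis using that u(1) n(1,2) eq by blast
qed

text \<open>Adjacency of oriented links, translated through \<open>f\<close>: the heads
  \<open>b\<close> and \<open>c\<close> are kept, while the image tails \<open>u\<close> and
  \<open>w\<close> are the unknowns.\<close>

lemma f_half_tadj:
  assumes x: "A.link a x b" "u \<in> P" "f (half P a x b) = half P' (s a) (s u) (s b)" "B.link (s a) (s u) (s b)"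
    and y: "A.link a y c" "w \<in> P" "f (half P a y c) = half P' (s a) (s w) (s c)" "B.link (s a) (s w) (s c)"
  shows "(x = y \<and> b \<noteq> c \<or> x \<noteq> y \<and> x = c \<and> b = y) \<longleftrightarrow> (u = w \<and> b \<noteq> c \<or> u \<noteq> w \<and> u = c \<and> b = w)"
proof -
  have P: "{a, b, x} \<subseteq> P" "distinct [a, b, x]" "{a, c, y} \<subseteq> P" "distinct [a, c, y]"
    using x y unfolding A.link_def by auto
  have "half P a x b \<in> simple_spanning_trees P" "half P a y c \<in> simple_spanning_trees P"
    using A.link_half[OF P(1,2)] A.link_half[OF P(3,4)] x y by auto
  then have "tadj P (half P a x b) (half P a y c) \<longleftrightarrow>
      tadj P' (half P' (s a) (s u) (s b)) (half P' (s a) (s w) (s c))"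
    using adj_f x(3) y(3) by metis
  then show ?thesis
    unfolding A.half_tadj[OF x(1) y(1)] B.half_tadj[OF x(4) y(4)] using s_eq P x(2) y(2) by auto
qed

text \<open>An isomorphism can permute the trees next to a star without respecting the points, as it happens
  for four points in non-convex position; this forces a triangle component of the graph of links.\<close>

lemma f_half_swapped:
  assumes l: "A.link a x b" and u: "u \<in> P" "u \<noteq> a" "u \<noteq> b"
    and fx: "f (half P a x b) = half P' (s a) (s u) (s b)" and ux: "u \<noteq> x"
  shows "A.link a u b" "f (half P a u b) = half P' (s a) (s x) (s b)" "B.link (s a) (s x) (s b)"
    "\<And>y. A.link a b y \<Longrightarrow> y = x \<or> y = u" "\<And>y. A.link a x y \<Longrightarrow> y = b \<or> y = u"
proof -
  have P: "{a, b, x} \<subseteq> P" "distinct [a, b, x]" using l unfolding A.link_def by auto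
  have "half P a x b \<in> simple_spanning_trees P" using A.link_half[OF P] l by blast
  then have "half P' (s a) (s u) (s b) \<in> simple_spanning_trees P'" using f_sst fx by metis
  moreover have "{s a, s b, s u} \<subseteq> P'" "distinct [s a, s b, s u]" using P u s_in s_eq by auto
  ultimately have lx': "B.link (s a) (s u) (s b)" using B.link_half by blast
  note lb = A.link_commute[OF l]
  obtain w where w: "w \<in> P" "w \<noteq> a" "w \<noteq> x" "f (half P a b x) = half P' (s a) (s w) (s x)"
    "B.link (s a) (s w) (s x)"
    using f_half[OF lb] by metis
  \<comment> \<open>The links from \<open>x\<close> to \<open>b\<close> and back are adjacent. As
    \<open>u\<close> differs from \<open>x\<close>, their images cannot be reversals of each other
    and have a common tail.\<close>
  have "w = u" using f_half_tadj[OF l u(1) fx lx' lb w(1,4,5)] P ux by auto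
  note fb = w(4,5)[unfolded this]
  note lux' = B.link_commute[OF fb(2)]
  interpret I: tree_graph_iso P' P "inv_into (simple_spanning_trees P) f" "inv_into P s"
    by (rule inverse)
  have inv_s: "inv_into P s (s v) = v" if "v \<in> P" for v
    using bij_s that by (simp add: bij_betw_def)
  obtain y' where y': "y' \<in> P'" "y' \<noteq> s a" "y' \<noteq> s u"
    "inv_into (simple_spanning_trees P) f (half P' (s a) (s x) (s u)) =
       half P (inv_into P s (s a)) (inv_into P s y') (inv_into P s (s u))"
    "A.link (inv_into P s (s a)) (inv_into P s y') (inv_into P s (s u))"
    using I.f_half[OF lux'] by metis
  define y where "y = inv_into P s y'"
  have y: "y \<in> P" using I.s_in[OF y'(1)] unfolding y_def .
  have ly: "A.link a y u" using y'(5) inv_s P u(1) unfolding y_def by auto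
  have lux'S: "half P' (s a) (s x) (s u) \<in> simple_spanning_trees P'"
    using lux' B.link_half[of "s a" "s u" "s x"] unfolding B.link_def by blast
  have fy: "f (half P a y u) = half P' (s a) (s x) (s u)"
    using y'(4) inv_s P u(1) bij_f lux'S unfolding y_def
    by (metis bij_betw_def f_inv_into_f insert_subset)
  have x: "x \<in> P" using P by simp
  \<comment> \<open>The link from \<open>x\<close> to \<open>u\<close> on the image side reverses
    the image of the link from \<open>b\<close> to \<open>x\<close>. Its preimage has head
    \<open>u\<close>, and adjacency forces the tail \<open>b\<close>.\<close>
  have "y = b" using f_half_tadj[OF lb u(1) fb ly x fy lux'] P ux u by auto
  note lbu = ly[unfolded this] and fbu = fy[unfolded this]
  show lub: "A.link a u b" by (rule A.link_commute[OF lbu])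
  obtain v where v: "v \<in> P" "v \<noteq> a" "v \<noteq> b" "f (half P a u b) = half P' (s a) (s v) (s b)"
    "B.link (s a) (s v) (s b)"
    using f_half[OF lub] by metis
  have "v = x" using f_half_tadj[OF lub v(1,4,5) lbu x fbu lux'] P ux u by auto
  then show "f (half P a u b) = half P' (s a) (s x) (s b)" "B.link (s a) (s x) (s b)"
    using v by simp_all
  show "y = x \<or> y = u" if ly: "A.link a b y" for y
  proof (rule ccontr)
    assume n: "\<not> (y = x \<or> y = u)"
    obtain w where w: "w \<in> P" "w \<noteq> a" "w \<noteq> y" "f (half P a b y) = half P' (s a) (s w) (s y)"
      "B.link (s a) (s w) (s y)"
      using f_half[OF ly] by metis
    \<comment> \<open>The link from \<open>b\<close> to \<open>y\<close> shares its tail with the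
      links from \<open>b\<close> to \<open>x\<close> and to \<open>u\<close>, whose images have the
      different tails \<open>u\<close> and \<open>x\<close>.\<close>
    have "w = u" using f_half_tadj[OF ly w(1,4,5) lb u(1) fb] n by auto
    moreover have "w = x" using f_half_tadj[OF ly w(1,4,5) lbu x fbu lux'] n by auto
    ultimately show False using ux by simp
  qed
  show "y = b \<or> y = u" if ly: "A.link a x y" for y
  proof (rule ccontr)
    assume n: "\<not> (y = b \<or> y = u)"
    obtain w where w: "w \<in> P" "w \<noteq> a" "w \<noteq> y" "f (half P a x y) = half P' (s a) (s w) (s y)"
      "B.link (s a) (s w) (s y)"
      using f_half[OF ly] by metis
    have "w = u" using f_half_tadj[OF ly w(1,4,5) l u(1) fx lx'] n by auto
    moreover have "x \<noteq> y" using ly unfolding A.link_def by auto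
    \<comment> \<open>The image would share the tail \<open>u\<close> with the image of the link
      from \<open>b\<close> to \<open>x\<close>, but that link is not adjacent to the one from
      \<open>x\<close> to \<open>y\<close>.\<close>
    ultimately show False using f_half_tadj[OF ly w(1,4,5) lb u(1) fb] n P by auto
  qed
qed

text \<open>Even when \<open>f\<close> permutes the trees of a triangle of links, the links
  themselves correspond. This is what remains usable for four points.\<close>

lemma f_link:
  assumes l: "A.link a x b"
  shows "B.link (s a) (s x) (s b)"
proof -
  obtain u where u: "u \<in> P" "u \<noteq> a" "u \<noteq> b" "f (half P a x b) = half P' (s a) (s u) (s b)"
    "B.link (s a) (s u) (s b)"
    using f_half[OF l] by metis
  then show ?thesis using f_half_swapped(3)[OF l u(1-4)] by (cases "u = x") auto
qed

text \<open>A wrong tail \<open>u\<close> makes \<open>{b, x, u}\<close> closed under links at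
  \<open>a\<close>. With five points there is a further point besides these and \<open>a\<close>,
  against the connectedness of the links.\<close>

lemma f_half_eq:
  assumes l: "A.link a x b" and n: "5 \<le> card P"
  shows "f (half P a x b) = half P' (s a) (s x) (s b)"
proof -
  obtain u where u: "u \<in> P" "u \<noteq> a" "u \<noteq> b" "f (half P a x b) = half P' (s a) (s u) (s b)"
    using f_half[OF l] by metis
  have P: "{a, b, x} \<subseteq> P" "distinct [a, b, x]" using l unfolding A.link_def by auto
  show ?thesis
  proof (cases "u = x")
    case False
    note sw = f_half_swapped[OF l u(1-4) False]
    note sw' = f_half_swapped[OF sw(1) _ _ _ sw(2)]
    let ?K = "{b, x, u}"
    have "?K \<noteq> P - {a}"
    proof
      assume "?K = P - {a}"
      moreover have "card ?K \<le> 3" by (simp add: card_insert_if)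
      ultimately show False using n P A.finite_P by simp
    qed
    then obtain p y where py: "p \<in> ?K" "y \<in> P - {a} - ?K" "\<And>w. w \<in> P \<Longrightarrow> \<not> edges_cross {a, w} {p, y}"
      using A.link_connected[of a ?K] P u by auto
    then have "A.link a p y" using P u unfolding A.link_def by auto
    then have "y = b \<or> y = x \<or> y = u"
      using py(1) sw(4,5)[of y] sw'(5)[of y] P False by auto
    then show ?thesis using py(2) by blast
  qed (use u in simp)
qed

text \<open>If the image belongs to a wrong point \<open>u\<close>, then the image of the triangle of trees on the cycle
  \<open>a, u, x\<close> comes from three trees that differ only in a connector of one forest, and a fourth one would
  extend this maximal clique.\<close>

lemma f_dstar_step:
  assumes ab: "a \<in> P" "b \<in> P" "a \<noteq> b" and v: "A.valid a b I" "A.valid a b (insert x I)"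
    and x: "x \<in> P - {a, b} - I" and I0: "I \<noteq> {}"
    and top: "\<And>z. z \<in> I \<Longrightarrow> edges_cross {a, z} {b, x}"
    and fI: "f (dstar P a b I) = dstar P' (s a) (s b) (s ` I)"
  shows "f (dstar P a b (insert x I)) = dstar P' (s a) (s b) (s ` insert x I)"
proof -
  let ?T = "dstar P a b I" and ?T1 = "dstar P a b (insert x I)"
  let ?a = "s a" and ?b = "s b" and ?x = "s x" and ?I = "s ` I"
  let ?R = "dstar P' ?a ?b ?I"
  have I: "I \<subseteq> P - {a, b}" "insert x I \<subseteq> P - {a, b}" using v unfolding A.valid_def by auto
  have I': "?I \<subseteq> P' - {?a, ?b}" using I ab s_in s_eq by auto
  have ab': "?a \<in> P'" "?b \<in> P'" "?a \<noteq> ?b" using ab s_in s_eq by auto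
  have x': "?x \<in> P' - {?a, ?b} - ?I" using x ab I s_in s_eq by auto
  have fin: "finite I" using I(1) A.finite_P by (meson finite_Diff finite_subset)
  have cI: "card ?I = card I"
    by (rule card_image) (use I s_eq in \<open>auto simp: inj_on_def subset_iff\<close>)
  have T: "?T \<in> simple_spanning_trees P" "?T1 \<in> simple_spanning_trees P"
    using A.dstar_sst[OF ab I(1)] A.dstar_sst[OF ab I(2)] v by auto
  have R: "?R \<in> simple_spanning_trees P'" using f_sst[OF T(1)] fI by simp
  have T1: "?T1 = swap ?T {a, x} {b, x}" by (rule dstar_insert[OF ab I(1) x])
  have Te: "{a, x} \<in> ?T" "{x, b} \<notin> ?T" "{b, x} \<notin> ?T" "{a, b} \<in> ?T"
    using x ab I unfolding dstar_edge[OF ab I(1)] by auto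
  have TT1: "tadj P ?T ?T1" using A.tadj_swap[OF T(1) Te(1,3)] T(2) T1 by simp
  obtain J where J: "J \<subseteq> P' - {?a, ?b}" "card J = card (insert x I)" "f ?T1 = dstar P' ?a ?b J"
    using f_dstar[OF ab v(2)] by metis
  have "tadj P' ?R (dstar P' ?a ?b J)" using f_tadj[OF TT1] fI J(3) by simp
  moreover have "card J = Suc (card ?I)" using J(2) cI fin x by simp
  ultimately obtain u where u: "u \<in> P' - {?a, ?b} - ?I" "J = insert u ?I"
    using B.dstar_tadj_insert[OF ab' I' J(1)] by metis
  show ?thesis
  proof (cases "u = ?x")
    case True
    then show ?thesis using J(3) u(2) by simp
  next
    case ux: False
    have R1: "f ?T1 = swap ?R {?a, u} {?b, u}"
      using J(3) u dstar_insert[OF ab' I'] by metis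
    have Re: "{?a, u} \<in> ?R" "{?b, u} \<notin> ?R" "{?a, ?x} \<in> ?R" "{u, ?x} \<notin> ?R"
      using u(1) x' ab' ux unfolding dstar_edge[OF ab' I'] by auto
    have leaf: "y = ?a" if "{u, y} \<in> ?R" for y
      using that u(1) ab' unfolding dstar_edge[OF ab' I'] by auto
    have leafx: "{?x, y} \<in> ?R \<Longrightarrow> y = ?a" for y
      using x' ab' unfolding dstar_edge[OF ab' I'] by auto

    \<comment> \<open>\<open>?T\<close>, \<open>?T1\<close> and \<open>?T2\<close> arise from one
      graph by deleting one edge each of the cycle \<open>a\<close>, \<open>x\<close>,
      \<open>b\<close>.\<close>
    let ?T2 = "swap ?T {a, b} {x, b}"
    have T1S: "swap ?T {a, x} {b, x} \<in> simple_spanning_trees P" using T(2) T1 by simp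
    have T2: "?T2 \<in> simple_spanning_trees P"
    proof (rule A.sst_swap[OF T(1) Te(4) _ Te(2)])
      show "{x, b} \<in> complete_edges P" using x ab by (auto simp: complete_edges_iff)
      have "{a, x} \<in> ?T2" "{x, b} \<in> ?T2" using Te x by (auto simp: swap_def doubleton_eq_iff)
      then show "conn ?T2 a b" by (rule conn_trans[OF conn_edge conn_edge])
      have "\<not> edges_cross {x, b} {a, x}" using edges_cross_disjoint[of "{x, b}" "{a, x}"] by blast
      then show "clear (?T - {{a, b}}) {x, b}"
        using A.sst_swap_clear[OF T1S] unfolding clear_def by (auto simp: insert_commute)
    qed
    note TT2 = A.tadj_swap[OF T(1) Te(4,2) T2]
    have T1T2: "tadj P ?T1 ?T2"
      using A.tadj_swap_swap[OF Te(1,3) Te(4,2) T1S T2] T1 x by (auto simp: doubleton_eq_iff)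
    have bistar: "A.bistar a b x I {} = ?T2"
    proof -
      have 1: "P - {a, b} - I = insert x (P - {a, b, x} - I - {})" using x by blast
      have "?T = insert {a, b} (insert {a, x} ((\<lambda>z. {a, z}) ` (P - {a, b, x} - I - {}) \<union> (\<lambda>z. {b, z}) ` I))"
        unfolding dstar_def 1 image_insert by simp
      moreover have "{a, b} \<noteq> {a, x}" "{a, b} \<notin> (\<lambda>z. {a, z}) ` (P - {a, b, x} - I - {})"
        "{a, b} \<notin> (\<lambda>z. {b, z}) ` I" using x ab I by (auto simp: doubleton_eq_iff)
      ultimately show ?thesis unfolding swap_def A.bistar_def by (auto simp: insert_commute)
    qed
    have "dist_le P (card P - 3 - card ({} :: (real ^ 2) set)) (A.bistar a b x I {}) (star P x)"
      by (rule A.bistar_dist) (use x ab I top T2 bistar in auto)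
    then have dist: "dist_le P (card P - 3) ?T2 (star P x)" using bistar by simp

    let ?Z = "f ?T2"
    have ZS: "?Z \<in> simple_spanning_trees P'" by (rule f_sst[OF T2])
    have "card (star P' ?x - ?Z) \<le> card P' - 3"
      using f_star_degree[OF dist] x card_eq by simp
    moreover have "card P' = Suc (card (star P' ?x \<inter> ?Z) + card (star P' ?x - ?Z))"
    proof -
      have "finite (star P' ?x)" unfolding star_def using B.finite_P by auto
      then show ?thesis using card_star[OF B.finite_P, of ?x] x' card_Int_Diff[of "star P' ?x" ?Z] by auto
    qed
    moreover have "3 \<le> card P'"
    proof -
      have "card {a, b, x} \<le> card P" using x ab A.finite_P by (intro card_mono) auto
      then show ?thesis using x ab card_eq by (auto simp: card_insert_if split: if_splits)
    qed
    \<comment> \<open>The star of \<open>?x\<close> has \<open>card P' - 1\<close> edges, and at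
      most \<open>card P' - 3\<close> of them are missing in \<open>?Z\<close>.\<close>
    ultimately have deg: "2 \<le> card (star P' ?x \<inter> ?Z)" by linarith
    have "\<exists>g\<in>star P' ?x \<inter> ?Z. g \<noteq> {?a, ?x}"
    proof (rule ccontr)
      assume "\<not> (\<exists>g\<in>star P' ?x \<inter> ?Z. g \<noteq> {?a, ?x})"
      then have "star P' ?x \<inter> ?Z \<subseteq> {{?a, ?x}}" by blast
      from card_mono[OF _ this] deg show False by simp
    qed
    then obtain w where w: "{?x, w} \<in> ?Z" "{?x, w} \<notin> ?R"
      using leafx unfolding star_def by (auto simp: insert_commute)
    have RZ: "tadj P' ?R ?Z" using f_tadj[OF TT2] fI by simp
    have R1Z: "tadj P' (swap ?R {?a, u} {?b, u}) ?Z" using f_tadj[OF T1T2] R1 by simp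
    \<comment> \<open>\<open>?x\<close> is a leaf of \<open>?R\<close>, so its second edge in
      \<open>?Z\<close> is the inserted one. In the first case this edge must also attach
      \<open>u\<close> again; in the second it would be \<open>{?b, u}\<close>, which misses
      \<open>?x\<close>.\<close>
    have Z: "?Z = swap ?R {?a, u} {u, ?x}"
    proof (rule B.common_neighbour[OF Re(1,2) RZ R1Z])
      fix h assume h: "h \<notin> ?R" "h \<noteq> {?b, u}" "?Z = swap ?R {?a, u} h"
      have "h = {?x, w}" using w h(3) unfolding swap_def by auto
      moreover obtain y where "h = {u, y}"
        using B.swap_leaf[OF R Re(1) leaf, of h] h(3) ZS by metis
      ultimately have "h = {u, ?x}" using ux by (auto simp: doubleton_eq_iff)
      then show ?thesis using h(3) by simp
    next
      fix h assume h: "h \<in> ?R" "h \<noteq> {?a, u}" "?Z = swap ?R h {?b, u}"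
      then have "{?x, w} = {?b, u}" using w unfolding swap_def by auto
      then show ?thesis using ux x' by (auto simp: doubleton_eq_iff)
    qed
    \<comment> \<open>The third tree on the cycle \<open>?a\<close>, \<open>u\<close>,
      \<open>?x\<close>; its preimage \<open>Y\<close> is not yet known.\<close>
    let ?W = "swap ?R {?a, ?x} {u, ?x}"
    have W: "?W \<in> simple_spanning_trees P'"
    proof (rule B.sst_swap[OF R Re(3) _ Re(4)])
      show "{u, ?x} \<in> complete_edges P'" using u x' ux by (auto simp: complete_edges_iff)
      have "{?a, u} \<in> ?W" "{u, ?x} \<in> ?W" using Re ux by (auto simp: swap_def doubleton_eq_iff)
      then show "conn ?W ?a ?x" by (rule conn_trans[OF conn_edge conn_edge])
      have "\<not> edges_cross {u, ?x} {?a, u}" using edges_cross_disjoint[of "{u, ?x}" "{?a, u}"] by blast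
      then show "clear (?R - {{?a, ?x}}) {u, ?x}"
        using B.sst_swap_clear[of ?R "{?a, u}" "{u, ?x}"] ZS Z unfolding clear_def by auto
    qed
    have neu: "{?a, u} \<noteq> {?a, ?x}" using ux by (auto simp: doubleton_eq_iff)
    have ZW: "tadj P' ?Z ?W"
      using B.tadj_swap_swap[OF Re(1,4) Re(3,4)] ZS W Z neu by simp
    obtain Y where Y: "Y \<in> simple_spanning_trees P" "f Y = ?W"
      using W bij_f by (metis bij_betw_def imageE)
    have TY: "tadj P ?T Y"
      using adj_f[OF T(1) Y(1)] fI Y(2) B.tadj_swap[OF R Re(3,4) W] by simp
    have T2Y: "tadj P ?T2 Y" using adj_f[OF T2 Y(1)] Y(2) ZW by simp
    have "Y \<noteq> ?T1"
      using Y(2) R1 swap_eq_iff[OF Re(1,2) Re(3,4)] neu by auto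
    \<comment> \<open>In the other case \<open>Y\<close> would be \<open>?T1\<close> or contain the
      cycle \<open>a\<close>, \<open>x\<close>, \<open>b\<close>.\<close>
    obtain g where g: "g \<notin> ?T" "Y = swap ?T {a, b} g"
    proof (rule A.common_neighbour[OF Te(4,2) TY T2Y])
      fix h assume h: "h \<in> ?T" "h \<noteq> {a, b}" "Y = swap ?T h {x, b}"
      have "h = {a, x}"
      proof (rule ccontr)
        assume "h \<noteq> {a, x}"
        then have "{a, x} \<in> Y" "{x, b} \<in> Y" "{a, b} \<in> Y" using h Te unfolding swap_def by auto
        then show False using A.sst_no_triangle[OF Y(1)] by blast
      qed
      then show ?thesis using h(3) T1 \<open>Y \<noteq> ?T1\<close> by (simp add: insert_commute)
    qed blast
    \<comment> \<open>The leaves \<open>x\<close> at \<open>a\<close> and \<open>z\<close> at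
      \<open>b\<close> make \<open>ab\<close> an inner edge, as the count of connectors
      requires.\<close>
    obtain z where z: "z \<in> I" using I0 by blast
    have Tb: "{a, x} \<in> ?T" "x \<noteq> b" "{b, z} \<in> ?T" "z \<noteq> a"
      using x z I ab unfolding dstar_edge[OF ab I(1)] by auto
    define F where "F = ?T - {{a, b}}"
    define S where "S = {v \<in> P. conn F a v}"
    note bis = A.bisects_internal[OF T(1) Te(4) Tb, folded F_def, folded S_def]
    note K = A.connector_swap[OF T(1) Te(4), folded F_def, folded S_def]
    have "g \<in> connectors F S (P - S)" using K[OF g(1)] g(2) Y(1) by blast
    then obtain k where k: "k \<in> connectors F S (P - S)" "k \<noteq> g" "k \<noteq> {a, b}" "k \<noteq> {x, b}"
      using A.fourth_connector[OF bis(1), of g "{a, b}" "{x, b}"] by metis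
    have kT: "k \<notin> ?T"
    proof
      assume "k \<in> ?T"
      then have "k \<in> F" using k(3) unfolding F_def by blast
      obtain p q where pq: "k = {p, q}" "p \<in> S" "q \<in> P - S" using k(1) unfolding connectors_def by blast
      then have "{p, q} \<in> F" using \<open>k \<in> F\<close> by simp
      then show False using bisects_edge(4)[OF bis(1)] pq(2,3) by blast
    qed
    let ?V = "swap ?T {a, b} k"
    have V: "?V \<in> simple_spanning_trees P" using K[OF kT] k(1) by blast
    have TV: "tadj P ?T ?V" by (rule A.tadj_swap[OF T(1) Te(4) kT V])
    have T2V: "tadj P ?T2 ?V" using A.tadj_swap_swap[OF Te(4,2) Te(4) kT T2 V] k(4) by auto
    have YV: "tadj P Y ?V" using A.tadj_swap_swap[OF Te(4) g(1) Te(4) kT _ V] g(2) Y(1) k(2) by auto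
    have V': "f ?V \<in> simple_spanning_trees P'" by (rule f_sst[OF V])
    have RV: "tadj P' ?R (f ?V)" "tadj P' (swap ?R {?a, u} {u, ?x}) (f ?V)" "tadj P' ?W (f ?V)"
      using f_tadj[OF TV] f_tadj[OF T2V] f_tadj[OF YV] fI Z Y(2) by auto
    \<comment> \<open>No tree is adjacent to all three trees on the cycle \<open>?a\<close>,
      \<open>u\<close>, \<open>?x\<close>: in the first case it agrees with \<open>?W\<close> in
      neither exchanged edge, in the second it contains the cycle.\<close>
    show ?thesis
    proof (rule B.common_neighbour[OF Re(1,4) RV(1,2)])
      fix h assume h: "h \<notin> ?R" "h \<noteq> {u, ?x}" "f ?V = swap ?R {?a, u} h"
      then show ?thesis
        using B.tadj_swap_swap[OF Re(3,4) Re(1) h(1) W] RV(3) V' neu by auto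
    next
      fix h assume h: "h \<in> ?R" "h \<noteq> {?a, u}" "f ?V = swap ?R h {u, ?x}"
      have "h \<noteq> {?a, ?x}" using tadj_neq[OF RV(3)] h(3) by blast
      then have "{?a, u} \<in> f ?V" "{u, ?x} \<in> f ?V" "{?a, ?x} \<in> f ?V"
        using h Re unfolding swap_def by auto
      then show ?thesis using B.sst_no_triangle[OF V'] by blast
    qed
  qed
qed

lemma f_dstar_eq:
  assumes n: "5 \<le> card P" and ab: "a \<in> P" "b \<in> P" "a \<noteq> b" and v: "A.valid a b J"
  shows "f (dstar P a b J) = dstar P' (s a) (s b) (s ` J)"
  using v
proof (induction "card J" arbitrary: J)
  case 0
  then have "finite J" using A.finite_P unfolding A.valid_def by (meson finite_Diff finite_subset)
  then have J: "J = {}" using 0 by simp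
  have "s a \<noteq> s b" "s b \<in> P'" using ab s_eq s_in by auto
  then show ?case
    using J f_star[OF ab(1)] dstar_empty[OF ab(3,2)] dstar_empty[of "s a" "s b" P'] by simp
next
  case (Suc k)
  have JP: "J \<subseteq> P - {a, b}" using Suc.prems unfolding A.valid_def by blast
  have finJ: "finite J" using Suc.hyps(2) by (metis card.infinite nat.distinct(1))
  obtain x0 where "x0 \<in> J" using Suc.hyps(2) by (metis card.empty equals0I nat.distinct(1))
  then obtain x where x: "x \<in> J" "A.valid a b (J - {x})"
    using A.valid_remove_above[OF Suc.prems ab(1,2)] by metis
  have J: "J = insert x (J - {x})" using x(1) by blast
  have ab': "s a \<in> P'" "s b \<in> P'" "s a \<noteq> s b" using ab s_in s_eq by auto
  have IH: "f (dstar P a b (J - {z})) = dstar P' (s a) (s b) (s ` (J - {z}))"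
    if "z \<in> J" "A.valid a b (J - {z})" for z
    using Suc.hyps(1)[OF _ that(2)] Suc.hyps(2) that(1) finJ by simp
  show ?case
  proof (cases "J - {x} = {}")
    case True
    then have Jx: "J = {x}" using x(1) by blast
    have P: "{a, b, x} \<subseteq> P" "distinct [a, b, x]" using JP x(1) ab by auto
    have P': "{s a, s b, s x} \<subseteq> P'" "distinct [s a, s b, s x]" using P s_in s_eq by auto
    have "A.link a x b" using A.link_valid[OF P] Suc.prems Jx by simp
    from f_half_eq[OF this n] show ?thesis
      unfolding half_dstar[OF P] half_dstar[OF P'] Jx by simp
  next
    case ne: False
    show ?thesis
    proof (cases "\<forall>z\<in>J - {x}. edges_cross {a, z} {b, x}")
      case True
      have "x \<in> P - {a, b} - (J - {x})" using x(1) JP by blast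
      moreover have "A.valid a b (insert x (J - {x}))"
        using Suc.prems x(1) by (simp add: insert_absorb)
      ultimately have "f (dstar P a b (insert x (J - {x}))) = dstar P' (s a) (s b) (s ` insert x (J - {x}))"
        using f_dstar_step[OF ab x(2) _ _ ne _ IH[OF x]] True by blast
      then show ?thesis unfolding J[symmetric] .
    next
      case False
      then obtain y where y: "y \<in> J" "y \<noteq> x" "\<not> edges_cross {a, y} {b, x}" by blast
      obtain z where z: "z \<in> J" "z = y \<or> edges_cross {a, y} {b, z}" "A.valid a b (J - {z})"
        using A.valid_remove_above[OF Suc.prems ab(1,2) y(1)] by metis
      \<comment> \<open>\<open>z\<close> is \<open>y\<close> or lies above \<open>y\<close>, and
        \<open>x\<close> does neither.\<close>
      have zx: "z \<noteq> x" using z(2) y by blast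
      obtain J' where J': "J' \<subseteq> P' - {s a, s b}" "card J' = card J"
        "f (dstar P a b J) = dstar P' (s a) (s b) J'"
        using f_dstar[OF ab Suc.prems] by metis
      have sub: "s ` (J - {w}) \<subseteq> J'" if w: "w \<in> J" "A.valid a b (J - {w})" for w
      proof -
        have c: "card J' = Suc (card (s ` (J - {w})))"
        proof -
          have "inj_on s (J - {w})" using JP s_eq by (auto simp: inj_on_def subset_iff)
          then show ?thesis using J'(2) w(1) finJ Suc.hyps(2) by (simp add: card_image)
        qed
        have I': "s ` (J - {w}) \<subseteq> P' - {s a, s b}" using JP ab s_in s_eq by auto
        have "tadj P' (dstar P' (s a) (s b) (s ` (J - {w}))) (dstar P' (s a) (s b) J')"
          using f_tadj[OF A.dstar_remove_tadj[OF ab Suc.prems w(2,1)]] IH[OF w] J'(3) tadj_sym by simp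
        then obtain u where "J' = insert u (s ` (J - {w}))"
          by (rule B.dstar_tadj_insert[OF ab' I' J'(1) _ c])
        then show ?thesis by blast
      qed
      have "s ` J \<subseteq> J'"
        using sub[OF x] sub[OF z(1,3)] zx by blast
      moreover have "card (s ` J) = card J'"
      proof -
        have "inj_on s J" using JP s_eq by (auto simp: inj_on_def subset_iff)
        then show ?thesis using J'(2) by (simp add: card_image)
      qed
      moreover have "finite J'" using J'(1) B.finite_P by (meson finite_Diff finite_subset)
      ultimately have "s ` J = J'" by (metis card_subset_eq)
      then show ?thesis using J'(3) by simp
    qed
  qed
qed

text \<open>The principal ideal of \<open>d\<close> omits \<open>c\<close>, so its double star
  contains \<open>ac\<close> and \<open>bd\<close>, and its image contains both image segments.
  Among four points, \<open>c\<close> is the only point that can violate the link of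
  \<open>d\<close> and \<open>b\<close> at \<open>a\<close>, so \<open>f_link\<close>
  suffices.\<close>

lemma noncross_image:
  assumes P: "{a, b, c, d} \<subseteq> P" "distinct [a, b, c, d]" and nc: "\<not> edges_cross {a, c} {b, d}"
  shows "\<not> edges_cross {s a, s c} {s b, s d}"
proof (cases "5 \<le> card P")
  case True
  have ab: "a \<in> P" "b \<in> P" "a \<noteq> b" using P by auto
  have ab': "s a \<in> P'" "s b \<in> P'" "s a \<noteq> s b" using ab s_in s_eq by auto
  define I where "I = {w \<in> P - {a, b}. w = d \<or> edges_cross {a, w} {b, d}}"
  have I: "I \<subseteq> P - {a, b}" unfolding I_def by blast
  have "\<not> edges_cross {a, x} {b, z}" if "x \<in> P - {a, b} - I" "z \<in> I" for x z
    using that A.order_trans[of a b x z d] P unfolding I_def by auto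
  then have v: "A.valid a b I" using I unfolding A.valid_def by blast
  have "f (dstar P a b I) \<in> simple_spanning_trees P'" using f_sst A.dstar_sst[OF ab I] v by blast
  then have S: "dstar P' (s a) (s b) (s ` I) \<in> simple_spanning_trees P'"
    using f_dstar_eq[OF True ab v] by simp
  have I': "s ` I \<subseteq> P' - {s a, s b}" using I ab s_in s_eq by auto
  have "d \<in> I" "c \<notin> I" using P nc unfolding I_def by auto
  then have "s d \<in> s ` I" "s c \<in> P' - {s a} - s ` I" using I P s_in s_eq by auto
  then have "{s a, s c} \<in> dstar P' (s a) (s b) (s ` I)" "{s b, s d} \<in> dstar P' (s a) (s b) (s ` I)"
    unfolding dstar_edge[OF ab' I'] by auto
  then show ?thesis by (rule B.sst_noncross[OF S])
next
  case False
  have "card {a, b, c, d} = 4" using P(2) by simp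
  then have PE: "P = {a, b, c, d}"
    using card_seteq[OF A.finite_P P(1)] False by simp
  have 1: "\<not> edges_cross {a, w} {d, b}" if "w = a \<or> w = b \<or> w = d" for w
    using edges_cross_disjoint[of "{a, w}" "{d, b}"] edges_cross_iff[of a w d b] that by auto
  have 2: "\<not> edges_cross {a, c} {d, b}" using nc by (simp add: insert_commute)
  have "\<not> edges_cross {a, w} {d, b}" if "w \<in> P" for w
    using that 1[of w] 2 unfolding PE by blast
  then have "A.link a d b" using P unfolding A.link_def by auto
  then have "B.link (s a) (s d) (s b)" by (rule f_link)
  moreover have "s c \<in> P'" using s_in P by simp
  ultimately have "\<not> edges_cross {s a, s c} {s d, s b}" unfolding B.link_def by blast
  moreover have "{s d, s b} = {s b, s d}" by blast
  ultimately show ?thesis by simp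
qed

lemma cross_iff:
  assumes P: "{a, b, c, d} \<subseteq> P" "distinct [a, b, c, d]"
  shows "edges_cross {a, b} {c, d} \<longleftrightarrow> edges_cross {s a, s b} {s c, s d}"
proof -
  interpret I: tree_graph_iso P' P "inv_into (simple_spanning_trees P) f" "inv_into P s"
    by (rule inverse)
  have inv_s: "inv_into P s (s v) = v" if "v \<in> P" for v
    using bij_s that by (simp add: bij_betw_def)
  have "{s a, s c, s b, s d} \<subseteq> P'" "distinct [s a, s c, s b, s d]" using P s_in s_eq by auto
  from I.noncross_image[OF this] have "\<not> edges_cross {s a, s b} {s c, s d} \<Longrightarrow> \<not> edges_cross {a, b} {c, d}"
    using inv_s P by simp
  moreover have "\<not> edges_cross {a, b} {c, d} \<Longrightarrow> \<not> edges_cross {s a, s b} {s c, s d}"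
    by (rule noncross_image) (use P in auto)
  ultimately show ?thesis by blast
qed

end

section \<open>Matching the stars, and point sets too small for them to be distinct\<close>

lemma starlike_transfer:
  assumes f: "bij_betw f V V'" and T: "T \<in> V"
    and V: "\<And>T U. adj T U \<Longrightarrow> U \<in> V" "\<And>T U. adj' T U \<Longrightarrow> U \<in> V'"
    and adj: "\<And>T U. T \<in> V \<Longrightarrow> U \<in> V \<Longrightarrow> adj' (f T) (f U) \<longleftrightarrow> adj T U"
  shows "starlike adj' (f T) \<longleftrightarrow> starlike adj T"
proof -
  have onto: "\<exists>U\<in>V. U' = f U" if "U' \<in> V'" for U'
    using f that by (auto simp: bij_betw_def)
  have nbr: "(\<exists>r'. adj' (f T) r' \<and> Q r') \<longleftrightarrow> (\<exists>r. adj T r \<and> Q (f r))" for Q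
    using onto V adj[OF T] by metis
  have nbr_all: "(\<forall>p'. adj' (f T) p' \<longrightarrow> Q p') \<longleftrightarrow> (\<forall>p. adj T p \<longrightarrow> Q (f p))" for Q
    using onto V adj[OF T] by metis
  have common: "(\<exists>r. adj T r \<and> adj' (f p) (f r) \<and> adj' (f q) (f r)) \<longleftrightarrow>
      (\<exists>r. adj T r \<and> adj p r \<and> adj q r)" if "p \<in> V" "q \<in> V" for p q
  proof (rule ex_cong1)
    fix r
    show "adj T r \<and> adj' (f p) (f r) \<and> adj' (f q) (f r) \<longleftrightarrow> adj T r \<and> adj p r \<and> adj q r"
      using V(1)[of T r] adj[OF that(1), of r] adj[OF that(2), of r] by (cases "adj T r") simp_all
  qed
  have "(\<exists>q. adj T q \<and> adj' (f p) (f q) \<and>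
        \<not> (\<exists>r. adj T r \<and> adj' (f p) (f r) \<and> adj' (f q) (f r))) \<longleftrightarrow>
      (\<exists>q. adj T q \<and> adj p q \<and> \<not> (\<exists>r. adj T r \<and> adj p r \<and> adj q r))"
    if p: "p \<in> V" for p
  proof (rule ex_cong1)
    fix q
    show "adj T q \<and> adj' (f p) (f q) \<and>
        \<not> (\<exists>r. adj T r \<and> adj' (f p) (f r) \<and> adj' (f q) (f r)) \<longleftrightarrow>
      adj T q \<and> adj p q \<and> \<not> (\<exists>r. adj T r \<and> adj p r \<and> adj q r)"
      using V(1)[of T q] adj[OF p, of q] common[OF p, of q] by (cases "adj T q") simp_all
  qed
  then show ?thesis
    unfolding starlike_def nbr_all nbr using V(1) by simp
qed

lemma star_inj:
  assumes "finite P" "3 \<le> card P" "a \<in> P" "b \<in> P" "star P a = star P b"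
  shows "a = b"
proof (rule ccontr)
  assume "a \<noteq> b"
  then have "P \<noteq> {a, b}" using assms(2) by auto
  then obtain c where c: "c \<in> P" "c \<noteq> a" "c \<noteq> b" using assms(3,4) by blast
  then have "{a, c} \<in> star P b" using assms(3,5) star_edge[OF assms(3), of a c] by simp
  then show False using \<open>a \<noteq> b\<close> c(3) star_edge[OF assms(4), of a c] by simp
qed

lemma (in points) small_unique:
  assumes "card P \<le> 2" "T \<in> simple_spanning_trees P" "U \<in> simple_spanning_trees P"
  shows "T = U"
proof -
  have star: "\<exists>a\<in>P. T = star P a" if T: "T \<in> simple_spanning_trees P" for T
  proof (rule ccontr)
    assume "\<not> (\<exists>a\<in>P. T = star P a)"
    then obtain b c b' where bc: "{b, c} \<in> T" "{b, b'} \<in> T" "b' \<noteq> c"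
      using internal_edge[OF T] by metis
    then have "{b, c, b'} \<subseteq> P" "card {b, c, b'} = 3" using sst_edge[OF T] by auto
    then show False using card_mono[OF finite_P, of "{b, c, b'}"] assms(1) by simp
  qed
  obtain a b where ab: "a \<in> P" "b \<in> P" "T = star P a" "U = star P b" using star assms(2,3) by metis
  show ?thesis
  proof (cases "a = b")
    case False
    then have "{a, b} = P" using card_seteq[OF finite_P, of "{a, b}"] ab assms(1) by simp
    then have "star P a = {{a, b}}" "star P b = {{a, b}}"
      using False unfolding star_def by auto
    then show ?thesis using ab by simp
  qed (use ab in simp)
qed

text \<open>One point and two points both have exactly one tree, so the tree graph cannot tell them
  apart; the assumption on the cardinalities excludes this pair. With at most two points on each
  side no four distinct points exist, and any bijection will do.\<close>

theorem theorem1: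
  fixes P P' :: "(real ^ 2) set"
  assumes "finite P" and "finite P'"
    and "general_position P" and "general_position P'"
    and "{card P, card P'} \<noteq> {1, 2}"
    and "graph_iso (geometric_tree_graph P) (geometric_tree_graph P')"
  shows "\<exists>\<sigma>. bij_betw \<sigma> P P' \<and>
           (\<forall>a\<in>P. \<forall>b\<in>P. \<forall>c\<in>P. \<forall>d\<in>P. distinct [a, b, c, d] \<longrightarrow>
              (edges_cross {a, b} {c, d} \<longleftrightarrow> edges_cross {\<sigma> a, \<sigma> b} {\<sigma> c, \<sigma> d}))"
proof -
  interpret A: points P by unfold_locales fact+
  interpret B: points P' by unfold_locales fact+
  let ?V = "simple_spanning_trees P" and ?V' = "simple_spanning_trees P'"
  obtain f where f: "bij_betw f ?V ?V'"
    and adj: "\<And>T U. T \<in> ?V \<Longrightarrow> U \<in> ?V \<Longrightarrow> tadj P' (f T) (f U) \<longleftrightarrow> tadj P T U"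
  proof -
    have "fst (geometric_tree_graph P) = ?V" "fst (geometric_tree_graph P') = ?V'"
      unfolding geometric_tree_graph_def by simp_all
    then show ?thesis using assms(6) that unfolding graph_iso_def tadj_graph by metis
  qed
  have small: "Q = {} \<longleftrightarrow> simple_spanning_trees Q = {}" if "points Q" for Q
  proof -
    interpret points Q by fact
    show ?thesis using star_sst sst_nonempty by auto
  qed
  have large: "\<exists>T\<in>simple_spanning_trees Q. \<exists>U\<in>simple_spanning_trees Q. T \<noteq> U"
    if "points Q" "3 \<le> card Q" for Q
  proof -
    interpret points Q by fact
    have "\<not> card Q \<le> 1" using that(2) by simp
    then obtain a b where "a \<in> Q" "b \<in> Q" "a \<noteq> b" using card_le_Suc0_iff_eq[OF finite_P] by auto
    then have "star Q a \<noteq> star Q b" using star_inj[OF finite_P that(2)] by metis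
    then show ?thesis using star_sst \<open>a \<in> Q\<close> \<open>b \<in> Q\<close> by metis
  qed
  show ?thesis
  proof (cases "3 \<le> card P")
    case False
    then have "card P \<le> 2" by simp
    have single: "T = U" if TU: "T \<in> ?V'" "U \<in> ?V'" for T U
    proof -
      have "?V' = f ` ?V" using f by (simp add: bij_betw_def)
      then have "T \<in> f ` ?V" "U \<in> f ` ?V" using TU by simp_all
      then obtain T0 U0 where "T0 \<in> ?V" "U0 \<in> ?V" "T = f T0" "U = f U0"
        by (elim imageE)
      then show ?thesis using A.small_unique[OF \<open>card P \<le> 2\<close>, of T0 U0] by simp
    qed
    have "card P' \<le> 2"
    proof (rule ccontr)
      assume "\<not> card P' \<le> 2"
      then have "3 \<le> card P'" by simp
      from large[OF B.points_axioms this] show False using single by metis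
    qed
    moreover have "P = {} \<longleftrightarrow> P' = {}"
      using small[OF A.points_axioms] small[OF B.points_axioms] f
      by (metis bij_betw_def image_is_empty)
    then have "card P = 0 \<longleftrightarrow> card P' = 0" using assms(1,2) by simp
    ultimately have "card P = card P'"
      using \<open>card P \<le> 2\<close> assms(5) by (auto simp: le_Suc_eq numeral_2_eq_2 insert_commute)
    then obtain g where g: "bij_betw g P P'"
      using finite_same_card_bij[OF assms(1,2)] by blast
    have "\<not> distinct [a, b, c, d]" if "a \<in> P" "b \<in> P" "c \<in> P" "d \<in> P" for a b c d
    proof
      assume "distinct [a, b, c, d]"
      then have "card {a, b, c, d} = 4" by simp
      then show False
        using card_mono[OF assms(1), of "{a, b, c, d}"] that \<open>card P \<le> 2\<close> by simp
    qed
    then show ?thesis using g by blast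
  next
    case True
    have "card P' \<ge> 3"
    proof (rule ccontr)
      assume "\<not> 3 \<le> card P'"
      then have small': "card P' \<le> 2" by simp
      have "T = U" if TU: "T \<in> ?V" "U \<in> ?V" for T U
      proof -
        have "f T = f U"
          by (rule B.small_unique[OF small']) (use TU f in \<open>auto simp: bij_betw_def\<close>)
        then show ?thesis using f TU by (meson bij_betw_def inj_onD)
      qed
      then show False using large[OF A.points_axioms True] by blast
    qed
    have starlike: "starlike (tadj P') (f T) \<longleftrightarrow> starlike (tadj P) T" if "T \<in> ?V" for T
      by (rule starlike_transfer[OF f that]) (auto simp: adj, auto simp: tadj_def)
    have "\<exists>a'\<in>P'. f (star P a) = star P' a'" if a: "a \<in> P" for a
    proof -
      have "f (star P a) \<in> ?V'" using A.star_sst[OF a] f by (auto simp: bij_betw_def)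
      then show ?thesis
        using starlike[OF A.star_sst[OF a]] A.starlike_star[OF a] B.starlike_iff by blast
    qed
    then obtain s where s: "\<And>a. a \<in> P \<Longrightarrow> s a \<in> P' \<and> f (star P a) = star P' (s a)"
      by metis
    have "inj_on s P"
    proof (rule inj_onI)
      fix a b assume ab: "a \<in> P" "b \<in> P" "s a = s b"
      then have "f (star P a) = f (star P b)" using s by metis
      then have "star P a = star P b"
        using A.star_sst[OF ab(1)] A.star_sst[OF ab(2)] f by (auto simp: bij_betw_def inj_on_def)
      then show "a = b" by (rule star_inj[OF assms(1) True ab(1,2)])
    qed
    moreover have "a' \<in> s ` P" if a': "a' \<in> P'" for a'
    proof -
      obtain T where T: "T \<in> ?V" "f T = star P' a'"
        using B.star_sst[OF a'] f by (metis bij_betw_def imageE)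
      then have "starlike (tadj P) T" using starlike B.starlike_star[OF a'] by metis
      then obtain a where a: "a \<in> P" "T = star P a" using A.starlike_iff[OF T(1)] by blast
      then have "star P' (s a) = star P' a'" using s T(2) by metis
      then have "s a = a'" using star_inj[OF assms(2) \<open>3 \<le> card P'\<close> _ a'] s a(1) by blast
      then show ?thesis using a(1) by blast
    qed
    ultimately have bij: "bij_betw s P P'" unfolding bij_betw_def using s by blast
    interpret tree_graph_iso P P' f s
      by unfold_locales (use f adj bij s in auto)
    show ?thesis using bij cross_iff by (intro exI[of _ s]) auto
  qed
qed

end
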